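(* Let $(M,\{,\ldots,\})$ be a Nambu-Poisson manifold of order $n$ with Nambu tensor $\Pi$, let $N\subset M$ be a submanifold, and let $E\subseteq TM|_N$ be a canonical vector subbundle such that $F:=E\cap TN$ is a regular, integrable distribution on $N$ and such that the restriction map $i^*:C^\infty(M)_E\to C^\infty(N)_F$ is surjective. (1) If $E\neq 0$, then $(M,N,E)$ is reducible. (2) If $E=0$, then $(M,N,E)$ is reducible if and only if $\Pi^\sharp(\Lambda^{n-1}T_p^*M)\subseteq T_pN$ for all $p\in N$, that is, if and only if $N$ is a Nambu-Poisson submanifold of $M$.
   Context: A Nambu-Poisson manifold of order $n$ is a smooth manifold $M$ ($n\le\dim M$) with an $n$-multilinear skew-symmetric bracket $\{,\ldots,\}$ on $C^\infty(M)$ satisfying the Leibniz rule $\{f_1,\ldots,f_{n-1},gh\}=g\{f_1,\ldots,f_{n-1},h\}+\{f_1,\ldots,f_{n-1},g\}h$ and the fundamental identity $\{g_1,\ldots,g_{n-1},\{f_1,\ldots,f_n\}\}=\sum_{k=1}^n\{f_1,\ldots,f_{k-1},\{g_1,\ldots,g_{n-1},f_k\},\ldots,f_n\}$. The Nambu tensor $\Pi\in\Gamma(\Lambda^nTM)$ is defined by $\Pi(df_1,\ldots,df_n)=\{f_1,\ldots,f_n\}$, and $\Pi^\sharp:\Lambda^{n-1}T^*M\to TM$ by $\langle\beta,\Pi^\sharp(\alpha_1\wedge\cdots\wedge\alpha_{n-1})\rangle=\Pi(\alpha_1,\ldots,\alpha_{n-1},\beta)$. A Nambu-Poisson map is a smooth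 map between Nambu-Poisson manifolds of the same order preserving the brackets. $N\subset M$ is a Nambu-Poisson submanifold if $N$ has a Nambu-Poisson structure for which the inclusion is a Nambu-Poisson map. Let $i:N\hookrightarrow M$ be the inclusion. "$F$ is a regular, integrable distribution on $N$" means that $F$ is a smooth integrable distribution of constant rank on $N$ such that the leaf space $\underline N=N/\mathcal F$ of the induced foliation $\mathcal F$ is a smooth manifold and the projection $\pi:N\to\underline N$ is a submersion. $C^\infty(M)_E$ denotes the functions on $M$ whose differential vanishes on $E$ (at points of $N$); $C^\infty(N)_F$ denotes the functions on $N$ whose differential vanishes on $F$. $E$ is canonical if $F_1,\ldots,F_n\in C^\infty(M)_E$ implies $\{F_1,\ldots,F_n\}\in C^\infty(M)_E$. $(M,N,E)$ is (Nambu-Poisson) reducible if $\underline N$ has a Nambu-Poisson structure of order $n$ with bracket $\{,\ldots,\}_{\underline N}$ such that for all $f_1,\ldots,f_n\in C^\infty(\underline N)$ and all smooth extensions $F_1,\ldots,F_n\in C^\infty(M)_E$ of $f_1\circ\pi,\ldots,f_n\circ\pi$, one has $\pi^*\{f_1,\ldots,f_n\}_{\underline N}=i^*\{F_1,\ldots,F_n\}$. *)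

theory Defs
  imports "HOL-Analysis.Analysis"
begin

section \<open>Smooth maps between Euclidean spaces\<close>

text \<open>\<open>Ck_on k S f\<close> is meant for open \<open>S\<close> only.\<close>

fun Ck_on :: "nat \<Rightarrow> 'e::euclidean_space set \<Rightarrow> ('e \<Rightarrow> 'f::euclidean_space) \<Rightarrow> bool" where
  "Ck_on 0 S f \<longleftrightarrow> continuous_on S f"
| "Ck_on (Suc k) S f \<longleftrightarrow> (\<forall>x\<in>S. f differentiable (at x)) \<and>
     (\<forall>v. Ck_on k S (\<lambda>x. frechet_derivative f (at x) v))"

text \<open>Smoothness on an arbitrary subset means local extendability to a smooth map on an open
  set. It is used for \<open>S\<close> relatively open in a linear subspace, where it is
  the usual notion of smoothness on an open subset of that subspace.\<close>

definition smooth_on :: "'e::euclidean_space set \<Rightarrow> ('e \<Rightarrow> 'f::euclidean_space) \<Rightarrow> bool" where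
  "smooth_on S f \<longleftrightarrow> (\<forall>x\<in>S. \<exists>W g. open W \<and> x \<in> W \<and> (\<forall>k. Ck_on k W g) \<and> (\<forall>y\<in>S \<inter> W. g y = f y))"


section \<open>Smooth manifolds\<close>

text \<open>A manifold is modelled on a linear subspace \<open>model M\<close> of a Euclidean space, its dimension
  being the dimension of that subspace. (The types of class \<open>euclidean_space\<close> themselves have
  positive dimension, which would rule out zero-dimensional manifolds, for instance a leaf
  space that is a point.) A chart is a domain together with a coordinate map; only the values of
  the coordinate map on the domain matter. The atlas need not be maximal.\<close>

record ('a, 'e) mfd =
  mtop :: "'a topology"
  model :: "'e set"
  atlas :: "('a set \<times> ('a \<Rightarrow> 'e)) set"

abbreviation carr :: "('a, 'e) mfd \<Rightarrow> 'a set" where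
  "carr M \<equiv> topspace (mtop M)"

definition mdim :: "('a, 'e::euclidean_space) mfd \<Rightarrow> nat" where
  "mdim M = dim (model M)"

definition top_chart :: "('a, 'e::euclidean_space) mfd \<Rightarrow> 'a set \<Rightarrow> ('a \<Rightarrow> 'e) \<Rightarrow> bool" where
  "top_chart M U \<phi> \<longleftrightarrow> openin (mtop M) U \<and> openin (top_of_set (model M)) (\<phi> ` U) \<and>
     homeomorphic_map (subtopology (mtop M) U) (top_of_set (\<phi> ` U)) \<phi>"

definition compatible_charts ::
    "'a set \<Rightarrow> ('a \<Rightarrow> 'e::euclidean_space) \<Rightarrow> 'a set \<Rightarrow> ('a \<Rightarrow> 'e) \<Rightarrow> bool" where
  "compatible_charts U \<phi> U' \<phi>' \<longleftrightarrow>
     smooth_on (\<phi> ` (U \<inter> U')) (\<phi>' \<circ> inv_into U \<phi>) \<and>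
     smooth_on (\<phi>' ` (U \<inter> U')) (\<phi> \<circ> inv_into U' \<phi>')"

definition smooth_manifold :: "('a, 'e::euclidean_space) mfd \<Rightarrow> bool" where
  "smooth_manifold M \<longleftrightarrow>
     subspace (model M) \<and> Hausdorff_space (mtop M) \<and> second_countable (mtop M) \<and>
     (\<forall>(U, \<phi>)\<in>atlas M. top_chart M U \<phi>) \<and>
     \<Union> (fst ` atlas M) = carr M \<and>
     (\<forall>(U, \<phi>)\<in>atlas M. \<forall>(U', \<phi>')\<in>atlas M. compatible_charts U \<phi> U' \<phi>')"

text \<open>The charts of the maximal atlas.\<close>

definition smooth_chart :: "('a, 'e::euclidean_space) mfd \<Rightarrow> 'a set \<Rightarrow> ('a \<Rightarrow> 'e) \<Rightarrow> bool" where
  "smooth_chart M U \<phi> \<longleftrightarrow> top_chart M U \<phi> \<and>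
     (\<forall>(U', \<phi>')\<in>atlas M. compatible_charts U \<phi> U' \<phi>')"

definition smooth_fun_on :: "('a, 'e::euclidean_space) mfd \<Rightarrow> 'a set \<Rightarrow> ('a \<Rightarrow> real) \<Rightarrow> bool" where
  "smooth_fun_on M W f \<longleftrightarrow> (\<forall>(U, \<phi>)\<in>atlas M. smooth_on (\<phi> ` (U \<inter> W)) (f \<circ> inv_into U \<phi>))"

text \<open>Functions on \<open>M\<close> are represented by functions on the whole type that vanish off the carrier,
  so that equality of HOL functions is equality on \<open>M\<close> and sums and products are pointwise.\<close>

definition Cinf :: "('a, 'e::euclidean_space) mfd \<Rightarrow> ('a \<Rightarrow> real) set" where
  "Cinf M = {f. smooth_fun_on M (carr M) f \<and> (\<forall>x. x \<notin> carr M \<longrightarrow> f x = 0)}"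

definition smooth_map ::
    "('a, 'e::euclidean_space) mfd \<Rightarrow> ('b, 'f::euclidean_space) mfd \<Rightarrow> ('a \<Rightarrow> 'b) \<Rightarrow> bool" where
  "smooth_map M N h \<longleftrightarrow> continuous_map (mtop M) (mtop N) h \<and>
     (\<forall>(U, \<phi>)\<in>atlas M. \<forall>(V, \<psi>)\<in>atlas N.
        smooth_on (\<phi> ` (U \<inter> h -` V)) (\<psi> \<circ> h \<circ> inv_into U \<phi>))"

text \<open>\<open>pull M h f\<close> is \<open>f \<circ> h\<close> as a function on \<open>M\<close>; \<open>pull N (\<lambda>x. x)\<close> is restriction to \<open>N\<close>.\<close>

definition pull :: "('a, 'e) mfd \<Rightarrow> ('a \<Rightarrow> 'b) \<Rightarrow> ('b \<Rightarrow> real) \<Rightarrow> 'a \<Rightarrow> real" where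
  "pull M h f = (\<lambda>x. if x \<in> carr M then f (h x) else 0)"


section \<open>Tangent and cotangent spaces\<close>

text \<open>Tangent vectors are derivations of \<open>Cinf M\<close> at a point, set to \<open>0\<close> off \<open>Cinf M\<close>.\<close>

type_synonym 'a tvec = "('a \<Rightarrow> real) \<Rightarrow> real"

definition tangent :: "('a, 'e::euclidean_space) mfd \<Rightarrow> 'a \<Rightarrow> 'a tvec set" where
  "tangent M p = {v. (\<forall>f. f \<notin> Cinf M \<longrightarrow> v f = 0) \<and>
     (\<forall>f\<in>Cinf M. \<forall>g\<in>Cinf M. \<forall>a b. v (\<lambda>x. a * f x + b * g x) = a * v f + b * v g) \<and>
     (\<forall>f\<in>Cinf M. \<forall>g\<in>Cinf M. v (\<lambda>x. f x * g x) = f p * v g + g p * v f)}"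

definition push :: "('a, 'e) mfd \<Rightarrow> ('b, 'f::euclidean_space) mfd \<Rightarrow> ('a \<Rightarrow> 'b) \<Rightarrow> 'a tvec \<Rightarrow> 'b tvec" where
  "push M N h v = (\<lambda>f. if f \<in> Cinf N then v (pull M h f) else 0)"

text \<open>The tangent vector at \<open>q\<close> with coordinates \<open>w\<close> in the chart \<open>(U, \<phi>)\<close>.\<close>

definition chart_vec ::
    "('a, 'e::euclidean_space) mfd \<Rightarrow> 'a set \<Rightarrow> ('a \<Rightarrow> 'e) \<Rightarrow> 'a \<Rightarrow> 'e \<Rightarrow> 'a tvec" where
  "chart_vec M U \<phi> q w =
     (\<lambda>f. if f \<in> Cinf M then deriv (\<lambda>t::real. f (inv_into U \<phi> (\<phi> q + t *\<^sub>R w))) 0 else 0)"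

text \<open>The cotangent space is the dual of the tangent space; covectors are \<open>0\<close> off it.\<close>

definition cotangent :: "('a, 'e::euclidean_space) mfd \<Rightarrow> 'a \<Rightarrow> ('a tvec \<Rightarrow> real) set" where
  "cotangent M p = {\<alpha>. (\<forall>v. v \<notin> tangent M p \<longrightarrow> \<alpha> v = 0) \<and>
     (\<forall>v\<in>tangent M p. \<forall>w\<in>tangent M p. \<forall>a b. \<alpha> (\<lambda>f. a * v f + b * w f) = a * \<alpha> v + b * \<alpha> w)}"

definition differential :: "('a, 'e::euclidean_space) mfd \<Rightarrow> 'a \<Rightarrow> ('a \<Rightarrow> real) \<Rightarrow> 'a tvec \<Rightarrow> real" where
  "differential M p f = (\<lambda>v. if v \<in> tangent M p then v f else 0)"

definition submersion ::
    "('a, 'e::euclidean_space) mfd \<Rightarrow> ('b, 'f::euclidean_space) mfd \<Rightarrow> ('a \<Rightarrow> 'b) \<Rightarrow> bool" where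
  "submersion M N h \<longleftrightarrow> smooth_map M N h \<and>
     (\<forall>p\<in>carr M. push M N h ` tangent M p = tangent N (h p))"

definition immersion ::
    "('a, 'e::euclidean_space) mfd \<Rightarrow> ('b, 'f::euclidean_space) mfd \<Rightarrow> ('a \<Rightarrow> 'b) \<Rightarrow> bool" where
  "immersion M N h \<longleftrightarrow> smooth_map M N h \<and> (\<forall>p\<in>carr M. inj_on (push M N h) (tangent M p))"

definition submanifold :: "('a, 'e::euclidean_space) mfd \<Rightarrow> ('a, 'f::euclidean_space) mfd \<Rightarrow> bool" where
  "submanifold M N \<longleftrightarrow> smooth_manifold N \<and> carr N \<subseteq> carr M \<and>
     mtop N = subtopology (mtop M) (carr N) \<and> immersion N M (\<lambda>x. x)"

text \<open>\<open>T\<^sub>pN\<close> as a subspace of \<open>T\<^sub>pM\<close>.\<close>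

definition tangent_sub ::
    "('a, 'e::euclidean_space) mfd \<Rightarrow> ('a, 'f::euclidean_space) mfd \<Rightarrow> 'a \<Rightarrow> 'a tvec set" where
  "tangent_sub M N p = push N M (\<lambda>x. x) ` tangent N p"


section \<open>Subbundles, foliations and leaf spaces\<close>

text \<open>Smooth vector subbundles (of constant rank \<open>k\<close>) of \<open>TM\<close> restricted to a submanifold \<open>N\<close>,
  given by local smooth frames \<open>e 0, \<dots>, e (k - 1)\<close>; a section \<open>X\<close> of this bundle is smooth iff
  \<open>q \<mapsto> X q f\<close> is smooth for all \<open>f \<in> Cinf M\<close>. Taking \<open>M = N\<close> gives distributions on \<open>N\<close>.\<close>

definition vector_subbundle :: "('a, 'e::euclidean_space) mfd \<Rightarrow> ('a, 'f::euclidean_space) mfd \<Rightarrow>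
    ('a \<Rightarrow> 'a tvec set) \<Rightarrow> bool" where
  "vector_subbundle M N E \<longleftrightarrow> (\<exists>k::nat. \<forall>p\<in>carr N. \<exists>U e.
     openin (mtop N) U \<and> p \<in> U \<and>
     (\<forall>j<k. (\<forall>q\<in>U. e j q \<in> tangent M q) \<and> (\<forall>f\<in>Cinf M. smooth_fun_on N U (\<lambda>q. e j q f))) \<and>
     (\<forall>q\<in>U. E q = {(\<lambda>f. \<Sum>j<k. c j * e j q f) | c. True} \<and>
        (\<forall>c. (\<forall>f\<in>Cinf M. (\<Sum>j<k. c j * e j q f) = 0) \<longrightarrow> (\<forall>j<k. c j = 0))))"

text \<open>The distribution \<open>E \<inter> TN\<close>, as subspaces of the tangent spaces of \<open>N\<close>.\<close>

definition tangential_part :: "('a, 'e::euclidean_space) mfd \<Rightarrow> ('a, 'f::euclidean_space) mfd \<Rightarrow>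
    ('a \<Rightarrow> 'a tvec set) \<Rightarrow> 'a \<Rightarrow> 'a tvec set" where
  "tangential_part M N E p = {w \<in> tangent N p. push N M (\<lambda>x. x) w \<in> E p}"

text \<open>In a flat chart the distribution \<open>F\<close> becomes a constant subspace \<open>W\<close>.\<close>

definition flat_chart :: "('a, 'f::euclidean_space) mfd \<Rightarrow> ('a \<Rightarrow> 'a tvec set) \<Rightarrow>
    'a set \<Rightarrow> ('a \<Rightarrow> 'f) \<Rightarrow> 'f set \<Rightarrow> bool" where
  "flat_chart N F U \<phi> W \<longleftrightarrow> smooth_chart N U \<phi> \<and> subspace W \<and> W \<subseteq> model N \<and>
     (\<forall>q\<in>U. F q = chart_vec N U \<phi> q ` W)"

definition integrable_distribution :: "('a, 'f::euclidean_space) mfd \<Rightarrow> ('a \<Rightarrow> 'a tvec set) \<Rightarrow> bool" where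
  "integrable_distribution N F \<longleftrightarrow> vector_subbundle N N F \<and>
     (\<forall>p\<in>carr N. \<exists>U \<phi> W. p \<in> U \<and> flat_chart N F U \<phi> W)"

text \<open>Two points lie in a common plaque if in some flat chart they belong to a connected subset of
  an affine slice parallel to \<open>W\<close>. Leaves are the classes of points that can be joined by
  finite chains of plaques.\<close>

definition same_plaque :: "('a, 'f::euclidean_space) mfd \<Rightarrow> ('a \<Rightarrow> 'a tvec set) \<Rightarrow> 'a \<Rightarrow> 'a \<Rightarrow> bool" where
  "same_plaque N F p q \<longleftrightarrow> (\<exists>U \<phi> W C. flat_chart N F U \<phi> W \<and> C \<subseteq> U \<and> connectedin (mtop N) C \<and>
     p \<in> C \<and> q \<in> C \<and> (\<forall>x\<in>C. \<phi> x - \<phi> p \<in> W))"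

definition leaf :: "('a, 'f::euclidean_space) mfd \<Rightarrow> ('a \<Rightarrow> 'a tvec set) \<Rightarrow> 'a \<Rightarrow> 'a set" where
  "leaf N F p = {q. (same_plaque N F)\<^sup>*\<^sup>* p q}"

text \<open>\<open>F\<close> is a regular, integrable distribution whose leaf space, with its
  manifold structure, is \<open>Q\<close>; the projection \<open>\<pi>\<close> is \<open>leaf N F\<close>. Since \<open>\<pi>\<close> is a surjective
  submersion, the smooth structure of \<open>Q\<close> is uniquely determined.\<close>

definition regular_integrable_distribution :: "('a, 'f::euclidean_space) mfd \<Rightarrow>
    ('a \<Rightarrow> 'a tvec set) \<Rightarrow> ('a set, 'g::euclidean_space) mfd \<Rightarrow> bool" where
  "regular_integrable_distribution N F Q \<longleftrightarrow> integrable_distribution N F \<and>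
     smooth_manifold Q \<and> carr Q = leaf N F ` carr N \<and> submersion N Q (leaf N F)"


section \<open>Nambu-Poisson structures\<close>

text \<open>An \<open>n\<close>-ary bracket takes a list of functions; only its values on lists of length \<open>n\<close> of
  smooth functions matter. The inequality \<open>n \<le> dim M\<close> is kept separate, in
  \<open>nambu_poisson_manifold\<close>: on a manifold of dimension less than \<open>n\<close> (such as a leaf space or
  a submanifold may be) the zero bracket counts as a Nambu-Poisson structure.\<close>

definition nambu_structure ::
    "('a, 'e::euclidean_space) mfd \<Rightarrow> nat \<Rightarrow> (('a \<Rightarrow> real) list \<Rightarrow> 'a \<Rightarrow> real) \<Rightarrow> bool" where
  "nambu_structure M n br \<longleftrightarrow> 1 \<le> n \<and>
     (\<forall>fs. length fs = n \<and> set fs \<subseteq> Cinf M \<longrightarrow> br fs \<in> Cinf M) \<and>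
     \<comment> \<open>multilinearity\<close>
     (\<forall>fs k g h a b. length fs = n \<and> set fs \<subseteq> Cinf M \<and> k < n \<and> g \<in> Cinf M \<and> h \<in> Cinf M \<longrightarrow>
        br (fs[k := \<lambda>x. a * g x + b * h x]) = (\<lambda>x. a * br (fs[k := g]) x + b * br (fs[k := h]) x)) \<and>
     \<comment> \<open>skew-symmetry\<close>
     (\<forall>fs i j. length fs = n \<and> set fs \<subseteq> Cinf M \<and> i < j \<and> j < n \<longrightarrow>
        br (fs[i := fs ! j, j := fs ! i]) = (\<lambda>x. - br fs x)) \<and>
     \<comment> \<open>Leibniz rule\<close>
     (\<forall>fs g h. length fs = n - 1 \<and> set fs \<subseteq> Cinf M \<and> g \<in> Cinf M \<and> h \<in> Cinf M \<longrightarrow>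
        br (fs @ [\<lambda>x. g x * h x]) = (\<lambda>x. g x * br (fs @ [h]) x + br (fs @ [g]) x * h x)) \<and>
     \<comment> \<open>fundamental identity\<close>
     (\<forall>gs fs. length gs = n - 1 \<and> set gs \<subseteq> Cinf M \<and> length fs = n \<and> set fs \<subseteq> Cinf M \<longrightarrow>
        br (gs @ [br fs]) = (\<lambda>x. \<Sum>k<n. br (fs[k := br (gs @ [fs ! k])]) x))"

definition nambu_poisson_manifold ::
    "('a, 'e::euclidean_space) mfd \<Rightarrow> nat \<Rightarrow> (('a \<Rightarrow> real) list \<Rightarrow> 'a \<Rightarrow> real) \<Rightarrow> bool" where
  "nambu_poisson_manifold M n br \<longleftrightarrow> smooth_manifold M \<and> n \<le> mdim M \<and> nambu_structure M n br"

text \<open>The Nambu tensor at \<open>p\<close>, evaluated on a list of \<open>n\<close> covectors: \<open>\<Pi>(df\<^sub>1, \<dots>, df\<^sub>n)\<close> is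
  the bracket of \<open>f\<^sub>1, \<dots>, f\<^sub>n\<close>, which at \<open>p\<close> depends only on the differentials at \<open>p\<close>.\<close>

definition nambu_tensor :: "('a, 'e::euclidean_space) mfd \<Rightarrow> (('a \<Rightarrow> real) list \<Rightarrow> 'a \<Rightarrow> real) \<Rightarrow>
    'a \<Rightarrow> ('a tvec \<Rightarrow> real) list \<Rightarrow> real" where
  "nambu_tensor M br p \<alpha>s = br (map (\<lambda>\<alpha>. SOME f. f \<in> Cinf M \<and> differential M p f = \<alpha>) \<alpha>s) p"

text \<open>\<open>\<Pi>\<^sup>\<sharp>(\<alpha>\<^sub>1 \<and> \<dots> \<and> \<alpha>\<^sub>n\<^sub>-\<^sub>1)\<close>, as a function of the list of the covectors \<open>\<alpha>\<^sub>i\<close>.\<close>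

definition nambu_sharp :: "('a, 'e::euclidean_space) mfd \<Rightarrow> (('a \<Rightarrow> real) list \<Rightarrow> 'a \<Rightarrow> real) \<Rightarrow>
    'a \<Rightarrow> ('a tvec \<Rightarrow> real) list \<Rightarrow> 'a tvec" where
  "nambu_sharp M br p \<alpha>s =
     (THE v. v \<in> tangent M p \<and> (\<forall>\<beta>\<in>cotangent M p. \<beta> v = nambu_tensor M br p (\<alpha>s @ [\<beta>])))"

text \<open>The image of the linear map \<open>\<Pi>\<^sup>\<sharp>\<close>: every element of the exterior power is a finite linear
  combination of decomposable elements \<open>\<alpha>\<^sub>1 \<and> \<dots> \<and> \<alpha>\<^sub>n\<^sub>-\<^sub>1\<close>.\<close>

definition nambu_sharp_image :: "('a, 'e::euclidean_space) mfd \<Rightarrow> nat \<Rightarrow>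
    (('a \<Rightarrow> real) list \<Rightarrow> 'a \<Rightarrow> real) \<Rightarrow> 'a \<Rightarrow> 'a tvec set" where
  "nambu_sharp_image M n br p =
     {(\<lambda>f. \<Sum>j<m. c j * nambu_sharp M br p (A j) f) | (m::nat) c A.
        \<forall>j<m. length (A j) = n - 1 \<and> set (A j) \<subseteq> cotangent M p}"

definition nambu_poisson_map :: "('a, 'e::euclidean_space) mfd \<Rightarrow> (('a \<Rightarrow> real) list \<Rightarrow> 'a \<Rightarrow> real) \<Rightarrow>
    ('b, 'f::euclidean_space) mfd \<Rightarrow> (('b \<Rightarrow> real) list \<Rightarrow> 'b \<Rightarrow> real) \<Rightarrow> nat \<Rightarrow> ('a \<Rightarrow> 'b) \<Rightarrow> bool" where
  "nambu_poisson_map M brM N brN n h \<longleftrightarrow> smooth_map M N h \<and>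
     (\<forall>fs. length fs = n \<and> set fs \<subseteq> Cinf N \<longrightarrow> brM (map (pull M h) fs) = pull M h (brN fs))"

definition nambu_poisson_submanifold :: "('a, 'e::euclidean_space) mfd \<Rightarrow> nat \<Rightarrow>
    (('a \<Rightarrow> real) list \<Rightarrow> 'a \<Rightarrow> real) \<Rightarrow> ('a, 'f::euclidean_space) mfd \<Rightarrow> bool" where
  "nambu_poisson_submanifold M n br N \<longleftrightarrow>
     submanifold M N \<and> (\<exists>brN. nambu_structure N n brN \<and> nambu_poisson_map N brN M br n (\<lambda>x. x))"


section \<open>Reduction\<close>

text \<open>Smooth functions on \<open>M\<close> whose differential vanishes on \<open>E\<close> at the points of \<open>S\<close>.\<close>

definition Cinf_along :: "('a, 'e::euclidean_space) mfd \<Rightarrow> 'a set \<Rightarrow> ('a \<Rightarrow> 'a tvec set) \<Rightarrow>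
    ('a \<Rightarrow> real) set" where
  "Cinf_along M S E = {f \<in> Cinf M. \<forall>p\<in>S. \<forall>v\<in>E p. differential M p f v = 0}"

definition canonical_subbundle :: "('a, 'e::euclidean_space) mfd \<Rightarrow> nat \<Rightarrow>
    (('a \<Rightarrow> real) list \<Rightarrow> 'a \<Rightarrow> real) \<Rightarrow> ('a, 'f::euclidean_space) mfd \<Rightarrow> ('a \<Rightarrow> 'a tvec set) \<Rightarrow> bool" where
  "canonical_subbundle M n br N E \<longleftrightarrow>
     (\<forall>Fs. length Fs = n \<and> set Fs \<subseteq> Cinf_along M (carr N) E \<longrightarrow> br Fs \<in> Cinf_along M (carr N) E)"

text \<open>Reducibility of \<open>(M, N, E)\<close>, where \<open>Q\<close> is the leaf space of \<open>E \<inter> TN\<close>.\<close>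

definition nambu_reducible :: "('a, 'e::euclidean_space) mfd \<Rightarrow> nat \<Rightarrow>
    (('a \<Rightarrow> real) list \<Rightarrow> 'a \<Rightarrow> real) \<Rightarrow> ('a, 'f::euclidean_space) mfd \<Rightarrow> ('a \<Rightarrow> 'a tvec set) \<Rightarrow>
    ('a set, 'g::euclidean_space) mfd \<Rightarrow> bool" where
  "nambu_reducible M n br N E Q \<longleftrightarrow> (\<exists>brQ. nambu_structure Q n brQ \<and>
     (let \<pi> = leaf N (tangential_part M N E) in
      \<forall>fs Fs. length fs = n \<and> set fs \<subseteq> Cinf Q \<and>
        length Fs = n \<and> set Fs \<subseteq> Cinf_along M (carr N) E \<and>
        (\<forall>k<n. pull N (\<lambda>x. x) (Fs ! k) = pull N \<pi> (fs ! k)) \<longrightarrow>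
        pull N \<pi> (brQ fs) = pull N (\<lambda>x. x) (br Fs)))"

definition zero_subbundle :: "('a, 'f) mfd \<Rightarrow> ('a \<Rightarrow> 'a tvec set) \<Rightarrow> bool" where
  "zero_subbundle N E \<longleftrightarrow> (\<forall>p\<in>carr N. E p = {\<lambda>f. 0})"

end

theory Submission
  imports Defs
begin

text \<open>Everything rests on one condition, \<open>ideal_on\<close>: for \<open>A = C\<^sup>\<infinity>(M)\<^sub>E\<close>, brackets of elements of
  \<open>A\<close> with an element of \<open>A\<close> that vanishes on \<open>N\<close> vanish on \<open>N\<close> again.

  Smooth functions on the leaf space are the same as functions in \<open>C\<^sup>\<infinity>(N)\<^sub>F\<close>
  (\<open>leaf_space_functions\<close>), and these are the restrictions of the functions in \<open>A\<close>. A bracket on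
  the leaf space must therefore be computed by extending to \<open>A\<close>, taking the bracket on \<open>M\<close> and
  restricting, and the condition says precisely that the choice of the extensions is immaterial.
  The identities of a Nambu-Poisson bracket are then inherited (\<open>nambu_descends\<close>). So reducibility
  is equivalent to the condition.

  If \<open>E\<close> is not zero, the condition is automatic (\<open>canonical_ideal\<close>). For \<open>h \<in> A\<close> vanishing on \<open>N\<close>
  and an arbitrary function \<open>G\<close> the product \<open>h G\<close> is in \<open>A\<close>, because \<open>d(h G) = G dh\<close> on \<open>N\<close>. As
  \<open>E\<close> is canonical, the differential of \<open>{g\<^sub>1, \<dots>, h G} = h {g\<^sub>1, \<dots>, G} + {g\<^sub>1, \<dots>, h} G\<close> vanishes on
  \<open>E\<close>; at points of \<open>N\<close> the only term that survives on \<open>E\<close> is \<open>{g\<^sub>1, \<dots>, h} dG\<close>, and \<open>G\<close> can be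
  chosen with \<open>dG \<noteq> 0\<close> on \<open>E\<close>.

  If \<open>E\<close> is zero, then \<open>A\<close> is the algebra of all smooth functions on \<open>M\<close> and restriction to \<open>N\<close> is
  surjective. The vectors \<open>\<Pi>\<^sup>\<sharp>(dg\<^sub>1 \<and> \<dots> \<and> dg\<^sub>n\<^sub>-\<^sub>1)\<close> are the derivations \<open>{g\<^sub>1, \<dots>, g\<^sub>n\<^sub>-\<^sub>1, _}\<close>
  (\<open>nambu_sharp_eq\<close>), and a derivation is tangent to \<open>N\<close> iff it kills the functions vanishing on
  \<open>N\<close>; so the condition says that the image of \<open>\<Pi>\<^sup>\<sharp>\<close> is tangent to \<open>N\<close>
  (\<open>sharp_image_iff_ideal\<close>). It also says that the bracket descends along the restriction to \<open>N\<close>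
  (\<open>nambu_submanifold_iff_ideal\<close>).

  The analytic part of the proof serves two facts. A function on \<open>N\<close> that is constant on the leaves
  is smooth on the leaf space, since a submersion has smooth local sections
  (\<open>submersion_local_section\<close>, by the inverse function theorem). Every covector is the
  differential of a function (\<open>covector_is_differential\<close>). Both need that a derivation is a
  directional derivative in any chart (\<open>tangent_imp_chart_vec\<close>, by Hadamard's lemma).\<close>

section \<open>Calculus of smooth maps on open sets\<close>

abbreviation smooth_open :: "'e::euclidean_space set \<Rightarrow> ('e \<Rightarrow> 'f::euclidean_space) \<Rightarrow> bool" where
  "smooth_open S f \<equiv> \<forall>k. Ck_on k S f"

lemma Ck_on_cong:
  assumes "open S" "\<And>x. x \<in> S \<Longrightarrow> f x = g x"
  shows "Ck_on k S f \<Longrightarrow> Ck_on k S g"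
  using assms(2)
proof (induction k arbitrary: f g)
  case 0
  then show ?case by (auto cong: continuous_on_cong)
next
  case (Suc k)
  have d: "(g has_derivative frechet_derivative f (at x)) (at x)" if x: "x \<in> S" for x
  proof -
    have "(f has_derivative frechet_derivative f (at x)) (at x)"
      using Suc.prems(1) x frechet_derivative_works by auto
    then show ?thesis
      using has_derivative_transform_within_open \<open>open S\<close> x Suc.prems(2) by blast
  qed
  then have e: "frechet_derivative f (at x) = frechet_derivative g (at x)" if "x \<in> S" for x
    using frechet_derivative_at that by blast
  have "Ck_on k S (\<lambda>x. frechet_derivative g (at x) v)" for v
    by (rule Suc.IH[of "\<lambda>x. frechet_derivative f (at x) v"]) (use Suc.prems e in auto)
  then show ?case
    using d by (auto simp: differentiable_def)
qed

lemma Ck_on_SucI: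
  assumes "open S" "\<And>x. x \<in> S \<Longrightarrow> (f has_derivative f' x) (at x)"
    and "\<And>v. Ck_on k S (\<lambda>x. f' x v)"
  shows "Ck_on (Suc k) S f"
proof -
  have "Ck_on k S (\<lambda>x. frechet_derivative f (at x) v)" for v
    by (rule Ck_on_cong[OF assms(1) _ assms(3)[of v]])
       (use frechet_derivative_at assms(2) in metis)
  then show ?thesis
    using assms(2) by (auto simp: differentiable_def)
qed

lemma Ck_on_SucD:
  assumes "Ck_on (Suc k) S f"
  shows "x \<in> S \<Longrightarrow> (f has_derivative frechet_derivative f (at x)) (at x)"
    and "Ck_on k S (\<lambda>x. frechet_derivative f (at x) v)"
  using assms frechet_derivative_works by auto

lemma Ck_on_lower: "Ck_on (Suc k) S f \<Longrightarrow> Ck_on k S f"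
proof (induction k arbitrary: f)
  case 0
  then show ?case
    by (auto intro!: continuous_at_imp_continuous_on differentiable_imp_continuous_within)
next
  case (Suc k)
  have "Ck_on k S (\<lambda>x. frechet_derivative f (at x) v)" for v
    using Suc.IH Ck_on_SucD(2)[OF Suc.prems] by blast
  then show ?case using Suc.prems by simp
qed

lemma Ck_on_subset: "Ck_on k S f \<Longrightarrow> T \<subseteq> S \<Longrightarrow> Ck_on k T f"
  by (induction k arbitrary: f) (auto intro: continuous_on_subset)

lemma smooth_open_deriv:
  assumes "smooth_open S f"
  shows "x \<in> S \<Longrightarrow> (f has_derivative frechet_derivative f (at x)) (at x)"
    and "smooth_open S (\<lambda>x. frechet_derivative f (at x) v)"
  using assms Ck_on_SucD by blast+

lemma smooth_open_imp_continuous: "smooth_open S f \<Longrightarrow> continuous_on S f"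
  using Ck_on.simps(1) by blast

lemma Ck_on_const: "open S \<Longrightarrow> Ck_on k S (\<lambda>x. c)"
proof (induction k arbitrary: c)
  case (Suc k)
  then show ?case
    by (intro Ck_on_SucI[where f' = "\<lambda>x v. 0"]) auto
qed auto

lemma Ck_on_bounded_linear:
  assumes "bounded_linear h" "open S"
  shows "Ck_on k S f \<Longrightarrow> Ck_on k S (\<lambda>x. h (f x))"
proof (induction k arbitrary: f)
  case 0
  then show ?case using bounded_linear.continuous_on[OF assms(1)] by simp
next
  case (Suc k)
  show ?case
    by (rule Ck_on_SucI[where f' = "\<lambda>x v. h (frechet_derivative f (at x) v)"])
       (use assms Suc.IH Ck_on_SucD[OF Suc.prems] bounded_linear.has_derivative in blast)+
qed

lemma Ck_on_id: "open S \<Longrightarrow> Ck_on k S (\<lambda>x. x)"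
proof (cases k)
  case (Suc j)
  assume "open S"
  then show ?thesis
    unfolding Suc by (intro Ck_on_SucI[where f' = "\<lambda>x v. v"] Ck_on_const) auto
qed auto

lemma Ck_on_linear: "linear h \<Longrightarrow> open S \<Longrightarrow> Ck_on k S h"
  using Ck_on_bounded_linear[OF _ _ Ck_on_id, of h S k] linear_conv_bounded_linear by auto

lemma Ck_on_add:
  assumes "open S"
  shows "Ck_on k S f \<Longrightarrow> Ck_on k S g \<Longrightarrow> Ck_on k S (\<lambda>x. f x + g x)"
proof (induction k arbitrary: f g)
  case (Suc k)
  show ?case
    by (rule Ck_on_SucI[where f' = "\<lambda>x v. frechet_derivative f (at x) v + frechet_derivative g (at x) v"])
       (use assms Suc.IH Ck_on_SucD[OF Suc.prems(1)] Ck_on_SucD[OF Suc.prems(2)]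
         in \<open>auto intro: has_derivative_add\<close>)
qed (simp add: continuous_on_add)

lemma Ck_on_bilinear:
  assumes "bounded_bilinear B" "open S"
  shows "Ck_on k S f \<Longrightarrow> Ck_on k S g \<Longrightarrow> Ck_on k S (\<lambda>x. B (f x) (g x))"
proof (induction k arbitrary: f g)
  case 0
  then show ?case using bounded_bilinear.continuous_on[OF assms(1)] by auto
next
  case (Suc k)
  show ?case
  proof (rule Ck_on_SucI[where f' = "\<lambda>x v. B (f x) (frechet_derivative g (at x) v)
        + B (frechet_derivative f (at x) v) (g x)"])
    show "((\<lambda>x. B (f x) (g x)) has_derivative
      (\<lambda>v. B (f x) (frechet_derivative g (at x) v) + B (frechet_derivative f (at x) v) (g x))) (at x)"
      if "x \<in> S" for x
      using bounded_bilinear.FDERIV[OF assms(1) Ck_on_SucD(1)[OF Suc.prems(1) that] Ck_on_SucD(1)[OF Suc.prems(2) that]] .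
    show "Ck_on k S (\<lambda>x. B (f x) (frechet_derivative g (at x) v)
        + B (frechet_derivative f (at x) v) (g x))" for v
      by (intro Ck_on_add Suc.IH assms Ck_on_lower[OF Suc.prems(1)] Ck_on_lower[OF Suc.prems(2)]
          Ck_on_SucD(2)[OF Suc.prems(1)] Ck_on_SucD(2)[OF Suc.prems(2)])
  qed (rule assms)
qed

lemmas Ck_on_scaleR = Ck_on_bilinear[OF bounded_bilinear_scaleR]
lemmas Ck_on_mult = Ck_on_bilinear[OF bounded_bilinear_mult]
lemmas Ck_on_inner = Ck_on_bilinear[OF bounded_bilinear_inner]

lemma Ck_on_sum:
  assumes "open S"
  shows "(\<And>i. i \<in> I \<Longrightarrow> Ck_on k S (f i)) \<Longrightarrow> Ck_on k S (\<lambda>x. \<Sum>i\<in>I. f i x)"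
  by (induction I rule: infinite_finite_induct) (auto simp: Ck_on_const Ck_on_add assms)

lemma Ck_on_compose:
  assumes "open S" "open T" "f ` S \<subseteq> T"
  shows "Ck_on k S f \<Longrightarrow> Ck_on k T g \<Longrightarrow> Ck_on k S (\<lambda>x. g (f x))"
  using assms(1,3)
proof (induction k arbitrary: f g)
  case 0
  then show ?case using continuous_on_compose2[of T g S f] by simp
next
  case (Suc k)
  let ?Df = "\<lambda>x. frechet_derivative f (at x)" and ?Dg = "\<lambda>y. frechet_derivative g (at y)"
  have dg: "(g has_derivative ?Dg (f x)) (at (f x))" if "x \<in> S" for x
    using Ck_on_SucD(1)[OF Suc.prems(2), of "f x"] Suc.prems that by auto
  show ?case
  proof (rule Ck_on_SucI[OF Suc.prems(3), where f' = "\<lambda>x v. ?Dg (f x) (?Df x v)"])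
    show "((\<lambda>x. g (f x)) has_derivative (\<lambda>v. ?Dg (f x) (?Df x v))) (at x)" if "x \<in> S" for x
      using has_derivative_compose[OF Ck_on_SucD(1)[OF Suc.prems(1) that] dg[OF that]] .
    \<comment> \<open>Expanding in the basis reduces the derivative to sums and products of compositions.\<close>
    show "Ck_on k S (\<lambda>x. ?Dg (f x) (?Df x v))" for v
    proof (rule Ck_on_cong[OF Suc.prems(3), of "\<lambda>x. \<Sum>b\<in>Basis. (?Df x v \<bullet> b) *\<^sub>R ?Dg (f x) b"])
      show "Ck_on k S (\<lambda>x. \<Sum>b\<in>Basis. (?Df x v \<bullet> b) *\<^sub>R ?Dg (f x) b)"
        by (intro Ck_on_sum Ck_on_scaleR Ck_on_inner Ck_on_const Ck_on_SucD(2)[OF Suc.prems(1)]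
            Suc.IH[of f] Ck_on_lower[OF Suc.prems(1)] Ck_on_SucD(2)[OF Suc.prems(2)] Suc.prems)
      fix x assume "x \<in> S"
      then have "linear (?Dg (f x))"
        using dg has_derivative_linear by blast
      then show "(\<Sum>b\<in>Basis. (?Df x v \<bullet> b) *\<^sub>R ?Dg (f x) b) = ?Dg (f x) (?Df x v)"
        using linear_sum[of "?Dg (f x)" "\<lambda>b. (?Df x v \<bullet> b) *\<^sub>R b" Basis]
        by (simp add: linear_scale euclidean_representation)
    qed
  qed
qed

lemma Ck_on_local:
  assumes "\<And>x. x \<in> S \<Longrightarrow> \<exists>T. open T \<and> x \<in> T \<and> Ck_on k T f"
  shows "Ck_on k S f"
  using assms
proof (induction k arbitrary: f)
  case 0
  then show ?case
    unfolding Ck_on.simps(1)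
    by (meson continuous_at_imp_continuous_at_within continuous_on_eq_continuous_at
        continuous_on_eq_continuous_within)
next
  case (Suc k)
  have "\<exists>T. open T \<and> x \<in> T \<and> Ck_on k T (\<lambda>x. frechet_derivative f (at x) v)" if "x \<in> S" for x v
    using Suc.prems[OF that] by auto
  then have "Ck_on k S (\<lambda>x. frechet_derivative f (at x) v)" for v
    using Suc.IH by blast
  then show ?case using Suc.prems by fastforce
qed


section \<open>Smooth maps on subsets\<close>

lemma smooth_onE:
  assumes "smooth_on S f" "x \<in> S"
  obtains W g where "open W" "x \<in> W" "smooth_open W g" "\<And>y. y \<in> S \<Longrightarrow> y \<in> W \<Longrightarrow> g y = f y"
  using assms(1)[unfolded smooth_on_def, THEN bspec, OF assms(2)] by (elim exE conjE) simp

lemma smooth_open_imp_on: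
  assumes "smooth_open W g" "open W" "S \<subseteq> W" "\<And>y. y \<in> S \<Longrightarrow> g y = f y"
  shows "smooth_on S f"
  unfolding smooth_on_def
proof
  fix x assume "x \<in> S"
  then show "\<exists>W g. open W \<and> x \<in> W \<and> smooth_open W g \<and> (\<forall>y\<in>S \<inter> W. g y = f y)"
    using assms by (intro exI[of _ W] exI[of _ g]) auto
qed

lemma smooth_on_local:
  assumes "\<And>x. x \<in> S \<Longrightarrow> \<exists>W. open W \<and> x \<in> W \<and> smooth_on (S \<inter> W) f"
  shows "smooth_on S f"
  unfolding smooth_on_def
proof
  fix x assume x: "x \<in> S"
  then obtain W where W: "open W" "x \<in> W" "smooth_on (S \<inter> W) f" using assms by blast
  then obtain W' g where "open W'" "x \<in> W'" "smooth_open W' g" "\<And>y. y \<in> S \<inter> W \<Longrightarrow> y \<in> W' \<Longrightarrow> g y = f y"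
    using smooth_onE[of "S \<inter> W" f x] x by blast
  then show "\<exists>W g. open W \<and> x \<in> W \<and> smooth_open W g \<and> (\<forall>y\<in>S \<inter> W. g y = f y)"
    using W by (intro exI[of _ "W \<inter> W'"] exI[of _ g]) (auto intro: Ck_on_subset)
qed

lemma smooth_on_cong: "smooth_on S f \<Longrightarrow> (\<And>x. x \<in> S \<Longrightarrow> f x = g x) \<Longrightarrow> smooth_on S g"
  unfolding smooth_on_def by simp

lemma smooth_on_const: "smooth_on S (\<lambda>x. c)"
  by (rule smooth_open_imp_on[of UNIV "\<lambda>x. c"]) (auto simp: Ck_on_const)

lemma smooth_on_binary:
  fixes S :: "'e::euclidean_space set"
  assumes "smooth_on S f" "smooth_on S g"
    and B: "\<And>k W f g. open (W :: 'e set) \<Longrightarrow> Ck_on k W f \<Longrightarrow> Ck_on k W g \<Longrightarrow> Ck_on k W (\<lambda>x. B (f x) (g x))"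
  shows "smooth_on S (\<lambda>x. B (f x) (g x))"
  unfolding smooth_on_def
proof
  fix x assume x: "x \<in> S"
  obtain W f' where "open W" "x \<in> W" "smooth_open W f'" "\<And>y. y \<in> S \<Longrightarrow> y \<in> W \<Longrightarrow> f' y = f y"
    using smooth_onE[OF assms(1) x] by blast
  moreover obtain W' g' where "open W'" "x \<in> W'" "smooth_open W' g'" "\<And>y. y \<in> S \<Longrightarrow> y \<in> W' \<Longrightarrow> g' y = g y"
    using smooth_onE[OF assms(2) x] by blast
  moreover from calculation have "Ck_on k (W \<inter> W') (\<lambda>x. B (f' x) (g' x))" for k
    using Ck_on_subset[of k W f' "W \<inter> W'"] Ck_on_subset[of k W' g' "W \<inter> W'"] by (intro B) auto
  ultimately show "\<exists>W h. open W \<and> x \<in> W \<and> smooth_open W h \<and> (\<forall>y\<in>S \<inter> W. h y = B (f y) (g y))"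
    by (intro exI[of _ "W \<inter> W'"] exI[of _ "\<lambda>x. B (f' x) (g' x)"]) auto
qed

lemma smooth_on_lincomb:
  fixes f g :: "_ \<Rightarrow> real"
  assumes "smooth_on S f" "smooth_on S g"
  shows "smooth_on S (\<lambda>x. a * f x + b * g x)"
  by (rule smooth_on_binary[OF assms]) (intro Ck_on_add Ck_on_mult Ck_on_const; assumption)

lemma smooth_on_mult:
  fixes f g :: "_ \<Rightarrow> real"
  assumes "smooth_on S f" "smooth_on S g"
  shows "smooth_on S (\<lambda>x. f x * g x)"
  by (rule smooth_on_binary[OF assms]) (rule Ck_on_mult)

lemma smooth_on_compose:
  assumes "smooth_on S f" "smooth_on T g" "f ` S \<subseteq> T"
  shows "smooth_on S (g \<circ> f)"
  unfolding smooth_on_def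
proof
  fix x assume x: "x \<in> S"
  obtain W f' where f: "open W" "x \<in> W" "smooth_open W f'" "\<And>y. y \<in> S \<Longrightarrow> y \<in> W \<Longrightarrow> f' y = f y"
    using smooth_onE[OF assms(1) x] by blast
  have "f x \<in> T" using assms(3) x by blast
  then obtain W' g' where g: "open W'" "f x \<in> W'" "smooth_open W' g'" "\<And>y. y \<in> T \<Longrightarrow> y \<in> W' \<Longrightarrow> g' y = g y"
    using smooth_onE[OF assms(2)] by blast
  let ?V = "W \<inter> f' -` W'"
  have V: "open ?V"
    using continuous_open_preimage[OF smooth_open_imp_continuous[OF f(3)] f(1) g(1)] .
  have "smooth_open ?V (\<lambda>x. g' (f' x))"
    using Ck_on_compose[OF V g(1), of f' _ g'] Ck_on_subset f(3) g(3) by blast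
  then show "\<exists>W h. open W \<and> x \<in> W \<and> smooth_open W h \<and> (\<forall>y\<in>S \<inter> W. h y = (g \<circ> f) y)"
    using V x f g assms(3) by (intro exI[of _ ?V] exI[of _ "\<lambda>x. g' (f' x)"]) auto
qed


lemma Ck_on_imp_continuous: "Ck_on k S f \<Longrightarrow> continuous_on S f"
proof (induction k)
  case (Suc k)
  then show ?case using Ck_on_lower by blast
qed simp

section \<open>Bump functions and Hadamard's lemma\<close>

text \<open>The family is closed under differentiation up to linear combinations, so that smoothness of
  all its members follows by one induction on the order of differentiability.\<close>

definition flat_exp :: "nat \<Rightarrow> real \<Rightarrow> real" where
  "flat_exp m x = (if x \<le> 0 then 0 else exp (- inverse x) / x ^ m)"

lemma flat_exp_tendsto_0: "(flat_exp m \<longlongrightarrow> 0) (at 0)"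
proof -
  have "((\<lambda>x::real. inverse x ^ m / exp (inverse x)) \<longlongrightarrow> 0) (at_right 0)"
    by (rule filterlim_compose[OF tendsto_power_div_exp_0 filterlim_inverse_at_top_right])
  then have "(flat_exp m \<longlongrightarrow> 0) (at_right 0)"
    by (rule Lim_transform_eventually)
       (auto simp: eventually_at_right_less flat_exp_def field_simps exp_minus
         intro!: eventually_mono[OF eventually_at_right_less])
  moreover have "(flat_exp m \<longlongrightarrow> 0) (at_left 0)"
    by (rule Lim_transform_eventually[OF tendsto_const])
       (auto simp: flat_exp_def eventually_at_filter)
  ultimately show ?thesis
    by (simp add: filterlim_split_at)
qed

lemma flat_exp_has_derivative:
  "(flat_exp m has_real_derivative flat_exp (m + 2) x - real m * flat_exp (m + 1) x) (at x)"
proof -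
  consider "x < 0" | "x = 0" | "x > 0" by linarith
  then show ?thesis
  proof cases
    case 1
    have "((\<lambda>x. 0) has_real_derivative 0) (at x)" by simp
    then have "(flat_exp m has_real_derivative 0) (at x)"
      by (rule has_field_derivative_transform_within_open[of _ _ _ "{..<0}"])
         (use 1 in \<open>auto simp: flat_exp_def\<close>)
    then show ?thesis using 1 by (simp add: flat_exp_def)
  next
    case 2
    have "((\<lambda>y. (flat_exp m y - flat_exp m 0) / (y - 0)) \<longlongrightarrow> 0) (at 0)"
      using flat_exp_tendsto_0[of "Suc m"]
      by (rule Lim_transform_eventually) (auto simp: flat_exp_def eventually_at_filter mult.commute)
    then show ?thesis using 2 by (simp add: has_field_derivative_iff flat_exp_def)
  next
    case 3
    have "((\<lambda>x. exp (- inverse x) / x ^ m) has_real_derivative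
        (exp (- inverse x) * (inverse x)\<^sup>2 * x ^ m - exp (- inverse x) * (real m * x ^ (m - 1))) / (x ^ m * x ^ m)) (at x)"
      using 3 by (auto intro!: derivative_eq_intros simp: power2_eq_square)
    also have "(exp (- inverse x) * (inverse x)\<^sup>2 * x ^ m - exp (- inverse x) * (real m * x ^ (m - 1))) / (x ^ m * x ^ m)
        = flat_exp (m + 2) x - real m * flat_exp (m + 1) x"
    proof (cases m)
      case 0
      then show ?thesis using 3 by (simp add: flat_exp_def power2_eq_square field_simps)
    next
      case (Suc j)
      then show ?thesis using 3 by (simp add: flat_exp_def power2_eq_square field_simps)
    qed
    finally show ?thesis
      by (rule has_field_derivative_transform_within_open[of _ _ _ "{0<..}"])
         (use 3 in \<open>auto simp: flat_exp_def\<close>)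
  qed
qed

lemma Ck_flat_exp: "Ck_on k UNIV (flat_exp m)"
proof (induction k arbitrary: m)
  case 0
  show ?case
    using flat_exp_has_derivative
    by (auto intro!: continuous_at_imp_continuous_on DERIV_isCont)
next
  case (Suc k)
  show ?case
  proof (rule Ck_on_SucI[where f' = "\<lambda>x v. (flat_exp (m + 2) x + (- real m) * flat_exp (m + 1) x) * v"])
    show "(flat_exp m has_derivative (\<lambda>v. (flat_exp (m + 2) x + - real m * flat_exp (m + 1) x) * v)) (at x)" for x
      using flat_exp_has_derivative[of m x]
      by (simp add: has_field_derivative_def)
  qed (intro open_UNIV Ck_on_add Ck_on_mult Ck_on_const Suc.IH)+
qed

lemma exists_bump:
  fixes a :: "'e::euclidean_space"
  assumes "r > 0"
  shows "\<exists>\<beta>. smooth_open UNIV \<beta> \<and> \<beta> a = 1 \<and> (\<forall>y. y \<notin> ball a r \<longrightarrow> \<beta> y = (0::real))"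
proof (intro exI conjI)
  let ?\<beta> = "\<lambda>y. flat_exp 0 (r\<^sup>2 + (- 1) * ((y + - a) \<bullet> (y + - a))) * inverse (flat_exp 0 (r\<^sup>2))"
  have "Ck_on k UNIV (\<lambda>y. r\<^sup>2 + (- 1) * ((y + - a) \<bullet> (y + - a)))" for k
    by (intro open_UNIV Ck_on_add Ck_on_mult Ck_on_inner Ck_on_const Ck_on_id)
  then show "smooth_open UNIV ?\<beta>"
    using Ck_on_mult[OF open_UNIV Ck_on_compose[OF open_UNIV open_UNIV _ _ Ck_flat_exp] Ck_on_const[OF open_UNIV]]
    by blast
  show "?\<beta> a = 1"
    using assms by (simp add: flat_exp_def)
  show "\<forall>y. y \<notin> ball a r \<longrightarrow> ?\<beta> y = 0"
  proof (intro allI impI)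
    fix y assume that: "y \<notin> ball a r"
    have "r\<^sup>2 \<le> (norm (y - a))\<^sup>2"
      using that assms by (intro power_mono) (auto simp: dist_norm norm_minus_commute)
    then show "?\<beta> y = 0"
      by (simp add: flat_exp_def power2_norm_eq_inner)
  qed
qed

text \<open>Differentiation under the integral sign multiplies the weight \<open>\<phi>\<close> by \<open>t\<close>, which is why
  general weights are allowed.\<close>

lemma Ck_on_radial_integral:
  fixes h :: "'e::euclidean_space \<Rightarrow> real"
  assumes "r > 0"
  shows "Ck_on k (ball a r) h \<Longrightarrow> continuous_on {0..1} \<phi> \<Longrightarrow>
    Ck_on k (ball a r) (\<lambda>y. integral {0..1} (\<lambda>t. \<phi> t * h (a + t *\<^sub>R (y - a))))"
proof (induction k arbitrary: h \<phi>)
  let ?p = "\<lambda>z. a + snd z *\<^sub>R (fst z - a)"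
  have seg: "a + t *\<^sub>R (y - a) \<in> ball a r" if "y \<in> ball a r" "t \<in> {0..1}" for y t
  proof -
    have "\<bar>t\<bar> * norm (y - a) \<le> 1 * norm (y - a)"
      using that by (intro mult_right_mono) auto
    then show ?thesis using that by (simp add: dist_norm norm_minus_commute)
  qed
  have cont: "continuous_on (ball a r \<times> {0..1}) (\<lambda>z. \<phi> (snd z) * u (?p z))"
    if "continuous_on (ball a r) u" "continuous_on {0..1} \<phi>" for u :: "'e \<Rightarrow> real" and \<phi>
    using seg by (intro continuous_on_mult continuous_on_compose2[OF that(2)]
        continuous_on_compose2[OF that(1)] continuous_intros) auto
  have cont1: "continuous_on {0..1} (\<lambda>t. \<phi> t * u (a + t *\<^sub>R (y - a)))"
    if "continuous_on (ball a r) u" "continuous_on {0..1} \<phi>" "y \<in> ball a r" for u :: "'e \<Rightarrow> real" and \<phi> y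
    using continuous_on_compose2[OF cont[OF that(1,2)], of "{0..1}" "\<lambda>t. (y, t)"] that(3)
    by (force intro: continuous_intros)
  {
    case 0
    then show ?case
      using integral_continuous_on_param[of "ball a r" 0 "1::real" "\<lambda>y t. \<phi> t * h (a + t *\<^sub>R (y - a))"]
        cont[of h \<phi>] by (simp add: case_prod_unfold)
  next
    case (Suc k)
    let ?Dh = "\<lambda>z. frechet_derivative h (at z)"
    have Dh: "(h has_derivative ?Dh z) (at z)" if "z \<in> ball a r" for z
      using Ck_on_SucD(1)[OF Suc.prems(1) that] .
    have Dh0: "continuous_on (ball a r) (\<lambda>z. ?Dh z v)" for v
      using Ck_on_imp_continuous[OF Ck_on_SucD(2)[OF Suc.prems(1)]] .
    have t\<phi>: "continuous_on {0..1} (\<lambda>t. \<phi> t * t)"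
      using Suc.prems(2) by (intro continuous_intros)
    define D where "D = (\<lambda>y t. Blinfun (\<lambda>v. \<phi> t * t * ?Dh (a + t *\<^sub>R (y - a)) v))"
    have D: "blinfun_apply (D y t) = (\<lambda>v. \<phi> t * t * ?Dh (a + t *\<^sub>R (y - a)) v)"
      if "y \<in> ball a r" "t \<in> {0..1}" for y t
      unfolding D_def
      by (intro bounded_linear_Blinfun_apply bounded_linear_mult_right[THEN bounded_linear_compose]
          has_derivative_bounded_linear[OF Dh] seg that)
    have contD: "continuous_on (ball a r \<times> {0..1}) (\<lambda>(y, t). D y t)"
    proof (rule continuous_on_blinfun_componentwise)
      fix v
      have "continuous_on (ball a r \<times> {0..1}) (\<lambda>z. \<phi> (snd z) * snd z * ?Dh (?p z) v)"
        by (rule cont[OF Dh0 t\<phi>])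
      then show "continuous_on (ball a r \<times> {0..1}) (\<lambda>z. blinfun_apply (case z of (y, t) \<Rightarrow> D y t) v)"
        by (rule continuous_on_eq) (auto simp: D)
    qed
    have der: "((\<lambda>y. \<phi> t * h (a + t *\<^sub>R (y - a))) has_derivative blinfun_apply (D y t)) (at y)"
      if "y \<in> ball a r" "t \<in> {0..1}" for y t
    proof -
      have "((\<lambda>y. a + t *\<^sub>R (y - a)) has_derivative (\<lambda>v. t *\<^sub>R v)) (at y)"
        by (auto intro!: derivative_eq_intros)
      then have "((\<lambda>y. h (a + t *\<^sub>R (y - a))) has_derivative (\<lambda>v. ?Dh (a + t *\<^sub>R (y - a)) (t *\<^sub>R v))) (at y)"
        by (rule has_derivative_compose) (rule Dh[OF seg[OF that]])
      then have "((\<lambda>y. \<phi> t * h (a + t *\<^sub>R (y - a))) has_derivative (\<lambda>v. \<phi> t * ?Dh (a + t *\<^sub>R (y - a)) (t *\<^sub>R v))) (at y)"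
        by (rule has_derivative_mult_right)
      moreover have "(\<lambda>v. \<phi> t * ?Dh (a + t *\<^sub>R (y - a)) (t *\<^sub>R v)) = blinfun_apply (D y t)"
        using linear_scale[OF has_derivative_linear[OF Dh[OF seg[OF that]]]] D[OF that] by auto
      ultimately show ?thesis by simp
    qed
    show ?case
    proof (rule Ck_on_SucI[where f' = "\<lambda>y v. integral {0..1} (\<lambda>t. \<phi> t * t * ?Dh (a + t *\<^sub>R (y - a)) v)"])
      fix y assume y: "y \<in> ball a r"
      have "((\<lambda>y. integral (cbox 0 1) (\<lambda>t. \<phi> t * h (a + t *\<^sub>R (y - a)))) has_derivative
          blinfun_apply (integral (cbox 0 1) (D y))) (at y within ball a r)"
      proof (rule leibniz_rule)
        show "(\<lambda>t. \<phi> t * h (a + t *\<^sub>R (y - a))) integrable_on cbox 0 1" if "y \<in> ball a r" for y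
          using cont1[OF Ck_on_imp_continuous[OF Suc.prems(1)] Suc.prems(2) that]
          by (auto intro!: integrable_continuous_real)
      qed (use der contD y in \<open>auto intro: has_derivative_at_withinI\<close>)
      moreover have "blinfun_apply (integral (cbox 0 1) (D y))
          = (\<lambda>v. integral {0..1} (\<lambda>t. \<phi> t * t * ?Dh (a + t *\<^sub>R (y - a)) v))"
      proof
        fix v
        have "continuous_on {0..1} (D y)"
          using continuous_on_compose2[OF contD, of "{0..1}" "\<lambda>t. (y, t)"] y
          by (force intro: continuous_intros)
        then have "blinfun_apply (integral {0..1} (D y)) v = integral {0..1} (\<lambda>t. blinfun_apply (D y t) v)"
          by (intro blinfun_apply_integral integrable_continuous_real)
        also have "\<dots> = integral {0..1} (\<lambda>t. \<phi> t * t * ?Dh (a + t *\<^sub>R (y - a)) v)"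
          by (rule integral_cong) (use D[OF y] in auto)
        finally show "blinfun_apply (integral (cbox 0 1) (D y)) v
          = integral {0..1} (\<lambda>t. \<phi> t * t * ?Dh (a + t *\<^sub>R (y - a)) v)" by simp
      qed
      ultimately show "((\<lambda>y. integral {0..1} (\<lambda>t. \<phi> t * h (a + t *\<^sub>R (y - a)))) has_derivative
          (\<lambda>v. integral {0..1} (\<lambda>t. \<phi> t * t * ?Dh (a + t *\<^sub>R (y - a)) v))) (at y)"
        using y at_within_open[of y "ball a r"] by simp
    qed (use Suc.IH[OF Ck_on_SucD(2)[OF Suc.prems(1)] t\<phi>] in auto)
  }
qed

text \<open>Integrate \<open>t \<mapsto> d/dt g (a + t (y - a))\<close> from \<open>0\<close> to \<open>1\<close>.\<close>

lemma Hadamard: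
  fixes g :: "'e::euclidean_space \<Rightarrow> real"
  assumes "smooth_open (ball a r) g" "r > 0"
  obtains G where "\<And>b. smooth_open (ball a r) (G b)"
    "\<And>y. y \<in> ball a r \<Longrightarrow> g y = g a + (\<Sum>b\<in>Basis. ((y - a) \<bullet> b) * G b y)"
    "\<And>b. G b a = frechet_derivative g (at a) b"
proof
  let ?Dg = "\<lambda>z. frechet_derivative g (at z)"
  let ?G = "\<lambda>b y. integral {0..1} (\<lambda>t::real. 1 * ?Dg (a + t *\<^sub>R (y - a)) b)"
  show "smooth_open (ball a r) (?G b)" for b
    using Ck_on_radial_integral[OF assms(2) _ continuous_on_const, where h="\<lambda>z. ?Dg z b"]
      smooth_open_deriv(2)[OF assms(1)] by blast
  show "?G b a = ?Dg a b" for b by simp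
  fix y assume y: "y \<in> ball a r"
  have seg: "a + t *\<^sub>R (y - a) \<in> ball a r" if "t \<in> {0..1}" for t
  proof -
    have "\<bar>t\<bar> * norm (y - a) \<le> 1 * norm (y - a)"
      using that by (intro mult_right_mono) auto
    then show ?thesis using y by (simp add: dist_norm norm_minus_commute)
  qed
  have lin: "linear (?Dg z)" if "z \<in> ball a r" for z
    using smooth_open_deriv(1)[OF assms(1) that] by (rule has_derivative_linear)
  have "((\<lambda>t. g (a + t *\<^sub>R (y - a))) has_vector_derivative ?Dg (a + t *\<^sub>R (y - a)) (y - a)) (at t within {0..1})"
    if "t \<in> {0..1}" for t
  proof -
    have "((\<lambda>t. a + t *\<^sub>R (y - a)) has_derivative (\<lambda>s. s *\<^sub>R (y - a))) (at t within {0..1})"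
      by (auto intro!: derivative_eq_intros)
    then have "((\<lambda>t. g (a + t *\<^sub>R (y - a))) has_derivative (\<lambda>s. ?Dg (a + t *\<^sub>R (y - a)) (s *\<^sub>R (y - a)))) (at t within {0..1})"
      by (rule has_derivative_compose) (rule smooth_open_deriv(1)[OF assms(1) seg[OF that]])
    then show ?thesis
      unfolding has_vector_derivative_def using linear_scale[OF lin[OF seg[OF that]]] by simp
  qed
  then have "((\<lambda>t. ?Dg (a + t *\<^sub>R (y - a)) (y - a)) has_integral g (a + 1 *\<^sub>R (y - a)) - g (a + 0 *\<^sub>R (y - a))) {0..1}"
    by (intro fundamental_theorem_of_calculus) auto
  then have "g y - g a = integral {0..1} (\<lambda>t. ?Dg (a + t *\<^sub>R (y - a)) (y - a))"
    by (simp add: integral_unique)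
  also have "\<dots> = integral {0..1} (\<lambda>t. \<Sum>b\<in>Basis. ((y - a) \<bullet> b) * ?Dg (a + t *\<^sub>R (y - a)) b)"
  proof (rule integral_cong)
    fix t :: real assume "t \<in> {0..1}"
    then have l: "linear (?Dg (a + t *\<^sub>R (y - a)))" using lin seg by blast
    show "?Dg (a + t *\<^sub>R (y - a)) (y - a) = (\<Sum>b\<in>Basis. ((y - a) \<bullet> b) * ?Dg (a + t *\<^sub>R (y - a)) b)"
      using linear_sum[OF l, of "\<lambda>b. ((y - a) \<bullet> b) *\<^sub>R b" Basis] linear_scale[OF l]
      by (simp add: euclidean_representation)
  qed
  also have "\<dots> = (\<Sum>b\<in>Basis. integral {0..1} (\<lambda>t. ((y - a) \<bullet> b) * ?Dg (a + t *\<^sub>R (y - a)) b))"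
  proof (rule integral_sum)
    fix b :: 'e
    have "continuous_on (ball a r) (\<lambda>z. ?Dg z b)"
      using smooth_open_imp_continuous smooth_open_deriv(2)[OF assms(1)] by blast
    then have "continuous_on {0..1} (\<lambda>t. ?Dg (a + t *\<^sub>R (y - a)) b)"
      by (rule continuous_on_compose2) (use seg in \<open>auto intro!: continuous_intros\<close>)
    then show "(\<lambda>t. ((y - a) \<bullet> b) * ?Dg (a + t *\<^sub>R (y - a)) b) integrable_on {0..1}"
      by (intro integrable_continuous_real continuous_intros)
  qed auto
  finally show "g y = g a + (\<Sum>b\<in>Basis. ((y - a) \<bullet> b) * ?G b y)"
    by simp
qed


section \<open>Smooth local right inverses\<close>

text \<open>The inverse \<open>g\<close> of \<open>f\<close> is differentiable with \<open>g'(y) = f'(g y)\<^sup>-\<^sup>1\<close>, and smoothness follows by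
  induction once \<open>y \<mapsto> g'(y) w\<close> is known to be differentiable. This holds since
  \<open>(y, w) \<mapsto> (g y, g'(y) w)\<close> is the inverse of the tangent map \<open>(x, u) \<mapsto> (f x, f'(x) u)\<close>, whose
  derivative is invertible wherever that of \<open>f\<close> is.\<close>

lemma smooth_local_inverse:
  fixes f :: "'e::euclidean_space \<Rightarrow> 'e"
  assumes U: "open U" and f: "smooth_open U f" and a: "a \<in> U"
    and inj: "\<And>v. frechet_derivative f (at a) v = 0 \<Longrightarrow> v = 0"
  obtains V g where "open V" "f a \<in> V" "smooth_open V g" "\<And>y. y \<in> V \<Longrightarrow> g y \<in> U \<and> f (g y) = y"
    "g (f a) = a"
proof -
  define A where "A = (\<lambda>x. frechet_derivative f (at x))"
  have A: "(f has_derivative A x) (at x)" if "x \<in> U" for x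
    using smooth_open_deriv(1)[OF f that] unfolding A_def .
  have smA: "smooth_open U (\<lambda>x. A x v)" for v
    unfolding A_def by (rule smooth_open_deriv(2)[OF f])
  define f' where "f' = (\<lambda>x. Blinfun (A x))"
  have f': "blinfun_apply (f' x) = A x" if "x \<in> U" for x
    unfolding f'_def using bounded_linear_Blinfun_apply has_derivative_bounded_linear[OF A[OF that]] by blast
  have contf': "continuous_on U f'"
    by (rule continuous_on_blinfun_componentwise)
       (rule continuous_on_eq[OF smooth_open_imp_continuous[OF smA]], simp add: f')
  have "linear (A a)" using A[OF a] has_derivative_linear by blast
  moreover have "inj (A a)"
    using inj linear_injective_0[OF \<open>linear (A a)\<close>] unfolding A_def by blast
  ultimately obtain B where B: "linear B" "B \<circ> A a = id"
    using linear_injective_left_inverse by blast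
  have "Blinfun B o\<^sub>L f' a = id_blinfun"
    using B by (intro blinfun_eqI)
      (simp add: f'[OF a] bounded_linear_Blinfun_apply linear_conv_bounded_linear fun_eq_iff)
  then obtain U' V g g' where
    U': "open U'" "U' \<subseteq> U" "a \<in> U'" and V: "open V" "f a \<in> V" and hom: "homeomorphism U' V f g"
    and g: "\<And>y. y \<in> V \<Longrightarrow> (g has_derivative (g' y)) (at y)"
    and g': "\<And>y. y \<in> V \<Longrightarrow> g' y = inv (blinfun_apply (f' (g y)))"
    and bij: "\<And>y. y \<in> V \<Longrightarrow> bij (blinfun_apply (f' (g y)))"
    using inverse_function_theorem[OF U _ contf' a, of f] A f' by metis
  have gU: "g y \<in> U'" "g y \<in> U" "f (g y) = y" if "y \<in> V" for y
    using hom that U'(2) unfolding homeomorphism_def by auto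
  have fV: "f x \<in> V" "g (f x) = x" if "x \<in> U'" for x
    using hom that unfolding homeomorphism_def by auto
  have Ag: "A (g y) (g' y w) = w" "g' y (A (g y) w) = w" if "y \<in> V" for y w
    using bij[OF that] g'[OF that] f'[OF gU(2)[OF that]] surj_f_inv_f inv_f_f bij_is_surj bij_is_inj
    by metis+
  have ling: "linear (g' y)" if "y \<in> V" for y
    using g[OF that] has_derivative_linear by blast
  define D where "D = (\<lambda>b x. frechet_derivative (\<lambda>x. A x b) (at x))"
  have D: "((\<lambda>x. A x b) has_derivative D b x) (at x)" if "x \<in> U" for b x
    unfolding D_def using smooth_open_deriv(1)[OF smA that] .
  have smD: "smooth_open U (\<lambda>x. D b x c)" for b c
    unfolding D_def by (rule smooth_open_deriv(2)[OF smA])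
  \<comment> \<open>The tangent map of \<open>f\<close>, with \<open>A x u\<close> expanded in the basis so that it can be differentiated.\<close>
  define T where "T = (\<lambda>(x, u). (f x, \<Sum>b\<in>Basis. (u \<bullet> b) *\<^sub>R A x b))"
  have AT: "A x u = (\<Sum>b\<in>Basis. (u \<bullet> b) *\<^sub>R A x b)" if "x \<in> U" for x u
    using linear_sum[OF has_derivative_linear[OF A[OF that]], of "\<lambda>b. (u \<bullet> b) *\<^sub>R b" Basis]
      linear_scale[OF has_derivative_linear[OF A[OF that]]] by (simp add: euclidean_representation)
  define S where "S = (\<lambda>y w h. \<Sum>b\<in>Basis. (g' y w \<bullet> b) *\<^sub>R D b (g y) (g' y h))"
  have dg': "((\<lambda>y. g' y w) has_derivative (\<lambda>h. - g' y (S y w h))) (at y)" if y: "y \<in> V" for y w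
  proof -
    define x u where "x = g y" and "u = g' y w"
    have x: "x \<in> U'" "x \<in> U" unfolding x_def using gU[OF y] by auto
    have T': "(T has_derivative (\<lambda>(h, k). (A z h, (\<Sum>b\<in>Basis. (k \<bullet> b) *\<^sub>R A z b) + (\<Sum>b\<in>Basis. (v \<bullet> b) *\<^sub>R D b z h)))) (at (z, v))"
      if "z \<in> U" for z v
    proof -
      have 1: "((\<lambda>p. f (fst p)) has_derivative (\<lambda>q. A z (fst q))) (at (z, v))"
        using has_derivative_compose[OF has_derivative_fst[OF has_derivative_ident], of f "A z" "(z, v)" UNIV]
          A[OF that] by simp
      have 2: "((\<lambda>p. A (fst p) b) has_derivative (\<lambda>q. D b z (fst q))) (at (z, v))" for b
        using has_derivative_compose[OF has_derivative_fst[OF has_derivative_ident], of "\<lambda>z. A z b" "D b z" "(z, v)" UNIV]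
          D[OF that] by simp
      have "((\<lambda>p. (f (fst p), \<Sum>b\<in>Basis. (snd p \<bullet> b) *\<^sub>R A (fst p) b)) has_derivative
         (\<lambda>q. (A z (fst q), \<Sum>b\<in>Basis. (v \<bullet> b) *\<^sub>R D b z (fst q) + (snd q \<bullet> b) *\<^sub>R A z b))) (at (z, v))"
        by (rule derivative_eq_intros 1 2 refl | simp)+
      then show ?thesis unfolding T_def case_prod_unfold by (simp add: sum.distrib add.commute)
    qed
    have "((\<lambda>(y, w). (g y, g' y w)) has_derivative (\<lambda>(h, k). (g' y h, g' y (k - S y w h)))) (at (T (x, u)))"
    proof (rule has_derivative_inverse_strong[where S = "U' \<times> UNIV" and f = T and x = "(x, u)"])
      show "open (U' \<times> (UNIV :: 'e set))" using U'(1) by (simp add: open_Times)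
      show "(x, u) \<in> U' \<times> UNIV" using x by simp
      show "continuous_on (U' \<times> UNIV) T"
        using T' U'(2) by (auto intro!: continuous_at_imp_continuous_on has_derivative_continuous)
      show "(case T p of (y, w) \<Rightarrow> (g y, g' y w)) = p" if "p \<in> U' \<times> UNIV" for p
      proof -
        obtain z v where p0: "p = (z, v)" by (cases p)
        then have p: "p = (z, v)" "z \<in> U'" using that by auto
        then have "g' (f z) (A (g (f z)) v) = v" using fV Ag by blast
        then show ?thesis using p fV AT[of z v] U'(2) by (auto simp: T_def)
      qed
      show "(T has_derivative (\<lambda>(h, k). (A x h, (\<Sum>b\<in>Basis. (k \<bullet> b) *\<^sub>R A x b) + (\<Sum>b\<in>Basis. (u \<bullet> b) *\<^sub>R D b x h)))) (at (x, u))"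
        using T'[OF x(2)] .
      show "(\<lambda>(h, k). (A x h, (\<Sum>b\<in>Basis. (k \<bullet> b) *\<^sub>R A x b) + (\<Sum>b\<in>Basis. (u \<bullet> b) *\<^sub>R D b x h)))
          \<circ> (\<lambda>(h, k). (g' y h, g' y (k - S y w h))) = id"
        using Ag(1)[OF y] AT[OF x(2), symmetric] by (auto simp: fun_eq_iff x_def u_def S_def)
    qed
    moreover have "T (x, u) = (y, w)"
      using gU(3)[OF y] Ag(1)[OF y, of w] AT[OF x(2), of u] by (simp add: T_def x_def u_def)
    ultimately have "((\<lambda>(y, w). (g y, g' y w)) has_derivative (\<lambda>(h, k). (g' y h, g' y (k - S y w h)))) (at (y, w))"
      by simp
    moreover have "((\<lambda>y. (y, w)) has_derivative (\<lambda>h. (h, 0))) (at y)"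
      by (auto intro!: derivative_eq_intros)
    ultimately have "((\<lambda>y. (g y, g' y w)) has_derivative (\<lambda>h. (g' y h, g' y (0 - S y w h)))) (at y)"
      using has_derivative_compose[of "\<lambda>y. (y, w)" "\<lambda>h. (h, 0)" y UNIV "\<lambda>(y, w). (g y, g' y w)"
        "\<lambda>(h, k). (g' y h, g' y (k - S y w h))"] by simp
    from has_derivative_snd[OF this] show ?thesis
      using linear_neg[OF ling[OF y]] by simp
  qed
  have "Ck_on k V g \<and> (\<forall>w. Ck_on k V (\<lambda>y. g' y w))" for k
  proof (induction k)
    case 0
    show ?case
      using g dg' by (auto intro!: continuous_at_imp_continuous_on has_derivative_continuous)
  next
    case (Suc k)
    have IH: "Ck_on k V g" "Ck_on k V (\<lambda>y. g' y w)" for w using Suc.IH by auto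
    have Dg: "Ck_on k V (\<lambda>y. D b (g y) c)" for b c
      using Ck_on_compose[OF V(1) U _ IH(1), of "\<lambda>x. D b x c"] gU(2) smD by blast
    have "Ck_on k V (\<lambda>y. - g' y (S y w h))" for w h
    proof (rule Ck_on_cong[OF V(1)])
      show "Ck_on k V (\<lambda>y. \<Sum>b\<in>Basis. (-1::real) *\<^sub>R (g' y w \<bullet> b) *\<^sub>R
          (\<Sum>c\<in>Basis. (g' y h \<bullet> c) *\<^sub>R (\<Sum>d\<in>Basis. (D b (g y) c \<bullet> d) *\<^sub>R g' y d)))"
        by (intro V Ck_on_sum Ck_on_scaleR Ck_on_const Ck_on_inner IH Dg)
      fix y assume y: "y \<in> V"
      note l = linear_sum[OF ling[OF y]] linear_scale[OF ling[OF y]]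
      have eD: "D b (g y) z = (\<Sum>c\<in>Basis. (z \<bullet> c) *\<^sub>R D b (g y) c)" for b z
        using linear_sum[OF has_derivative_linear[OF D[OF gU(2)[OF y]]], of b "\<lambda>c. (z \<bullet> c) *\<^sub>R c" Basis]
          linear_scale[OF has_derivative_linear[OF D[OF gU(2)[OF y]]]] by (simp add: euclidean_representation)
      have eg: "(\<Sum>d\<in>Basis. (z \<bullet> d) *\<^sub>R g' y d) = g' y z" for z
        using l(1)[of "\<lambda>c. (z \<bullet> c) *\<^sub>R c" Basis] l(2) by (simp add: euclidean_representation)
      have "(\<Sum>c\<in>Basis. (g' y h \<bullet> c) *\<^sub>R (\<Sum>d\<in>Basis. (D b (g y) c \<bullet> d) *\<^sub>R g' y d)) = g' y (D b (g y) (g' y h))" for b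
        unfolding eg eD[of b "g' y h"] by (simp add: l)
      then show "(\<Sum>b\<in>Basis. (-1::real) *\<^sub>R (g' y w \<bullet> b) *\<^sub>R
          (\<Sum>c\<in>Basis. (g' y h \<bullet> c) *\<^sub>R (\<Sum>d\<in>Basis. (D b (g y) c \<bullet> d) *\<^sub>R g' y d))) = - g' y (S y w h)"
        unfolding S_def by (simp add: l sum_negf)
    qed
    then show ?case
      using Ck_on_SucI[OF V(1), of g g'] Ck_on_SucI[OF V(1) dg'] g IH by blast
  qed
  then show ?thesis
    using that[OF V, of g] gU fV(2)[OF U'(3)] by blast
qed


section \<open>Smooth functions on manifolds\<close>

lemma top_chartD:
  assumes "top_chart M U \<phi>"
  shows "openin (mtop M) U" "U \<subseteq> carr M" "inj_on \<phi> U" "\<phi> ` U \<subseteq> model M"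
    "openin (top_of_set (model M)) (\<phi> ` U)"
proof -
  show U: "openin (mtop M) U" "openin (top_of_set (model M)) (\<phi> ` U)"
    using assms unfolding top_chart_def by auto
  show "U \<subseteq> carr M" using U openin_subset by blast
  then have "topspace (subtopology (mtop M) U) = U" by auto
  then show "inj_on \<phi> U"
    using assms homeomorphic_imp_injective_map unfolding top_chart_def by metis
  show "\<phi> ` U \<subseteq> model M" using U(2) openin_imp_subset by blast
qed

lemma atlas_top_chart: "smooth_manifold M \<Longrightarrow> (U, \<phi>) \<in> atlas M \<Longrightarrow> top_chart M U \<phi>"
  unfolding smooth_manifold_def by auto

lemma atlas_smooth_chart: "smooth_manifold M \<Longrightarrow> (U, \<phi>) \<in> atlas M \<Longrightarrow> smooth_chart M U \<phi>"
  unfolding smooth_manifold_def smooth_chart_def by auto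

lemma smooth_chart_top: "smooth_chart M U \<phi> \<Longrightarrow> top_chart M U \<phi>"
  unfolding smooth_chart_def by blast

lemma atlas_cover:
  assumes "smooth_manifold M" "p \<in> carr M"
  obtains U \<phi> where "(U, \<phi>) \<in> atlas M" "p \<in> U"
proof -
  have "p \<in> \<Union> (fst ` atlas M)" using assms unfolding smooth_manifold_def by blast
  then show ?thesis using that by auto
qed

lemma chart_image_open:
  assumes "top_chart M U \<phi>" "openin (mtop M) T"
  obtains W where "open W" "\<phi> ` (U \<inter> T) = model M \<inter> W" "\<phi> ` (U \<inter> T) = \<phi> ` U \<inter> W"
proof -
  have "open_map (subtopology (mtop M) U) (top_of_set (\<phi> ` U)) \<phi>"
    using assms(1) homeomorphic_imp_open_map unfolding top_chart_def by blast
  moreover have "openin (subtopology (mtop M) U) (U \<inter> T)"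
    using assms(2) by (simp add: openin_subtopology_Int2)
  ultimately have "openin (top_of_set (\<phi> ` U)) (\<phi> ` (U \<inter> T))"
    unfolding open_map_def by blast
  then have "openin (top_of_set (model M)) (\<phi> ` (U \<inter> T))"
    using top_chartD(5)[OF assms(1)] openin_trans by blast
  then obtain W where "open W" "\<phi> ` (U \<inter> T) = model M \<inter> W"
    unfolding openin_open by blast
  then show ?thesis using that[of W] top_chartD(4)[OF assms(1)] by blast
qed

lemma chart_preimage_open:
  assumes "top_chart M U \<phi>" "open W"
  shows "openin (mtop M) {x \<in> U. \<phi> x \<in> W}"
proof -
  have c: "continuous_map (subtopology (mtop M) U) (top_of_set (\<phi> ` U)) \<phi>"
    using assms(1) homeomorphic_imp_continuous_map unfolding top_chart_def by blast
  have "openin (top_of_set (\<phi> ` U)) (\<phi> ` U \<inter> W)"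
    using assms(2) by (simp add: openin_open_Int)
  from openin_continuous_map_preimage[OF c this]
  have "openin (subtopology (mtop M) U) {x \<in> U. \<phi> x \<in> W}"
    using top_chartD(2)[OF assms(1)] by (auto simp: Int_absorb1 elim!: back_subst[of "openin _"])
  then show ?thesis
    using top_chartD(1)[OF assms(1)] openin_trans_full by blast
qed

lemma smooth_on_chart_local:
  assumes "top_chart M U \<phi>"
    and "\<And>x. x \<in> U \<Longrightarrow> \<exists>T. openin (mtop M) T \<and> x \<in> T \<and> smooth_on (\<phi> ` (U \<inter> T)) f"
  shows "smooth_on (\<phi> ` U) f"
proof (rule smooth_on_local)
  fix y assume "y \<in> \<phi> ` U"
  then obtain x where x: "x \<in> U" "y = \<phi> x" by blast
  then obtain T where T: "openin (mtop M) T" "x \<in> T" "smooth_on (\<phi> ` (U \<inter> T)) f"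
    using assms(2) by blast
  then obtain W where "open W" "\<phi> ` (U \<inter> T) = \<phi> ` U \<inter> W"
    using chart_image_open[OF assms(1)] by metis
  then show "\<exists>W. open W \<and> y \<in> W \<and> smooth_on (\<phi> ` U \<inter> W) f"
    using x T by (metis Int_iff imageI)
qed

lemma Cinf_off_carrier: "f \<in> Cinf M \<Longrightarrow> x \<notin> carr M \<Longrightarrow> f x = 0"
  unfolding Cinf_def by blast

lemma Cinf_smooth_atlas:
  assumes "smooth_manifold M" "f \<in> Cinf M" "(U, \<phi>) \<in> atlas M"
  shows "smooth_on (\<phi> ` U) (f \<circ> inv_into U \<phi>)"
proof -
  have "U \<inter> carr M = U"
    using top_chartD(2) atlas_top_chart assms(1,3) by blast
  then show ?thesis
    using assms unfolding Cinf_def smooth_fun_on_def by fastforce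
qed

lemma CinfI:
  assumes "smooth_manifold M" "\<And>x. x \<notin> carr M \<Longrightarrow> f x = 0"
    and "\<And>U \<phi>. (U, \<phi>) \<in> atlas M \<Longrightarrow> smooth_on (\<phi> ` U) (f \<circ> inv_into U \<phi>)"
  shows "f \<in> Cinf M"
proof -
  have "U \<inter> carr M = U" if "(U, \<phi>) \<in> atlas M" for U \<phi>
    using top_chartD(2) atlas_top_chart assms(1) that by blast
  then show ?thesis
    using assms unfolding Cinf_def smooth_fun_on_def by fastforce
qed

lemma Cinf_zero: "(\<lambda>x. 0) \<in> Cinf M"
  unfolding Cinf_def smooth_fun_on_def by (auto simp: o_def smooth_on_const)

lemma Cinf_lincomb:
  assumes "f \<in> Cinf M" "g \<in> Cinf M"
  shows "(\<lambda>x. a * f x + b * g x) \<in> Cinf M"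
  using assms unfolding Cinf_def smooth_fun_on_def
  by (auto simp: o_def intro!: smooth_on_lincomb dest!: bspec)

lemma Cinf_mult:
  assumes "f \<in> Cinf M" "g \<in> Cinf M"
  shows "(\<lambda>x. f x * g x) \<in> Cinf M"
  using assms unfolding Cinf_def smooth_fun_on_def
  by (auto simp: o_def intro!: smooth_on_mult dest!: bspec)

lemma Cinf_sum:
  assumes "\<And>i. i \<in> I \<Longrightarrow> f i \<in> Cinf M"
  shows "(\<lambda>x. \<Sum>i\<in>I. f i x) \<in> Cinf M"
  using assms
proof (induction I rule: infinite_finite_induct)
  case (insert i I)
  then show ?case using Cinf_lincomb[of "f i" M "\<lambda>x. \<Sum>i\<in>I. f i x" 1 1] by simp
qed (simp_all add: Cinf_zero)

lemma Cinf_smooth_chart: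
  assumes M: "smooth_manifold M" and f: "f \<in> Cinf M" and c: "smooth_chart M U \<phi>"
  shows "smooth_on (\<phi> ` U) (f \<circ> inv_into U \<phi>)"
proof (rule smooth_on_chart_local[OF smooth_chart_top[OF c]])
  fix x assume x: "x \<in> U"
  have inj: "inj_on \<phi> U" and Uc: "U \<subseteq> carr M"
    using top_chartD smooth_chart_top[OF c] by blast+
  then obtain U' \<phi>' where A: "(U', \<phi>') \<in> atlas M" "x \<in> U'"
    using atlas_cover[OF M] x by blast
  have inj': "inj_on \<phi>' U'" using top_chartD atlas_top_chart[OF M A(1)] by blast
  have "smooth_on (\<phi> ` (U \<inter> U')) (\<phi>' \<circ> inv_into U \<phi>)"
    using c A(1) unfolding smooth_chart_def compatible_charts_def by blast
  moreover have "(\<phi>' \<circ> inv_into U \<phi>) ` \<phi> ` (U \<inter> U') \<subseteq> \<phi>' ` U'"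
    using inj by auto
  ultimately have "smooth_on (\<phi> ` (U \<inter> U')) ((f \<circ> inv_into U' \<phi>') \<circ> (\<phi>' \<circ> inv_into U \<phi>))"
    using smooth_on_compose Cinf_smooth_atlas[OF M f A(1)] by blast
  then have "smooth_on (\<phi> ` (U \<inter> U')) (f \<circ> inv_into U \<phi>)"
    by (rule smooth_on_cong) (use inj inj' in auto)
  then show "\<exists>T. openin (mtop M) T \<and> x \<in> T \<and> smooth_on (\<phi> ` (U \<inter> T)) (f \<circ> inv_into U \<phi>)"
    using A top_chartD(1)[OF atlas_top_chart[OF M A(1)]] by (intro exI[of _ U']) auto
qed

lemma pull_apply: "x \<in> carr M \<Longrightarrow> pull M h f x = f (h x)"
  unfolding pull_def by simp

lemma Cinf_pull:
  assumes M: "smooth_manifold M" and N: "smooth_manifold N" and h: "smooth_map M N h"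
    and f: "f \<in> Cinf N"
  shows "pull M h f \<in> Cinf M"
proof (rule CinfI[OF M])
  fix U \<phi> assume A: "(U, \<phi>) \<in> atlas M"
  note tc = atlas_top_chart[OF M A]
  have inj: "inj_on \<phi> U" and Uc: "U \<subseteq> carr M"
    using top_chartD[OF tc] by blast+
  have hc: "continuous_map (mtop M) (mtop N) h" using h unfolding smooth_map_def by blast
  show "smooth_on (\<phi> ` U) (pull M h f \<circ> inv_into U \<phi>)"
  proof (rule smooth_on_chart_local[OF tc])
    fix x assume x: "x \<in> U"
    then have "h x \<in> carr N" using hc Uc continuous_map_image_subset_topspace by blast
    then obtain V \<psi> where B: "(V, \<psi>) \<in> atlas N" "h x \<in> V" using atlas_cover[OF N] by blast
    have inj': "inj_on \<psi> V" using top_chartD atlas_top_chart[OF N B(1)] by blast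
    have "smooth_on (\<phi> ` (U \<inter> h -` V)) (\<psi> \<circ> h \<circ> inv_into U \<phi>)"
      using h A B(1) unfolding smooth_map_def by blast
    moreover have "(\<psi> \<circ> h \<circ> inv_into U \<phi>) ` \<phi> ` (U \<inter> h -` V) \<subseteq> \<psi> ` V"
      using inj by auto
    ultimately have "smooth_on (\<phi> ` (U \<inter> h -` V)) ((f \<circ> inv_into V \<psi>) \<circ> (\<psi> \<circ> h \<circ> inv_into U \<phi>))"
      using smooth_on_compose Cinf_smooth_atlas[OF N f B(1)] by blast
    then have s: "smooth_on (\<phi> ` (U \<inter> h -` V)) (pull M h f \<circ> inv_into U \<phi>)"
      by (rule smooth_on_cong) (use inj inj' Uc in \<open>auto simp: pull_def\<close>)
    have "openin (mtop M) {x \<in> carr M. h x \<in> V}"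
      using openin_continuous_map_preimage[OF hc] top_chartD(1) atlas_top_chart[OF N B(1)] by blast
    moreover have "U \<inter> {x \<in> carr M. h x \<in> V} = U \<inter> h -` V" using Uc by auto
    ultimately show "\<exists>T. openin (mtop M) T \<and> x \<in> T \<and> smooth_on (\<phi> ` (U \<inter> T)) (pull M h f \<circ> inv_into U \<phi>)"
      using s x B(2) Uc by (intro exI[of _ "{x \<in> carr M. h x \<in> V}"]) auto
  qed
qed (simp add: pull_def)

text \<open>The compact set outside of which the function is zero is closed because the manifold is
  Hausdorff, so its complement and the chart domain form an open cover, and the function is smooth
  on both members.\<close>

lemma Cinf_extend_by_zero:
  assumes M: "smooth_manifold M" and A: "(U, \<phi>) \<in> atlas M"
    and sub: "model M \<inter> cball a r \<subseteq> \<phi> ` U" and k: "smooth_open UNIV k"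
    and 0: "\<And>y. y \<notin> cball a r \<Longrightarrow> k y = 0"
  shows "(\<lambda>x. if x \<in> U then k (\<phi> x) else 0) \<in> Cinf M" (is "?F \<in> _")
proof (rule CinfI[OF M])
  note tc = atlas_top_chart[OF M A]
  have inj: "inj_on \<phi> U" and Uc: "U \<subseteq> carr M" and Um: "\<phi> ` U \<subseteq> model M"
    using top_chartD[OF tc] by blast+
  show "?F x = 0" if "x \<notin> carr M" for x using that Uc by auto
  obtain \<psi> where \<psi>: "homeomorphic_maps (subtopology (mtop M) U) (top_of_set (\<phi> ` U)) \<phi> \<psi>"
    using tc homeomorphic_map_maps unfolding top_chart_def by blast
  define K where "K = \<psi> ` (model M \<inter> cball a r)"
  have \<psi>\<phi>: "\<psi> (\<phi> x) = x" if "x \<in> U" for x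
    using \<psi> that Uc unfolding homeomorphic_maps_def by auto
  have K: "K = {x \<in> U. \<phi> x \<in> cball a r}"
  proof
    show "K \<subseteq> {x \<in> U. \<phi> x \<in> cball a r}"
    proof
      fix z assume "z \<in> K"
      then obtain y where y: "z = \<psi> y" "y \<in> model M \<inter> cball a r" unfolding K_def by blast
      then obtain x where "x \<in> U" "y = \<phi> x" using sub by blast
      then show "z \<in> {x \<in> U. \<phi> x \<in> cball a r}" using y \<psi>\<phi> by auto
    qed
    show "{x \<in> U. \<phi> x \<in> cball a r} \<subseteq> K"
    proof
      fix x assume "x \<in> {x \<in> U. \<phi> x \<in> cball a r}"
      then have "\<phi> x \<in> model M \<inter> cball a r" "x = \<psi> (\<phi> x)" using \<psi>\<phi> Um by auto
      then show "x \<in> K" unfolding K_def by blast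
    qed
  qed
  have "closed (model M)" using M closed_subspace unfolding smooth_manifold_def by blast
  then have "compact (model M \<inter> cball a r)" by (simp add: closed_Int_compact)
  then have "compactin (top_of_set (\<phi> ` U)) (model M \<inter> cball a r)"
    using sub by (simp add: compactin_subtopology)
  moreover have "continuous_map (top_of_set (\<phi> ` U)) (mtop M) \<psi>"
    using \<psi> continuous_map_in_subtopology unfolding homeomorphic_maps_def by blast
  ultimately have "compactin (mtop M) K"
    unfolding K_def by (rule image_compactin)
  then have "closedin (mtop M) K"
    using M compactin_imp_closedin unfolding smooth_manifold_def by blast
  then have oK: "openin (mtop M) (carr M - K)" by blast
  fix U' \<phi>' assume A': "(U', \<phi>') \<in> atlas M"
  note tc' = atlas_top_chart[OF M A']
  have inj': "inj_on \<phi>' U'" and Uc': "U' \<subseteq> carr M"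
    using top_chartD[OF tc'] by blast+
  show "smooth_on (\<phi>' ` U') (?F \<circ> inv_into U' \<phi>')"
  proof (rule smooth_on_chart_local[OF tc'])
    fix x assume x: "x \<in> U'"
    show "\<exists>T. openin (mtop M) T \<and> x \<in> T \<and> smooth_on (\<phi>' ` (U' \<inter> T)) (?F \<circ> inv_into U' \<phi>')"
    proof (cases "x \<in> K")
      case True
      have "compatible_charts U' \<phi>' U \<phi>"
        using M A A' unfolding smooth_manifold_def by auto
      then have "smooth_on (\<phi>' ` (U' \<inter> U)) (\<phi> \<circ> inv_into U' \<phi>')"
        unfolding compatible_charts_def by blast
      moreover have "smooth_on UNIV k"
        using smooth_open_imp_on[OF k] by auto
      ultimately have "smooth_on (\<phi>' ` (U' \<inter> U)) (k \<circ> (\<phi> \<circ> inv_into U' \<phi>'))"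
        using smooth_on_compose by blast
      then have "smooth_on (\<phi>' ` (U' \<inter> U)) (?F \<circ> inv_into U' \<phi>')"
        by (rule smooth_on_cong) (use inj' in auto)
      then show ?thesis using top_chartD(1)[OF tc] True K by blast
    next
      case False
      have "k (\<phi> y) = 0" if "y \<in> U" "y \<notin> K" for y
        using that K 0 by auto
      then have "smooth_on (\<phi>' ` (U' \<inter> (carr M - K))) (?F \<circ> inv_into U' \<phi>')"
        using inj' by (intro smooth_on_cong[OF smooth_on_const[where c = 0]]) auto
      then show ?thesis using oK False x Uc' by blast
    qed
  qed
qed

text \<open>The values of \<open>u\<close> outside the support of the bump function \<open>\<beta>\<close> do not matter, so \<open>u\<close> may
  be a function that is smooth only near the point of interest.\<close>

definition cut_off :: "'a set \<Rightarrow> ('a \<Rightarrow> 'e) \<Rightarrow> ('e \<Rightarrow> real) \<Rightarrow> ('e \<Rightarrow> real) \<Rightarrow> 'a \<Rightarrow> real" where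
  "cut_off U \<phi> \<beta> u = (\<lambda>x. if x \<in> U then \<beta> (\<phi> x) * u (\<phi> x) else 0)"

lemma exists_cut_off:
  assumes M: "smooth_manifold M" and A: "(U, \<phi>) \<in> atlas M" and p: "p \<in> U"
    and W: "open W" "\<phi> p \<in> W"
  obtains \<beta> where "smooth_open UNIV \<beta>" "\<beta> (\<phi> p) = 1" "\<And>y. y \<notin> W \<Longrightarrow> \<beta> y = 0"
    "\<And>u. smooth_open W u \<Longrightarrow> cut_off U \<phi> \<beta> u \<in> Cinf M"
proof -
  note tc = atlas_top_chart[OF M A]
  obtain W1 where W1: "open W1" "\<phi> ` U = model M \<inter> W1"
    using top_chartD(5)[OF tc] unfolding openin_open by blast
  have "open (W \<inter> W1)" "\<phi> p \<in> W \<inter> W1" using W W1 p by auto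
  then obtain r where r: "r > 0" "cball (\<phi> p) r \<subseteq> W \<inter> W1"
    using open_contains_cball by blast
  obtain \<beta> :: "_ \<Rightarrow> real" where \<beta>: "smooth_open UNIV \<beta>" "\<beta> (\<phi> p) = 1" "\<And>y. y \<notin> ball (\<phi> p) r \<Longrightarrow> \<beta> y = 0"
    using exists_bump[OF r(1), of "\<phi> p"] by blast
  show ?thesis
  proof
    show "\<beta> y = 0" if "y \<notin> W" for y using \<beta>(3) r(2) that by force
    fix u :: "_ \<Rightarrow> real" assume u: "smooth_open W u"
    have "smooth_open UNIV (\<lambda>y. \<beta> y * u y)"
    proof (intro allI Ck_on_local)
      fix k y
      show "\<exists>T. open T \<and> y \<in> T \<and> Ck_on k T (\<lambda>y. \<beta> y * u y)"
      proof (cases "y \<in> W")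
        case True
        have "Ck_on k W (\<lambda>y. \<beta> y * u y)"
          by (rule Ck_on_mult[OF W(1) Ck_on_subset[of k UNIV \<beta> W]]) (use \<beta>(1) u in auto)
        then show ?thesis using W(1) True by blast
      next
        case False
        have "Ck_on k (- cball (\<phi> p) r) (\<lambda>y. \<beta> y * u y)"
          by (rule Ck_on_cong[OF _ _ Ck_on_const[where c = 0]])
             (use \<beta>(3) in \<open>auto simp: open_Compl\<close>)
        then show ?thesis
          using False r(2) by (intro exI[of _ "- cball (\<phi> p) r"]) (auto simp: open_Compl)
      qed
    qed
    moreover have "model M \<inter> cball (\<phi> p) r \<subseteq> \<phi> ` U" using r(2) W1(2) by blast
    ultimately show "cut_off U \<phi> \<beta> u \<in> Cinf M"
      using Cinf_extend_by_zero[OF M A, of "\<phi> p" r "\<lambda>y. \<beta> y * u y"] \<beta>(3)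
      unfolding cut_off_def by auto
  qed (use \<beta> in auto)
qed


section \<open>Tangent vectors in a chart\<close>

lemma Cinf_local_repr:
  assumes "smooth_manifold M" "f \<in> Cinf M" "smooth_chart M U \<phi>" "p \<in> U"
  obtains W g where "open W" "\<phi> p \<in> W" "smooth_open W g"
    "\<And>x. x \<in> U \<Longrightarrow> \<phi> x \<in> W \<Longrightarrow> g (\<phi> x) = f x"
proof -
  obtain W g where "open W" "\<phi> p \<in> W" "smooth_open W g"
    "\<And>y. y \<in> \<phi> ` U \<Longrightarrow> y \<in> W \<Longrightarrow> g y = (f \<circ> inv_into U \<phi>) y"
    using smooth_onE[OF Cinf_smooth_chart[OF assms(1-3)], of "\<phi> p"] assms(4) by blast
  then show ?thesis
    using that[of W g] top_chartD(3)[OF smooth_chart_top[OF assms(3)]] by simp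
qed

lemma chart_line:
  assumes M: "smooth_manifold M" and c: "top_chart M U \<phi>" and p: "p \<in> U" and w: "w \<in> model M"
    and W: "open W" "\<phi> p \<in> W"
  obtains e where "e > 0" "\<And>t. \<bar>t\<bar> < e \<Longrightarrow> \<phi> p + t *\<^sub>R w \<in> W \<and> \<phi> p + t *\<^sub>R w \<in> \<phi> ` U"
proof -
  obtain W1 where W1: "open W1" "\<phi> ` U = model M \<inter> W1"
    using top_chartD(5)[OF c] unfolding openin_open by blast
  have sub: "subspace (model M)" using M unfolding smooth_manifold_def by blast
  have "open ((\<lambda>t::real. \<phi> p + t *\<^sub>R w) -` (W \<inter> W1))"
    using W W1 by (intro open_vimage open_Int) (auto intro!: continuous_intros)
  moreover have "0 \<in> (\<lambda>t::real. \<phi> p + t *\<^sub>R w) -` (W \<inter> W1)" using W W1 p by auto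
  ultimately obtain e where e: "e > 0" "ball 0 e \<subseteq> (\<lambda>t::real. \<phi> p + t *\<^sub>R w) -` (W \<inter> W1)"
    using open_contains_ball by blast
  have "\<phi> p + t *\<^sub>R w \<in> W \<and> \<phi> p + t *\<^sub>R w \<in> \<phi> ` U" if "\<bar>t\<bar> < e" for t
  proof -
    have "t \<in> ball 0 e" using that by simp
    moreover have "\<phi> p + t *\<^sub>R w \<in> model M"
      using sub w p W1(2) by (metis Int_iff imageI subspace_add subspace_mul)
    ultimately show ?thesis using e(2) W1(2) by blast
  qed
  then show ?thesis using that e(1) by blast
qed

lemma chart_vec_eq:
  assumes M: "smooth_manifold M" and c: "top_chart M U \<phi>" and p: "p \<in> U" and w: "w \<in> model M"
    and f: "f \<in> Cinf M" and W: "open W" "\<phi> p \<in> W" and g: "(g has_derivative D) (at (\<phi> p))"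
    and gf: "\<And>x. x \<in> U \<Longrightarrow> \<phi> x \<in> W \<Longrightarrow> g (\<phi> x) = f x"
  shows "((\<lambda>t. f (inv_into U \<phi> (\<phi> p + t *\<^sub>R w))) has_real_derivative D w) (at 0)"
    and "chart_vec M U \<phi> p w f = D w"
proof -
  obtain e where e: "e > 0" "\<And>t. \<bar>t\<bar> < e \<Longrightarrow> \<phi> p + t *\<^sub>R w \<in> W \<and> \<phi> p + t *\<^sub>R w \<in> \<phi> ` U"
    using chart_line[OF M c p w W] by blast
  have "((\<lambda>t::real. \<phi> p + t *\<^sub>R w) has_derivative (\<lambda>t. t *\<^sub>R w)) (at 0)"
    by (auto intro!: derivative_eq_intros)
  moreover have "(g has_derivative D) (at (\<phi> p + 0 *\<^sub>R w))" using g by simp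
  ultimately have "((\<lambda>t::real. g (\<phi> p + t *\<^sub>R w)) has_derivative (\<lambda>t. D (t *\<^sub>R w))) (at 0)"
    by (rule has_derivative_compose)
  moreover have "(\<lambda>t. D (t *\<^sub>R w)) = (*) (D w)"
    using linear_scale[OF has_derivative_linear[OF g]] by auto
  ultimately have "((\<lambda>t::real. g (\<phi> p + t *\<^sub>R w)) has_real_derivative D w) (at 0)"
    unfolding has_field_derivative_def by simp
  then show *: "((\<lambda>t. f (inv_into U \<phi> (\<phi> p + t *\<^sub>R w))) has_real_derivative D w) (at 0)"
  proof (rule has_field_derivative_transform_within_open[where S = "ball 0 e"])
    fix t :: real assume "t \<in> ball 0 e"
    then obtain x where "x \<in> U" "\<phi> p + t *\<^sub>R w = \<phi> x" "\<phi> x \<in> W" using e(2)[of t] by auto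
    then show "g (\<phi> p + t *\<^sub>R w) = f (inv_into U \<phi> (\<phi> p + t *\<^sub>R w))"
      using gf top_chartD(3)[OF c] by simp
  qed (use e in auto)
  show "chart_vec M U \<phi> p w f = D w"
    unfolding chart_vec_def using f DERIV_imp_deriv[OF *] by simp
qed

lemma chart_vec_repr:
  assumes M: "smooth_manifold M" and c: "smooth_chart M U \<phi>" and p: "p \<in> U" and f: "f \<in> Cinf M"
  obtains W g D where "open W" "\<phi> p \<in> W" "smooth_open W g" "\<And>x. x \<in> U \<Longrightarrow> \<phi> x \<in> W \<Longrightarrow> g (\<phi> x) = f x"
    "(g has_derivative D) (at (\<phi> p))" "\<And>w. w \<in> model M \<Longrightarrow> chart_vec M U \<phi> p w f = D w"
proof -
  obtain W g where W: "open W" "\<phi> p \<in> W" and g: "smooth_open W g"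
    "\<And>x. x \<in> U \<Longrightarrow> \<phi> x \<in> W \<Longrightarrow> g (\<phi> x) = f x"
    using Cinf_local_repr[OF M f c p] by blast
  note d = smooth_open_deriv(1)[OF g(1) W(2)]
  show ?thesis
    using that[OF W g d] chart_vec_eq(2)[OF M smooth_chart_top[OF c] p _ f W d g(2)] by blast
qed

lemma chart_vec_off: "f \<notin> Cinf M \<Longrightarrow> chart_vec M U \<phi> p w f = 0"
  unfolding chart_vec_def by simp

lemma chart_vec_tangent:
  assumes M: "smooth_manifold M" and c: "smooth_chart M U \<phi>" and p: "p \<in> U" and w: "w \<in> model M"
  shows "chart_vec M U \<phi> p w \<in> tangent M p"
proof -
  note eq = chart_vec_eq(2)[OF M smooth_chart_top[OF c] p w]
  have "chart_vec M U \<phi> p w (\<lambda>x. a * f x + b * g x) = a * chart_vec M U \<phi> p w f + b * chart_vec M U \<phi> p w g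
     \<and> chart_vec M U \<phi> p w (\<lambda>x. f x * g x) = f p * chart_vec M U \<phi> p w g + g p * chart_vec M U \<phi> p w f"
    if fg: "f \<in> Cinf M" "g \<in> Cinf M" for f g a b
  proof -
    obtain W1 f' D1 where 1: "open W1" "\<phi> p \<in> W1" "\<And>x. x \<in> U \<Longrightarrow> \<phi> x \<in> W1 \<Longrightarrow> f' (\<phi> x) = f x"
      "(f' has_derivative D1) (at (\<phi> p))" "chart_vec M U \<phi> p w f = D1 w"
      using chart_vec_repr[OF M c p fg(1)] w by metis
    obtain W2 g' D2 where 2: "open W2" "\<phi> p \<in> W2" "\<And>x. x \<in> U \<Longrightarrow> \<phi> x \<in> W2 \<Longrightarrow> g' (\<phi> x) = g x"
      "(g' has_derivative D2) (at (\<phi> p))" "chart_vec M U \<phi> p w g = D2 w"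
      using chart_vec_repr[OF M c p fg(2)] w by metis
    have W: "open (W1 \<inter> W2)" "\<phi> p \<in> W1 \<inter> W2" using 1 2 by auto
    have "((\<lambda>y. a * f' y + b * g' y) has_derivative (\<lambda>v. a * D1 v + b * D2 v)) (at (\<phi> p))"
      by (rule derivative_eq_intros 1(4) 2(4) refl | simp)+
    from eq[OF Cinf_lincomb[OF fg] W this] have
      "chart_vec M U \<phi> p w (\<lambda>x. a * f x + b * g x) = a * D1 w + b * D2 w"
      using 1(3) 2(3) by auto
    moreover have "((\<lambda>y. f' y * g' y) has_derivative (\<lambda>v. f' (\<phi> p) * D2 v + D1 v * g' (\<phi> p))) (at (\<phi> p))"
      by (rule has_derivative_mult[OF 1(4) 2(4)])
    from eq[OF Cinf_mult[OF fg] W this] have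
      "chart_vec M U \<phi> p w (\<lambda>x. f x * g x) = f' (\<phi> p) * D2 w + D1 w * g' (\<phi> p)"
      using 1(3) 2(3) by auto
    ultimately show ?thesis
      using 1 2 p by (simp add: mult.commute)
  qed
  then show ?thesis
    unfolding tangent_def by (auto simp: chart_vec_off)
qed

lemma tangentD:
  assumes "v \<in> tangent M p"
  shows "f \<in> Cinf M \<Longrightarrow> g \<in> Cinf M \<Longrightarrow> v (\<lambda>x. a * f x + b * g x) = a * v f + b * v g"
    and "f \<in> Cinf M \<Longrightarrow> g \<in> Cinf M \<Longrightarrow> v (\<lambda>x. f x * g x) = f p * v g + g p * v f"
    and "f \<notin> Cinf M \<Longrightarrow> v f = 0"
  using assms unfolding tangent_def by blast+

lemma tangent_zero_fun: "v \<in> tangent M p \<Longrightarrow> v (\<lambda>x. 0) = 0"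
  using tangentD(1)[of v M p "\<lambda>x. 0" "\<lambda>x. 0" 0 0] Cinf_zero[of M] by simp

lemma tangent_sum:
  assumes v: "v \<in> tangent M p" and f: "\<And>i. i \<in> I \<Longrightarrow> f i \<in> Cinf M"
  shows "v (\<lambda>x. \<Sum>i\<in>I. f i x) = (\<Sum>i\<in>I. v (f i))"
  using f
proof (induction I rule: infinite_finite_induct)
  case (insert i I)
  then show ?case
    using tangentD(1)[OF v, of "f i" "\<lambda>x. \<Sum>i\<in>I. f i x" 1 1] Cinf_sum[of I f M] by simp
qed (simp_all add: tangent_zero_fun[OF v])

lemma chart_vec_cut_off:
  assumes M: "smooth_manifold M" and c: "top_chart M U \<phi>" and p: "p \<in> U" and w: "w \<in> model M"
    and f: "cut_off U \<phi> \<beta> u \<in> Cinf M" and \<beta>: "smooth_open UNIV \<beta>" "\<beta> (\<phi> p) = 1"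
    and u: "(u has_derivative D) (at (\<phi> p))" "u (\<phi> p) = 0"
  shows "chart_vec M U \<phi> p w (cut_off U \<phi> \<beta> u) = D w"
proof -
  have "((\<lambda>y. \<beta> y * u y) has_derivative
      (\<lambda>v. \<beta> (\<phi> p) * D v + frechet_derivative \<beta> (at (\<phi> p)) v * u (\<phi> p))) (at (\<phi> p))"
    by (rule has_derivative_mult[OF smooth_open_deriv(1)[OF \<beta>(1)] u(1)]) simp
  from chart_vec_eq(2)[OF M c p w f open_UNIV _ this] show ?thesis
    using \<beta>(2) u(2) by (simp add: cut_off_def)
qed

text \<open>The components of the direction are the values of the derivation on the cut off coordinate
  functions. Near \<open>p\<close>, Hadamard's lemma writes a function as a constant plus products of
  coordinate functions vanishing at \<open>p\<close> with smooth functions; the Leibniz rule then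
  expresses the derivation by its values on the coordinate functions.\<close>

theorem tangent_imp_chart_vec:
  assumes M: "smooth_manifold M" and A: "(U, \<phi>) \<in> atlas M" and p: "p \<in> U"
    and v: "v \<in> tangent M p"
  obtains w where "w \<in> model M" "v = chart_vec M U \<phi> p w"
proof -
  note c = atlas_smooth_chart[OF M A] and tc = atlas_top_chart[OF M A]
  have inj: "inj_on \<phi> U" and Um: "\<phi> ` U \<subseteq> model M" using top_chartD[OF tc] by blast+
  have sub: "subspace (model M)" using M unfolding smooth_manifold_def by blast
  define a where "a = \<phi> p"
  define x where "x = (\<lambda>b y. (y + - a) \<bullet> b)"
  have smx: "smooth_open W (x b)" if "open W" for b W
    unfolding x_def using that by (intro allI Ck_on_inner Ck_on_add Ck_on_id Ck_on_const)
  have sm1: "smooth_open W (\<lambda>y. 1::real)" if "open W" for W :: "'b set"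
    using that by (intro allI Ck_on_const)
  obtain \<beta> where \<beta>: "smooth_open UNIV \<beta>" "\<beta> (\<phi> p) = 1" "\<And>u. smooth_open UNIV u \<Longrightarrow> cut_off U \<phi> \<beta> u \<in> Cinf M"
    by (rule exists_cut_off[OF M A p open_UNIV]) auto
  define w where "w = (\<Sum>b\<in>Basis. v (cut_off U \<phi> \<beta> (x b)) *\<^sub>R b)"
  have X: "cut_off U \<phi> \<beta> (x b) \<in> Cinf M" for b using \<beta>(3) smx by blast
  \<comment> \<open>The direction lies in the model space, being orthogonal to everything orthogonal to it.\<close>
  have "w \<bullet> u = 0" if u: "\<And>y. y \<in> model M \<Longrightarrow> u \<bullet> y = 0" for u
  proof -
    have "w \<bullet> u = (\<Sum>b\<in>Basis. v (\<lambda>z. (u \<bullet> b) * cut_off U \<phi> \<beta> (x b) z + 0 * cut_off U \<phi> \<beta> (x b) z))"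
      unfolding w_def inner_sum_left tangentD(1)[OF v X X]
      by (simp add: inner_commute mult.commute)
    also have "\<dots> = v (\<lambda>z. \<Sum>b\<in>Basis. (u \<bullet> b) * cut_off U \<phi> \<beta> (x b) z + 0 * cut_off U \<phi> \<beta> (x b) z)"
      by (rule tangent_sum[OF v Cinf_lincomb[OF X X], symmetric])
    also have "(\<lambda>z. \<Sum>b\<in>Basis. (u \<bullet> b) * cut_off U \<phi> \<beta> (x b) z + 0 * cut_off U \<phi> \<beta> (x b) z) = (\<lambda>z. 0)"
    proof
      fix z
      have "(\<Sum>b\<in>Basis. (u \<bullet> b) * ((\<phi> z + - a) \<bullet> b)) = u \<bullet> (\<phi> z + - a)"
        by (rule euclidean_inner[symmetric])
      also have "\<dots> = 0" if "z \<in> U"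
      proof -
        have "\<phi> z \<in> model M" "\<phi> p \<in> model M" using that Um p by auto
        then show ?thesis using u unfolding a_def by (simp add: inner_diff_right)
      qed
      finally show "(\<Sum>b\<in>Basis. (u \<bullet> b) * cut_off U \<phi> \<beta> (x b) z + 0 * cut_off U \<phi> \<beta> (x b) z) = 0"
        by (cases "z \<in> U")
           (simp_all add: cut_off_def x_def mult.left_commute[of _ "\<beta> _"] flip: sum_distrib_left)
    qed
    finally show ?thesis using tangent_zero_fun[OF v] by simp
  qed
  moreover obtain y z where yz: "y \<in> span (model M)" "\<And>s. s \<in> span (model M) \<Longrightarrow> orthogonal z s" "w = y + z"
    using orthogonal_subspace_decomp_exists by blast
  ultimately have "w \<bullet> z = 0" by (metis orthogonal_def span_base)
  moreover have "y \<bullet> z = 0" using yz(1,2) by (simp add: orthogonal_def inner_commute)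
  ultimately have "z = 0" using yz(3) by (simp add: inner_add_left)
  then have w: "w \<in> model M" using yz span_eq_iff[THEN iffD2, OF sub] by auto
  have "v f = chart_vec M U \<phi> p w f" if f: "f \<in> Cinf M" for f
  proof -
    obtain W g D where W: "open W" "\<phi> p \<in> W" and g: "smooth_open W g" "\<And>x. x \<in> U \<Longrightarrow> \<phi> x \<in> W \<Longrightarrow> g (\<phi> x) = f x"
      and D: "(g has_derivative D) (at (\<phi> p))" "\<And>w. w \<in> model M \<Longrightarrow> chart_vec M U \<phi> p w f = D w"
      using chart_vec_repr[OF M c p f] by metis
    obtain s where s: "s > 0" "ball a s \<subseteq> W" using W open_contains_ball unfolding a_def by blast
    have "smooth_open (ball a s) g" using Ck_on_subset g(1) s(2) by blast
    then obtain G where G: "\<And>b. smooth_open (ball a s) (G b)"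
      "\<And>y. y \<in> ball a s \<Longrightarrow> g y = g a + (\<Sum>b\<in>Basis. ((y - a) \<bullet> b) * G b y)"
      "\<And>b. G b a = frechet_derivative g (at a) b"
      using Hadamard[OF _ s(1)] by blast
    have Ga: "G b a = D b" for b
      using G(3) frechet_derivative_at[OF D(1)] unfolding a_def by simp
    obtain \<gamma> where \<gamma>: "\<gamma> (\<phi> p) = 1" "\<And>y. y \<notin> ball a s \<Longrightarrow> \<gamma> y = 0"
      "\<And>u. smooth_open (ball a s) u \<Longrightarrow> cut_off U \<phi> \<gamma> u \<in> Cinf M"
      using exists_cut_off[OF M A p open_ball, of a s] s(1) unfolding a_def by (metis centre_in_ball)
    let ?e = "cut_off U \<phi> \<gamma>" and ?o = "\<lambda>y::'b. 1::real"
    have C: "?e ?o \<in> Cinf M" "?e (x b) \<in> Cinf M" "?e (G b) \<in> Cinf M" "cut_off U \<phi> \<beta> ?o \<in> Cinf M" for b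
      using \<gamma>(3) \<beta>(3) sm1 smx G(1) by auto
    note ee = Cinf_mult[OF C(1) C(1)]
    have at_p: "?e ?o p = 1" "?e (x b) p = 0" "?e (G b) p = D b" "cut_off U \<phi> \<beta> ?o p = 1" "cut_off U \<phi> \<beta> (x b) p = 0" for b
      using p \<gamma>(1) \<beta>(2) Ga by (auto simp: cut_off_def x_def a_def)
    \<comment> \<open>The value on a coordinate function does not depend on the bump function: multiply by both.\<close>
    have vx: "v (?e (x b)) = v (cut_off U \<phi> \<beta> (x b))" for b
    proof -
      have "(\<lambda>z. ?e (x b) z * cut_off U \<phi> \<beta> ?o z) = (\<lambda>z. cut_off U \<phi> \<beta> (x b) z * ?e ?o z)"
        by (auto simp: cut_off_def)
      then show ?thesis
        using tangentD(2)[OF v C(2)[of b] C(4)] tangentD(2)[OF v X[of b] C(1)] at_p by simp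
    qed
    \<comment> \<open>Of the two cut offs, one is absorbed by the coordinates and one by the Hadamard coefficients.\<close>
    have eq: "(\<lambda>z. f z * (?e ?o z * ?e ?o z)) = (\<lambda>z. f p * (?e ?o z * ?e ?o z) + 1 * (\<Sum>b\<in>Basis. ?e (x b) z * ?e (G b) z))"
    proof
      fix z
      show "f z * (?e ?o z * ?e ?o z) = f p * (?e ?o z * ?e ?o z) + 1 * (\<Sum>b\<in>Basis. ?e (x b) z * ?e (G b) z)"
      proof (cases "z \<in> U \<and> \<phi> z \<in> ball a s")
        case True
        then have "f z = f p + (\<Sum>b\<in>Basis. x b (\<phi> z) * G b (\<phi> z))"
          using g(2)[of z] g(2)[OF p] s(2) W(2) G(2)[of "\<phi> z"] unfolding x_def a_def by auto
        then show ?thesis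
          using True by (simp add: cut_off_def sum_distrib_left algebra_simps)
      next
        case False
        then show ?thesis using \<gamma>(2)[of "\<phi> z"] by (auto simp: cut_off_def)
      qed
    qed
    have "v (\<lambda>z. f z * (?e ?o z * ?e ?o z))
        = f p * v (\<lambda>z. ?e ?o z * ?e ?o z) + 1 * v (\<lambda>z. \<Sum>b\<in>Basis. ?e (x b) z * ?e (G b) z)"
      unfolding eq by (rule tangentD(1)[OF v ee Cinf_sum[OF Cinf_mult[OF C(2) C(3)]]])
    moreover have "v (\<lambda>z. \<Sum>b\<in>Basis. ?e (x b) z * ?e (G b) z) = (\<Sum>b\<in>Basis. D b * v (cut_off U \<phi> \<beta> (x b)))"
      using tangent_sum[OF v Cinf_mult[OF C(2) C(3)], where I = Basis] tangentD(2)[OF v C(2) C(3)] at_p vx by simp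
    moreover have "v (\<lambda>z. f z * (?e ?o z * ?e ?o z)) = f p * v (\<lambda>z. ?e ?o z * ?e ?o z) + v f"
      using tangentD(2)[OF v f ee] at_p by simp
    ultimately have "v f = (\<Sum>b\<in>Basis. D b * v (cut_off U \<phi> \<beta> (x b)))" by simp
    also have "\<dots> = D w"
      unfolding w_def using linear_sum[OF has_derivative_linear[OF D(1)], of "\<lambda>b. v (cut_off U \<phi> \<beta> (x b)) *\<^sub>R b" Basis]
        linear_scale[OF has_derivative_linear[OF D(1)]] by (simp add: mult.commute)
    finally show ?thesis using D(2)[OF w] by simp
  qed
  then have "v = chart_vec M U \<phi> p w"
    using tangentD(3)[OF v] chart_vec_off by (metis ext)
  then show ?thesis using that w by blast
qed

text \<open>In coordinates a covector is a linear form \<open>l\<close> on the model space; the cut off function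
  \<open>l (\<phi> - \<phi> p)\<close> then has it as its differential.\<close>

theorem covector_is_differential:
  assumes M: "smooth_manifold M" and p: "p \<in> carr M" and \<alpha>: "\<alpha> \<in> cotangent M p"
  obtains f where "f \<in> Cinf M" "differential M p f = \<alpha>"
proof -
  obtain U \<phi> where A: "(U, \<phi>) \<in> atlas M" and pU: "p \<in> U" using atlas_cover[OF M p] .
  note c = atlas_smooth_chart[OF M A] and tc = atlas_top_chart[OF M A]
  have sub: "subspace (model M)" using M unfolding smooth_manifold_def by blast
  let ?L = "\<lambda>w. \<alpha> (chart_vec M U \<phi> p w)"
  have L: "?L (r *\<^sub>R w + s *\<^sub>R w') = r * ?L w + s * ?L w'" if w: "w \<in> model M" "w' \<in> model M" for r s w w'
  proof -
    have rs: "r *\<^sub>R w + s *\<^sub>R w' \<in> model M" using sub w by (simp add: subspace_add subspace_mul)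
    have "chart_vec M U \<phi> p (r *\<^sub>R w + s *\<^sub>R w') = (\<lambda>f. r * chart_vec M U \<phi> p w f + s * chart_vec M U \<phi> p w' f)"
    proof
      fix f
      show "chart_vec M U \<phi> p (r *\<^sub>R w + s *\<^sub>R w') f = r * chart_vec M U \<phi> p w f + s * chart_vec M U \<phi> p w' f"
      proof (cases "f \<in> Cinf M")
        case True
        obtain g D where D: "(g has_derivative D) (at (\<phi> p))" "\<And>w. w \<in> model M \<Longrightarrow> chart_vec M U \<phi> p w f = D w"
          using chart_vec_repr[OF M c pU True] by metis
        then show ?thesis
          using rs w linear_add[OF has_derivative_linear[OF D(1)]] linear_scale[OF has_derivative_linear[OF D(1)]]
          by simp
      qed (simp add: chart_vec_off)
    qed
    then show ?thesis
      using \<alpha> chart_vec_tangent[OF M c pU] w unfolding cotangent_def by simp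
  qed
  obtain B where B: "B \<subseteq> model M" "independent B" "model M \<subseteq> span B"
    by (rule basis_exists[of "model M"]) (rule that)
  obtain l where l: "linear l" "\<And>b. b \<in> B \<Longrightarrow> l b = ?L b"
    using linear_independent_extend[OF B(2), of ?L] by blast
  have lL: "l w = ?L w" if "w \<in> model M" for w
  proof -
    have L0: "?L 0 = 0" using L[of 0 0 0 0] subspace_0[OF sub] by simp
    have "subspace {w \<in> model M. l w = ?L w}"
      using L[of _ _ 1 1] L[of _ 0 _ 0] L0 subspace_0[OF sub] linear_0[OF l(1)]
        linear_add[OF l(1)] linear_scale[OF l(1)] sub
      unfolding subspace_def by auto
    then have "span B \<subseteq> {w \<in> model M. l w = ?L w}"
      using B l(2) by (intro span_minimal) auto
    then show ?thesis using that B(3) by blast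
  qed
  obtain \<beta> where \<beta>: "smooth_open UNIV \<beta>" "\<beta> (\<phi> p) = 1" "\<And>u. smooth_open UNIV u \<Longrightarrow> cut_off U \<phi> \<beta> u \<in> Cinf M"
    by (rule exists_cut_off[OF M A pU open_UNIV]) auto
  let ?u = "\<lambda>y. l y + - l (\<phi> p)"
  have f: "cut_off U \<phi> \<beta> ?u \<in> Cinf M"
    using l(1) by (intro \<beta>(3) allI Ck_on_add Ck_on_linear Ck_on_const) auto
  have du: "(?u has_derivative l) (at (\<phi> p))"
    using has_derivative_add[OF linear_imp_has_derivative[OF l(1)] has_derivative_const, of "- l (\<phi> p)"] by simp
  have "differential M p (cut_off U \<phi> \<beta> ?u) v = \<alpha> v" for v
  proof (cases "v \<in> tangent M p")
    case True
    then obtain w where w: "w \<in> model M" "v = chart_vec M U \<phi> p w"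
      using tangent_imp_chart_vec[OF M A pU] by blast
    then show ?thesis
      using chart_vec_cut_off[OF M tc pU w(1) f \<beta>(1,2) du] lL[OF w(1)] True
      by (simp add: differential_def)
  next
    case False
    then show ?thesis using \<alpha> by (simp add: differential_def cotangent_def)
  qed
  then show ?thesis using that f by blast
qed


section \<open>Submersions have local sections\<close>

lemma exists_linear_projection:
  fixes S :: "'e::euclidean_space set"
  assumes "subspace S"
  obtains P where "linear P" "\<And>y. P y \<in> S" "\<And>y. y \<in> S \<Longrightarrow> P y = y"
proof -
  obtain B where B: "B \<subseteq> S" "pairwise orthogonal B" "\<And>x. x \<in> B \<Longrightarrow> norm x = 1" "independent B" "span B = S"
    using orthonormal_basis_subspace[OF assms] by metis
  have fin: "finite B" using B(4) independent_imp_finite by blast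
  define P where "P = (\<lambda>y. \<Sum>b\<in>B. (y \<bullet> b) *\<^sub>R b)"
  have lin: "linear P"
    by (rule linearI) (simp_all add: P_def inner_add_left scaleR_add_left sum.distrib scaleR_sum_right)
  moreover have "P y \<in> S" for y
    unfolding P_def using B(1) assms by (intro subspace_sum subspace_scale) auto
  moreover have "P y = y" if "y \<in> S" for y
  proof -
    have "P c = c" if c: "c \<in> B" for c
    proof -
      have "(\<Sum>b\<in>B. (c \<bullet> b) *\<^sub>R b) = (\<Sum>b\<in>B. if b = c then c else 0)"
        using B(2,3) c by (intro sum.cong refl)
          (auto simp: pairwise_def orthogonal_def dot_square_norm)
      then show ?thesis using fin c by (simp add: P_def)
    qed
    moreover have "subspace {y. P y = y}"
      using lin by (auto simp: subspace_def linear_0 linear_add linear_scale)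
    ultimately have "span B \<subseteq> {y. P y = y}" by (intro span_minimal) auto
    then show ?thesis using B(5) that by blast
  qed
  ultimately show ?thesis using that by blast
qed

lemma linear_right_inverse_on:
  fixes D :: "'e::euclidean_space \<Rightarrow> 'f::euclidean_space"
  assumes D: "linear D" and S: "subspace S" and T: "subspace T"
    and surj: "\<And>u. u \<in> T \<Longrightarrow> \<exists>w\<in>S. D w = u"
  obtains R where "linear R" "\<And>u. u \<in> T \<Longrightarrow> R u \<in> S \<and> D (R u) = u"
proof -
  obtain B where B: "B \<subseteq> T" "independent B" "T \<subseteq> span B"
    by (rule basis_exists[of T]) (rule that)
  obtain r where r: "\<And>u. u \<in> T \<Longrightarrow> r u \<in> S \<and> D (r u) = u"
    using surj by metis
  obtain R where R: "linear R" "\<And>b. b \<in> B \<Longrightarrow> R b = r b"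
    using linear_independent_extend[OF B(2), of r] by blast
  have "subspace {u. R u \<in> S \<and> D (R u) = u}"
    using S D R(1) by (auto simp: subspace_def linear_0 linear_add linear_scale)
  then have "span B \<subseteq> {u. R u \<in> S \<and> D (R u) = u}"
    using B(1) r R(2) by (intro span_minimal) auto
  then show ?thesis using that[of R] R(1) B(3) by blast
qed

text \<open>Surjectivity of the push-forward on derivations says that the derivative of the coordinate
  expression maps onto the model space. Testing with cut off linear functions identifies the two.\<close>

lemma submersion_coordinates:
  assumes N: "smooth_manifold N" and Q: "smooth_manifold Q" and h: "submersion N Q h"
    and A: "(U, \<phi>) \<in> atlas N" and p: "p \<in> U" and B: "(V, \<psi>) \<in> atlas Q" and hp: "h p \<in> V"
  shows "\<exists>W H. open W \<and> \<phi> p \<in> W \<and> smooth_open W H \<and>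
    (\<forall>y\<in>model N \<inter> W. y \<in> \<phi> ` U \<and> h (inv_into U \<phi> y) \<in> V \<and> H y = \<psi> (h (inv_into U \<phi> y))) \<and>
    (\<forall>u\<in>model Q. \<exists>w\<in>model N. frechet_derivative H (at (\<phi> p)) w = u)"
proof -
  note tc = atlas_top_chart[OF N A] and sc = atlas_smooth_chart[OF N A]
  note tc' = atlas_top_chart[OF Q B] and sc' = atlas_smooth_chart[OF Q B]
  have inj: "inj_on \<phi> U" and Uc: "U \<subseteq> carr N" and Um: "\<phi> ` U \<subseteq> model N"
    using top_chartD[OF tc] by blast+
  have sm: "smooth_map N Q h" using h unfolding submersion_def by blast
  then have cont: "continuous_map (mtop N) (mtop Q) h" unfolding smooth_map_def by blast
  define T where "T = {x \<in> carr N. h x \<in> V}"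
  have "openin (mtop N) T"
    unfolding T_def by (rule openin_continuous_map_preimage[OF cont top_chartD(1)[OF tc']])
  then obtain W1 where W1: "open W1" "\<phi> ` (U \<inter> T) = model N \<inter> W1"
    using chart_image_open[OF tc] by metis
  have UT: "U \<inter> T = U \<inter> h -` V" using Uc unfolding T_def by auto
  have pT: "\<phi> p \<in> \<phi> ` (U \<inter> T)" using p hp UT by auto
  have "smooth_on (\<phi> ` (U \<inter> T)) (\<psi> \<circ> h \<circ> inv_into U \<phi>)"
    using sm A B unfolding smooth_map_def UT by blast
  then obtain W2 H where W2: "open W2" "\<phi> p \<in> W2" and H: "smooth_open W2 H"
    "\<And>y. y \<in> \<phi> ` (U \<inter> T) \<Longrightarrow> y \<in> W2 \<Longrightarrow> H y = (\<psi> \<circ> h \<circ> inv_into U \<phi>) y"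
    using smooth_onE[OF _ pT] by blast
  let ?W = "W1 \<inter> W2"
  have W: "open ?W" "\<phi> p \<in> ?W" using W1 W2 pT by auto
  have Heq: "y \<in> \<phi> ` U \<and> h (inv_into U \<phi> y) \<in> V \<and> H y = \<psi> (h (inv_into U \<phi> y))"
    if "y \<in> model N" "y \<in> ?W" for y
  proof -
    have "y \<in> \<phi> ` (U \<inter> T)" using that W1 by blast
    then obtain x where "x \<in> U" "x \<in> T" "y = \<phi> x" by blast
    then show ?thesis using H(2)[of y] that inj by (auto simp: T_def)
  qed
  define D where "D = frechet_derivative H (at (\<phi> p))"
  have D: "(H has_derivative D) (at (\<phi> p))"
    unfolding D_def by (rule smooth_open_deriv(1)[OF H(1) W2(2)])
  have Hp: "H (\<phi> p) = \<psi> (h p)"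
    using Heq[of "\<phi> p"] W Um p inj by auto
  have "\<exists>w\<in>model N. D w = u" if u: "u \<in> model Q" for u
  proof -
    have "chart_vec Q V \<psi> (h p) u \<in> push N Q h ` tangent N p"
      using chart_vec_tangent[OF Q sc' hp u] h p Uc unfolding submersion_def by blast
    then obtain v where v: "v \<in> tangent N p" "chart_vec Q V \<psi> (h p) u = push N Q h v" by blast
    then obtain w where w: "w \<in> model N" "v = chart_vec N U \<phi> p w"
      using tangent_imp_chart_vec[OF N A p] by blast
    obtain \<beta> where \<beta>: "smooth_open UNIV \<beta>" "\<beta> (\<psi> (h p)) = 1"
      "\<And>u. smooth_open UNIV u \<Longrightarrow> cut_off V \<psi> \<beta> u \<in> Cinf Q"
      by (rule exists_cut_off[OF Q B hp open_UNIV]) auto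
    define l where "l = (\<lambda>y. y \<bullet> (u - D w))"
    have l: "bounded_linear l" unfolding l_def by (rule bounded_linear_inner_left)
    let ?u = "\<lambda>y. l y + - l (\<psi> (h p))"
    let ?f = "cut_off V \<psi> \<beta> ?u"
    have f: "?f \<in> Cinf Q"
      using bounded_linear.linear[OF l] by (intro \<beta>(3) allI Ck_on_add Ck_on_linear Ck_on_const) auto
    have du: "(?u has_derivative l) (at y)" for y
      using has_derivative_add[OF bounded_linear_imp_has_derivative[OF l] has_derivative_const, of "- l (\<psi> (h p))"]
      by simp
    have "chart_vec Q V \<psi> (h p) u ?f = l u"
      by (rule chart_vec_cut_off[OF Q tc' hp u f \<beta>(1,2) du]) simp
    moreover have "chart_vec N U \<phi> p w (pull N h ?f) = l (D w)"
    proof -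
      have d\<beta>: "(\<beta> has_derivative frechet_derivative \<beta> (at (H (\<phi> p)))) (at (H (\<phi> p)))"
        by (rule smooth_open_deriv(1)[OF \<beta>(1)]) simp
      have "((\<lambda>y. \<beta> (H y) * ?u (H y)) has_derivative
          (\<lambda>v. \<beta> (H (\<phi> p)) * l (D v) + frechet_derivative \<beta> (at (H (\<phi> p))) (D v) * ?u (H (\<phi> p)))) (at (\<phi> p))"
        by (rule has_derivative_mult[OF has_derivative_compose[OF D d\<beta>] has_derivative_compose[OF D du]])
      then have "chart_vec N U \<phi> p w (pull N h ?f)
          = \<beta> (H (\<phi> p)) * l (D w) + frechet_derivative \<beta> (at (H (\<phi> p))) (D w) * ?u (H (\<phi> p))"
      proof (rule chart_vec_eq(2)[OF N tc p w(1) Cinf_pull[OF N Q sm f] W])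
        fix x assume x: "x \<in> U" "\<phi> x \<in> ?W"
        have "h x \<in> V" "H (\<phi> x) = \<psi> (h x)"
          using Heq[of "\<phi> x"] x Um inj by auto
        then show "\<beta> (H (\<phi> x)) * ?u (H (\<phi> x)) = pull N h ?f x"
          using x Uc by (auto simp: pull_def cut_off_def)
      qed
      then show ?thesis using Hp \<beta>(2) by simp
    qed
    moreover have "chart_vec Q V \<psi> (h p) u ?f = chart_vec N U \<phi> p w (pull N h ?f)"
      using v(2) w(2) f by (simp add: push_def)
    ultimately have "l u = l (D w)" by simp
    then have "(u - D w) \<bullet> (u - D w) = 0" unfolding l_def by (simp add: inner_diff_left)
    then show ?thesis using w(1) by auto
  qed
  moreover have "smooth_open ?W H" using Ck_on_subset[OF _ Int_lower2] H(1) by blast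
  ultimately show ?thesis
    using W Heq unfolding D_def by (intro exI[of _ ?W] exI[of _ H]) auto
qed

text \<open>With a linear right inverse \<open>R\<close> of the derivative, \<open>y \<mapsto> H (\<phi> p + R y)\<close> is a local
  diffeomorphism of the model space of the target. It is extended by the identity on a
  complement in order to apply the inverse function theorem on the whole Euclidean space.\<close>

lemma submersion_local_section:
  assumes N: "smooth_manifold N" and Q: "smooth_manifold Q" and h: "submersion N Q h"
    and A: "(U, \<phi>) \<in> atlas N" and p: "p \<in> U" and B: "(V, \<psi>) \<in> atlas Q" and hp: "h p \<in> V"
  obtains W s where "open W" "\<psi> (h p) \<in> W" "smooth_open W s"
    "\<And>y. y \<in> model Q \<Longrightarrow> y \<in> W \<Longrightarrow> s y \<in> \<phi> ` U \<and> h (inv_into U \<phi> (s y)) \<in> V \<and> \<psi> (h (inv_into U \<phi> (s y))) = y"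
proof -
  obtain W H where WH: "open W \<and> \<phi> p \<in> W \<and> smooth_open W H \<and>
    (\<forall>y\<in>model N \<inter> W. y \<in> \<phi> ` U \<and> h (inv_into U \<phi> y) \<in> V \<and> H y = \<psi> (h (inv_into U \<phi> y))) \<and>
    (\<forall>u\<in>model Q. \<exists>w\<in>model N. frechet_derivative H (at (\<phi> p)) w = u)"
    using submersion_coordinates[OF assms] by blast
  have W: "open W" "\<phi> p \<in> W" and H: "smooth_open W H"
    using WH by simp_all
  have H2: "y \<in> \<phi> ` U" "h (inv_into U \<phi> y) \<in> V" "H y = \<psi> (h (inv_into U \<phi> y))" if "y \<in> model N" "y \<in> W" for y
    using WH that by blast+
  have H3: "\<exists>w\<in>model N. frechet_derivative H (at (\<phi> p)) w = u" if "u \<in> model Q" for u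
    using WH that by blast
  have subN: "subspace (model N)" and subQ: "subspace (model Q)"
    using N Q unfolding smooth_manifold_def by blast+
  have Um: "\<phi> ` U \<subseteq> model N" and inj: "inj_on \<phi> U" using top_chartD[OF atlas_top_chart[OF N A]] by blast+
  have Vm: "\<psi> ` V \<subseteq> model Q" using top_chartD[OF atlas_top_chart[OF Q B]] by blast
  define D where "D = frechet_derivative H (at (\<phi> p))"
  have D: "(H has_derivative D) (at (\<phi> p))"
    unfolding D_def by (rule smooth_open_deriv(1)[OF H W(2)])
  obtain R where R: "linear R" "\<And>u. u \<in> model Q \<Longrightarrow> R u \<in> model N \<and> D (R u) = u"
    using linear_right_inverse_on[OF has_derivative_linear[OF D] subN subQ] H3 unfolding D_def by metis
  obtain P where P: "linear P" "\<And>y. P y \<in> model Q" "\<And>y. y \<in> model Q \<Longrightarrow> P y = y"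
    by (rule exists_linear_projection[OF subQ]) (rule that)
  let ?j = "\<lambda>y. \<phi> p + R (P y)"
  define k where "k = (\<lambda>y. H (?j y) + (y + (-1::real) *\<^sub>R P y))"
  have RP: "linear (\<lambda>y. R (P y))" using linear_compose[OF P(1) R(1)] by (simp add: o_def)
  have smj: "smooth_open S ?j" if "open S" for S
    using that by (intro allI Ck_on_add Ck_on_const Ck_on_linear RP)
  define W' where "W' = ?j -` W"
  have "continuous_on UNIV ?j" using smooth_open_imp_continuous[OF smj[OF open_UNIV]] .
  then have W': "open W'" unfolding W'_def using W(1) open_vimage by blast
  have jW: "?j ` W' \<subseteq> W" unfolding W'_def by auto
  have "Ck_on m W' (\<lambda>y. H (?j y))" for m
    using Ck_on_compose[OF W' W(1) jW, of m H] smj[OF W'] H by blast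
  moreover have "Ck_on m W' (\<lambda>y. y + (-1::real) *\<^sub>R P y)" for m
    by (rule Ck_on_add[OF W' Ck_on_id[OF W'] Ck_on_scaleR[OF W' Ck_on_const[OF W'] Ck_on_linear[OF P(1) W']]])
  ultimately have k: "smooth_open W' k"
    unfolding k_def using Ck_on_add[OF W'] by blast
  have P0: "P 0 = 0" "R 0 = 0" using P(1) R(1) linear_0 by auto
  have 0: "0 \<in> W'" unfolding W'_def using W(2) P0 by simp
  have "(?j has_derivative (\<lambda>y. R (P y))) (at 0)"
    using has_derivative_add[OF has_derivative_const linear_imp_has_derivative[OF RP], of "\<phi> p"] by simp
  then have "((\<lambda>y. H (?j y)) has_derivative (\<lambda>y. D (R (P y)))) (at 0)"
    by (rule has_derivative_compose) (use D P0 in simp)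
  then have "(k has_derivative (\<lambda>y. D (R (P y)) + (y + (-1::real) *\<^sub>R P y))) (at 0)"
    unfolding k_def using linear_imp_has_derivative[OF P(1)]
    by (intro has_derivative_add has_derivative_ident has_derivative_scaleR_right) auto
  then have "frechet_derivative k (at 0) v = v" for v
    using frechet_derivative_at R(2) P(2) by fastforce
  then have k0: "v = 0" if "frechet_derivative k (at 0) v = 0" for v
    using that by simp
  then obtain V' g where V': "open V'" "k 0 \<in> V'" and g: "smooth_open V' g"
    "\<And>y. y \<in> V' \<Longrightarrow> g y \<in> W' \<and> k (g y) = y"
    using smooth_local_inverse[OF W' k 0 k0] by metis
  have "\<phi> p \<in> model N" using Um p by auto
  then have "k 0 = \<psi> (h p)"
    using H2(3)[OF _ W(2)] P0 p inj unfolding k_def by simp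
  moreover have "smooth_open V' (\<lambda>y. ?j (g y))"
    using Ck_on_compose[OF V'(1) open_UNIV _ _ smj[OF open_UNIV, rule_format]] g(1) by blast
  moreover have "?j (g y) \<in> \<phi> ` U \<and> h (inv_into U \<phi> (?j (g y))) \<in> V \<and> \<psi> (h (inv_into U \<phi> (?j (g y)))) = y"
    if y: "y \<in> model Q" "y \<in> V'" for y
  proof -
    have m: "?j (g y) \<in> model N"
      using \<open>\<phi> p \<in> model N\<close> R(2)[OF P(2)] subspace_add[OF subN] by blast
    have "?j (g y) \<in> W" using g(2)[OF y(2)] unfolding W'_def by simp
    note Hj = H2[OF m this]
    then have "H (?j (g y)) \<in> model Q" using Vm by auto
    moreover have ky: "H (?j (g y)) + (g y + (-1::real) *\<^sub>R P (g y)) = y"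
      using g(2)[OF y(2)] unfolding k_def by simp
    then have "g y = (y - H (?j (g y))) + P (g y)" by (simp add: algebra_simps)
    ultimately have "g y \<in> model Q"
      using y(1) P(2) subQ by (metis subspace_add subspace_diff)
    then have "H (?j (g y)) = y" using ky P(3) by simp
    then show ?thesis using Hj by simp
  qed
  ultimately show ?thesis using that[OF V'(1), of "\<lambda>y. ?j (g y)"] V'(2) by simp
qed

text \<open>Near any point the descended function is the composition of \<open>f\<close> with a local section.\<close>

lemma submersion_descend:
  assumes N: "smooth_manifold N" and Q: "smooth_manifold Q" and h: "submersion N Q h"
    and surj: "h ` carr N = carr Q" and f: "f \<in> Cinf N"
    and const: "\<And>x y. x \<in> carr N \<Longrightarrow> y \<in> carr N \<Longrightarrow> h x = h y \<Longrightarrow> f x = f y"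
  obtains g where "g \<in> Cinf Q" "pull N h g = f"
proof -
  define g where "g = (\<lambda>z. if z \<in> carr Q then f (inv_into (carr N) h z) else 0)"
  have gh: "g (h x) = f x" if "x \<in> carr N" for x
  proof -
    have "h x \<in> h ` carr N" using that by blast
    then have "inv_into (carr N) h (h x) \<in> carr N" "h (inv_into (carr N) h (h x)) = h x"
      using inv_into_into[of "h x" h "carr N"] f_inv_into_f[of "h x" h "carr N"] by simp_all
    then show ?thesis
      using const[of "inv_into (carr N) h (h x)" x] that surj unfolding g_def by auto
  qed
  have "g \<in> Cinf Q"
  proof (rule CinfI[OF Q])
    fix V \<psi> assume B: "(V, \<psi>) \<in> atlas Q"
    note tc' = atlas_top_chart[OF Q B]
    have Vc: "V \<subseteq> carr Q" and Vm: "\<psi> ` V \<subseteq> model Q" and inj': "inj_on \<psi> V" using top_chartD[OF tc'] by blast+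
    show "smooth_on (\<psi> ` V) (g \<circ> inv_into V \<psi>)"
    proof (rule smooth_on_chart_local[OF tc'])
      fix z assume z: "z \<in> V"
      then obtain p where p: "p \<in> carr N" "z = h p" using surj Vc by blast
      then obtain U \<phi> where A: "(U, \<phi>) \<in> atlas N" "p \<in> U" using atlas_cover[OF N] by blast
      note tc = atlas_top_chart[OF N A(1)]
      have Uc: "U \<subseteq> carr N" and inj: "inj_on \<phi> U" using top_chartD[OF tc] by blast+
      obtain W s where W: "open W" "\<psi> (h p) \<in> W" and s: "smooth_open W s"
        "\<And>y. y \<in> model Q \<Longrightarrow> y \<in> W \<Longrightarrow> s y \<in> \<phi> ` U \<and> h (inv_into U \<phi> (s y)) \<in> V \<and> \<psi> (h (inv_into U \<phi> (s y))) = y"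
        by (rule submersion_local_section[OF N Q h A B]) (use z p in blast)+
      let ?T = "{x \<in> V. \<psi> x \<in> W}"
      have "smooth_on (\<psi> ` (V \<inter> ?T)) s"
        by (rule smooth_open_imp_on[OF s(1) W(1)]) auto
      moreover have "s ` \<psi> ` (V \<inter> ?T) \<subseteq> \<phi> ` U" using s(2) Vm by auto
      ultimately have "smooth_on (\<psi> ` (V \<inter> ?T)) ((f \<circ> inv_into U \<phi>) \<circ> s)"
        using smooth_on_compose Cinf_smooth_atlas[OF N f A(1)] by blast
      then have "smooth_on (\<psi> ` (V \<inter> ?T)) (g \<circ> inv_into V \<psi>)"
      proof (rule smooth_on_cong)
        fix y assume "y \<in> \<psi> ` (V \<inter> ?T)"
        then obtain x where x: "x \<in> V" "y = \<psi> x" "y \<in> W" by auto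
        let ?x = "inv_into U \<phi> (s y)"
        have sy: "s y \<in> \<phi> ` U" "h ?x \<in> V" "\<psi> (h ?x) = \<psi> x" using s(2)[of y] x Vm by auto
        then have "h ?x = x" using inj' x inj_onD by metis
        moreover have "?x \<in> carr N" using sy(1) inv_into_into Uc by (metis subsetD)
        ultimately have "g x = f ?x" using gh by metis
        then show "((f \<circ> inv_into U \<phi>) \<circ> s) y = (g \<circ> inv_into V \<psi>) y"
          using x inj' by simp
      qed
      then show "\<exists>T. openin (mtop Q) T \<and> z \<in> T \<and> smooth_on (\<psi> ` (V \<inter> T)) (g \<circ> inv_into V \<psi>)"
        using chart_preimage_open[OF tc' W(1)] z W(2) p by (intro exI[of _ ?T]) auto
    qed
  qed (simp add: g_def)
  moreover have "pull N h g = f"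
    using gh Cinf_off_carrier[OF f] by (auto simp: pull_def)
  ultimately show ?thesis using that by blast
qed


section \<open>Functions on the leaf space\<close>

lemma inv_chart_continuous:
  assumes "top_chart M U \<phi>"
  shows "continuous_map (top_of_set (\<phi> ` U)) (mtop M) (inv_into U \<phi>)"
proof -
  obtain \<psi> where \<psi>: "homeomorphic_maps (subtopology (mtop M) U) (top_of_set (\<phi> ` U)) \<phi> \<psi>"
    using assms homeomorphic_map_maps unfolding top_chart_def by blast
  have "continuous_map (top_of_set (\<phi> ` U)) (mtop M) \<psi>"
    using \<psi> continuous_map_in_subtopology unfolding homeomorphic_maps_def by blast
  then show ?thesis
  proof (rule continuous_map_eq)
    fix y assume "y \<in> topspace (top_of_set (\<phi> ` U))"
    then obtain x where "x \<in> U" "y = \<phi> x" by auto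
    then show "\<psi> y = inv_into U \<phi> y"
      using \<psi> top_chartD(2,3)[OF assms] unfolding homeomorphic_maps_def by auto
  qed
qed

lemma flat_chartD:
  assumes "flat_chart N F U \<phi> W"
  shows "smooth_chart N U \<phi>" "top_chart N U \<phi>" "subspace W" "W \<subseteq> model N"
    "q \<in> U \<Longrightarrow> F q = chart_vec N U \<phi> q ` W"
  using assms smooth_chart_top unfolding flat_chart_def by blast+

lemma same_plaque_sym:
  assumes "same_plaque N F p q"
  shows "same_plaque N F q p"
proof -
  obtain U \<phi> W C where C: "flat_chart N F U \<phi> W" "C \<subseteq> U" "connectedin (mtop N) C" "p \<in> C" "q \<in> C"
    "\<forall>x\<in>C. \<phi> x - \<phi> p \<in> W"
    using assms unfolding same_plaque_def by blast
  have "\<phi> x - \<phi> q \<in> W" if "x \<in> C" for x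
    using subspace_diff[OF flat_chartD(3)[OF C(1)], of "\<phi> x - \<phi> p" "\<phi> q - \<phi> p"] C that by simp
  then show ?thesis unfolding same_plaque_def using C by blast
qed

lemma same_plaque_leaf_eq:
  assumes "same_plaque N F p q"
  shows "leaf N F p = leaf N F q"
  using assms same_plaque_sym[OF assms] unfolding leaf_def
  by (auto intro: converse_rtranclp_into_rtranclp)

text \<open>In a flat chart such a function has vanishing derivative along the slices, hence is locally
  constant on them.\<close>

lemma constant_on_plaque:
  assumes N: "smooth_manifold N" and f: "f \<in> Cinf_along N (carr N) F" and pq: "same_plaque N F p q"
  shows "f q = f p"
proof -
  obtain U \<phi> W C where fc: "flat_chart N F U \<phi> W" and C: "C \<subseteq> U" "connectedin (mtop N) C" "p \<in> C" "q \<in> C"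
    "\<And>x. x \<in> C \<Longrightarrow> \<phi> x - \<phi> p \<in> W"
    using pq unfolding same_plaque_def by blast
  note fcD = flat_chartD[OF fc]
  have inj: "inj_on \<phi> U" and Uc: "U \<subseteq> carr N" and Um: "\<phi> ` U \<subseteq> model N" using top_chartD[OF fcD(2)] by blast+
  have sub: "subspace (model N)" using N unfolding smooth_manifold_def by blast
  have fC: "f \<in> Cinf N" using f unfolding Cinf_along_def by blast
  have zero: "((\<lambda>t. f (inv_into U \<phi> (\<phi> x + t *\<^sub>R w))) has_real_derivative 0) (at 0)"
    if x: "x \<in> U" and w: "w \<in> W" for x w
  proof -
    have wm: "w \<in> model N" using w fcD(4) by blast
    have "chart_vec N U \<phi> x w \<in> F x" using fcD(5)[OF x] w by blast
    then have "differential N x f (chart_vec N U \<phi> x w) = 0"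
      using f x Uc unfolding Cinf_along_def by blast
    then have "chart_vec N U \<phi> x w f = 0"
      using chart_vec_tangent[OF N fcD(1) x wm] unfolding differential_def by simp
    moreover obtain W' g D where "open W'" "\<phi> x \<in> W'" "\<And>z. z \<in> U \<Longrightarrow> \<phi> z \<in> W' \<Longrightarrow> g (\<phi> z) = f z"
      "(g has_derivative D) (at (\<phi> x))"
      using chart_vec_repr[OF N fcD(1) x fC] by metis
    ultimately show ?thesis
      using chart_vec_eq[OF N fcD(2) x wm fC, of W' g D] by simp
  qed
  have loc: "\<exists>T. openin (mtop N) T \<and> x \<in> T \<and> (\<forall>y\<in>T \<inter> C. f y = f x)" if x: "x \<in> C" for x
  proof -
    have xU: "x \<in> U" using x C by blast
    obtain W1 where W1: "open W1" "\<phi> ` U = model N \<inter> W1"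
      using top_chartD(5)[OF fcD(2)] unfolding openin_open by blast
    then obtain r where r: "r > 0" "ball (\<phi> x) r \<subseteq> W1" using xU open_contains_ball by blast
    let ?T = "{y \<in> U. \<phi> y \<in> ball (\<phi> x) r}"
    have "f y = f x" if y: "y \<in> ?T" "y \<in> C" for y
    proof -
      define w where "w = \<phi> y - \<phi> x"
      have w: "w \<in> W"
        using subspace_diff[OF fcD(3) C(5)[OF y(2)] C(5)[OF x]] unfolding w_def by simp
      have U: "\<phi> x + t *\<^sub>R w \<in> \<phi> ` U" if t: "t \<in> {0..1}" for t
      proof -
        have "\<bar>t\<bar> * norm w \<le> 1 * norm w" using t by (intro mult_right_mono) auto
        then have "\<phi> x + t *\<^sub>R w \<in> ball (\<phi> x) r"
          using y(1) by (simp add: w_def dist_norm norm_minus_commute)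
        moreover have "\<phi> x + t *\<^sub>R w \<in> model N"
          using sub w fcD(4) Um xU by (intro subspace_add subspace_scale) auto
        ultimately show ?thesis using r(2) W1(2) by blast
      qed
      have "((\<lambda>t. f (inv_into U \<phi> (\<phi> x + t *\<^sub>R w))) has_real_derivative 0) (at t within {0..1})"
        if t: "t \<in> {0..1}" for t
      proof -
        obtain z where z: "z \<in> U" "\<phi> x + t *\<^sub>R w = \<phi> z" using U[OF t] by blast
        have "\<phi> z + s *\<^sub>R w = \<phi> x + (t + s) *\<^sub>R w" for s
          unfolding z(2)[symmetric] by (simp add: algebra_simps)
        then have "((\<lambda>s. f (inv_into U \<phi> (\<phi> x + (t + s) *\<^sub>R w))) has_real_derivative 0) (at 0)"
          using zero[OF z(1) w] by simp
        then have "((\<lambda>s. f (inv_into U \<phi> (\<phi> x + s *\<^sub>R w))) has_real_derivative 0) (at t)"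
          using DERIV_at_within_shift[of "\<lambda>s. f (inv_into U \<phi> (\<phi> x + s *\<^sub>R w))" 0 t 0 UNIV] by simp
        then show ?thesis using has_field_derivative_at_within by blast
      qed
      then obtain c where "\<forall>t\<in>{0..1}. f (inv_into U \<phi> (\<phi> x + t *\<^sub>R w)) = c"
        using has_field_derivative_zero_constant[of "{0..1::real}"] by blast
      then have "f (inv_into U \<phi> (\<phi> x + 0 *\<^sub>R w)) = c" "f (inv_into U \<phi> (\<phi> x + 1 *\<^sub>R w)) = c"
        by (metis atLeastAtMost_iff order_refl zero_le_one)+
      then show ?thesis using y xU inj by (simp add: w_def)
    qed
    moreover have "openin (mtop N) ?T" using chart_preimage_open[OF fcD(2)] by blast
    ultimately show ?thesis using xU r(1) by (intro exI[of _ ?T]) auto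
  qed
  let ?X = "subtopology (mtop N) C"
  have op: "openin ?X {y \<in> C. P (f y)}" for P
  proof (subst openin_subopen, clarify)
    fix x assume x: "x \<in> C" "P (f x)"
    then obtain T where T: "openin (mtop N) T" "x \<in> T" "\<forall>y\<in>T \<inter> C. f y = f x" using loc by blast
    have "C \<inter> T \<subseteq> {y \<in> C. P (f y)}"
    proof
      fix y assume y: "y \<in> C \<inter> T"
      then have "f y = f x" using T(3) by blast
      then show "y \<in> {y \<in> C. P (f y)}" using x y by simp
    qed
    then show "\<exists>T. openin ?X T \<and> x \<in> T \<and> T \<subseteq> {y \<in> C. P (f y)}"
      using x T(1,2) by (intro exI[of _ "C \<inter> T"]) (simp add: openin_subtopology_Int2)
  qed
  have top: "topspace ?X = C" using C(2) connectedin_subset_topspace by (metis topspace_subtopology_subset)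
  have "topspace ?X - {y \<in> C. f y = f p} = {y \<in> C. f y \<noteq> f p}" unfolding top by auto
  then have "closedin ?X {y \<in> C. f y = f p}"
    unfolding closedin_def using op[of "\<lambda>c. c \<noteq> f p"] by (simp only: top) auto
  moreover have "connected_space ?X" using C(2) unfolding connectedin_def by blast
  ultimately have "{y \<in> C. f y = f p} = C"
    using op[of "\<lambda>c. c = f p"] top C(3) unfolding connected_space_clopen_in by blast
  then show ?thesis using C(4) by blast
qed

lemma constant_on_leaf:
  assumes "smooth_manifold N" "f \<in> Cinf_along N (carr N) F" "q \<in> leaf N F p"
  shows "f q = f p"
proof -
  have "(same_plaque N F)\<^sup>*\<^sup>* p q" using assms(3) unfolding leaf_def by simp
  then show ?thesis
    by induction (use constant_on_plaque[OF assms(1,2)] in auto)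
qed

text \<open>A vector of the distribution is the velocity of a straight line in a slice of a flat chart,
  and this line stays in one plaque.\<close>

lemma leaf_function_along:
  assumes N: "smooth_manifold N" and F: "integrable_distribution N F" and f: "f \<in> Cinf N"
    and const: "\<And>x y. same_plaque N F x y \<Longrightarrow> f x = f y"
  shows "f \<in> Cinf_along N (carr N) F"
proof -
  have "differential N p f v = 0" if p: "p \<in> carr N" and v: "v \<in> F p" for p v
  proof -
    obtain U \<phi> W where pU: "p \<in> U" and fc: "flat_chart N F U \<phi> W"
      using F p unfolding integrable_distribution_def by blast
    note fcD = flat_chartD[OF fc]
    have inj: "inj_on \<phi> U" using top_chartD[OF fcD(2)] by blast
    obtain w where w: "w \<in> W" "v = chart_vec N U \<phi> p w" using fcD(5)[OF pU] v by blast
    have wm: "w \<in> model N" using w fcD(4) by blast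
    obtain e where e: "e > 0" "\<And>t. \<bar>t\<bar> < e \<Longrightarrow> \<phi> p + t *\<^sub>R w \<in> UNIV \<and> \<phi> p + t *\<^sub>R w \<in> \<phi> ` U"
      using chart_line[OF N fcD(2) pU wm open_UNIV UNIV_I] by blast
    define c where "c = (\<lambda>t. inv_into U \<phi> (\<phi> p + t *\<^sub>R w))"
    have cU: "c t \<in> U" "\<phi> (c t) = \<phi> p + t *\<^sub>R w" if "\<bar>t\<bar> < e" for t
      using e(2)[OF that] unfolding c_def by (auto simp: inv_into_into f_inv_into_f)
    have c0: "c 0 = p" unfolding c_def using pU inj by simp
    let ?I = "{-e<..<e}"
    have "continuous_map (top_of_set ?I) (top_of_set (\<phi> ` U)) (\<lambda>t. \<phi> p + t *\<^sub>R w)"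
      using e(2) by (auto intro!: continuous_intros simp: abs_less_iff image_subset_iff)
    from continuous_map_compose[OF this inv_chart_continuous[OF fcD(2)]]
    have "continuous_map (top_of_set ?I) (mtop N) c" unfolding c_def o_def .
    then have conn: "connectedin (mtop N) (c ` ?I)"
      by (rule connectedin_continuous_map_image) (simp add: connectedin_subtopology connected_Ioo)
    have sp: "same_plaque N F p (c t)" if t: "\<bar>t\<bar> < e" for t
      unfolding same_plaque_def
    proof (intro exI conjI)
      show "flat_chart N F U \<phi> W" "connectedin (mtop N) (c ` ?I)" by (rule fc conn)+
      show "c ` ?I \<subseteq> U" using cU(1) by auto
      show "p \<in> c ` ?I" using c0 e(1) by (metis greaterThanLessThan_iff image_eqI neg_less_0_iff_less)
      show "c t \<in> c ` ?I" using t by (intro imageI) auto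
      show "\<forall>x\<in>c ` ?I. \<phi> x - \<phi> p \<in> W" using cU(2) w(1) subspace_scale[OF fcD(3)] by auto
    qed
    have "((\<lambda>t. f p) has_real_derivative 0) (at 0)" by simp
    then have "((\<lambda>t. f (c t)) has_real_derivative 0) (at 0)"
      by (rule has_field_derivative_transform_within_open[where S = "ball 0 e"])
         (use e(1) const[OF sp] in auto)
    then have "v f = 0"
      unfolding w(2) chart_vec_def c_def using DERIV_imp_deriv by auto
    then show ?thesis by (simp add: differential_def)
  qed
  then show ?thesis using f unfolding Cinf_along_def by blast
qed

text \<open>A function whose differential vanishes on the distribution is constant on plaques, hence on
  the leaves, which are their chains; it descends smoothly because the projection has smooth local
  sections.\<close>

theorem leaf_space_functions:
  assumes N: "smooth_manifold N" and F: "regular_integrable_distribution N F Q"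
  shows "f \<in> Cinf Q \<Longrightarrow> pull N (leaf N F) f \<in> Cinf_along N (carr N) F"
    and "g \<in> Cinf_along N (carr N) F \<Longrightarrow> \<exists>f\<in>Cinf Q. pull N (leaf N F) f = g"
proof -
  have Q: "smooth_manifold Q" "carr Q = leaf N F ` carr N" and sub: "submersion N Q (leaf N F)"
    and int: "integrable_distribution N F"
    using F unfolding regular_integrable_distribution_def by blast+
  show "pull N (leaf N F) f \<in> Cinf_along N (carr N) F" if f: "f \<in> Cinf Q"
  proof (rule leaf_function_along[OF N int])
    show "pull N (leaf N F) f \<in> Cinf N"
      using Cinf_pull[OF N Q(1) _ f] sub unfolding submersion_def by blast
    fix x y assume xy: "same_plaque N F x y"
    then have "x \<in> carr N" "y \<in> carr N"
      unfolding same_plaque_def using connectedin_subset_topspace by blast+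
    then show "pull N (leaf N F) f x = pull N (leaf N F) f y"
      using same_plaque_leaf_eq[OF xy] by (simp add: pull_def)
  qed
  show "\<exists>f\<in>Cinf Q. pull N (leaf N F) f = g" if g: "g \<in> Cinf_along N (carr N) F"
  proof -
    have "g \<in> Cinf N" using g unfolding Cinf_along_def by blast
    moreover have "g x = g y" if "leaf N F x = leaf N F y" for x y
      using constant_on_leaf[OF N g, of x y] that unfolding leaf_def by auto
    ultimately show ?thesis
      using submersion_descend[OF N Q(1) sub Q(2)[symmetric], of g] by metis
  qed
qed


section \<open>Nambu-Poisson brackets\<close>

lemma nambu_closed:
  "nambu_structure M n br \<Longrightarrow> length fs = n \<Longrightarrow> set fs \<subseteq> Cinf M \<Longrightarrow> br fs \<in> Cinf M"
  unfolding nambu_structure_def by blast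

lemma nambu_pos: "nambu_structure M n br \<Longrightarrow> 1 \<le> n"
  unfolding nambu_structure_def by blast

lemma nambu_linear:
  "nambu_structure M n br \<Longrightarrow> length fs = n \<Longrightarrow> set fs \<subseteq> Cinf M \<Longrightarrow> k < n \<Longrightarrow> g \<in> Cinf M \<Longrightarrow> h \<in> Cinf M \<Longrightarrow>
    br (fs[k := \<lambda>x. a * g x + b * h x]) = (\<lambda>x. a * br (fs[k := g]) x + b * br (fs[k := h]) x)"
  unfolding nambu_structure_def by blast

lemma nambu_skew:
  "nambu_structure M n br \<Longrightarrow> length fs = n \<Longrightarrow> set fs \<subseteq> Cinf M \<Longrightarrow> i < j \<Longrightarrow> j < n \<Longrightarrow>
    br (fs[i := fs ! j, j := fs ! i]) = (\<lambda>x. - br fs x)"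
  unfolding nambu_structure_def by blast

lemma nambu_leibniz:
  "nambu_structure M n br \<Longrightarrow> length fs = n - 1 \<Longrightarrow> set fs \<subseteq> Cinf M \<Longrightarrow> g \<in> Cinf M \<Longrightarrow> h \<in> Cinf M \<Longrightarrow>
    br (fs @ [\<lambda>x. g x * h x]) = (\<lambda>x. g x * br (fs @ [h]) x + br (fs @ [g]) x * h x)"
  unfolding nambu_structure_def by blast

lemma nambu_fundamental:
  "nambu_structure M n br \<Longrightarrow> length gs = n - 1 \<Longrightarrow> set gs \<subseteq> Cinf M \<Longrightarrow> length fs = n \<Longrightarrow> set fs \<subseteq> Cinf M \<Longrightarrow>
    br (gs @ [br fs]) = (\<lambda>x. \<Sum>k<n. br (fs[k := br (gs @ [fs ! k])]) x)"
  unfolding nambu_structure_def by blast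

lemma nambu_linear_last:
  assumes "nambu_structure M n br" "length gs = n - 1" "set gs \<subseteq> Cinf M" "g \<in> Cinf M" "h \<in> Cinf M"
  shows "br (gs @ [\<lambda>x. a * g x + b * h x]) = (\<lambda>x. a * br (gs @ [g]) x + b * br (gs @ [h]) x)"
proof -
  have "(gs @ [g])[n - 1 := u] = gs @ [u]" for u
    using assms(2) by (metis list_update_length)
  then show ?thesis
    using nambu_linear[OF assms(1), of "gs @ [g]" "n - 1" g h a b] assms nambu_pos[OF assms(1)] by simp
qed

lemma nambu_last_zero:
  assumes "nambu_structure M n br" "length gs = n - 1" "set gs \<subseteq> Cinf M"
  shows "br (gs @ [\<lambda>x. 0]) = (\<lambda>x. 0)"
  using nambu_linear_last[OF assms Cinf_zero Cinf_zero, of 0 0] by simp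

text \<open>By skew-symmetry, independence of the bracket from the choice of its last argument within
  the classes of a relation carries over to all arguments. This is used for two relations: equality
  of differentials at a point, and equality of restrictions to a submanifold.\<close>

lemma nambu_replace_all:
  assumes br: "nambu_structure M n br" and A: "A \<subseteq> Cinf M"
    and last: "\<And>gs f g. length gs = n - 1 \<Longrightarrow> set gs \<subseteq> A \<Longrightarrow> f \<in> A \<Longrightarrow> g \<in> A \<Longrightarrow> R f g \<Longrightarrow>
      br (gs @ [f]) p = br (gs @ [g]) p"
    and fs: "length fs = n" "set fs \<subseteq> A" and gs: "length gs = n" "set gs \<subseteq> A"
    and R: "\<And>k. k < n \<Longrightarrow> R (fs ! k) (gs ! k)"
  shows "br fs p = br gs p"
proof -
  have step: "br (hs[k := g]) p = br hs p"
    if hs: "length hs = n" "set hs \<subseteq> A" and k: "k < n" and g: "g \<in> A" "R (hs ! k) g" for hs k g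
  proof -
    have hk: "hs ! k \<in> A" using hs k nth_mem by blast
    show ?thesis
    proof (cases "k = n - 1")
      case True
      define us where "us = take (n - 1) hs"
      have us: "length us = n - 1" "set us \<subseteq> A"
        using hs set_take_subset[of "n - 1" hs] unfolding us_def by auto
      have "hs = us @ [hs ! k]" "hs[k := g] = us @ [g]"
        using hs(1) k True id_take_nth_drop[of k hs] upd_conv_take_nth_drop[of k hs g] unfolding us_def by auto
      then show ?thesis using last[OF us hk g] by metis
    next
      case False
      then have k': "k < n - 1" using k by simp
      \<comment> \<open>Exchange the argument in position \<open>k\<close> with the last one.\<close>
      define us where "us = (take (n - 1) hs)[k := hs ! (n - 1)]"
      have "hs ! (n - 1) \<in> A" using hs k nth_mem[of "n - 1" hs] by auto
      then have us: "length us = n - 1" "set us \<subseteq> A"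
        using hs set_take_subset[of "n - 1" hs] set_update_subset_insert[of "take (n - 1) hs" k "hs ! (n - 1)"]
        unfolding us_def by auto
      have swap: "(hs[k := f])[k := (hs[k := f]) ! (n - 1), n - 1 := (hs[k := f]) ! k] = us @ [f]" for f
        using hs(1) k' by (intro nth_equalityI) (auto simp: us_def nth_append nth_list_update)
      have br_eq: "br (us @ [f]) p = - br (hs[k := f]) p" if "f \<in> A" for f
      proof -
        have "set (hs[k := f]) \<subseteq> A" using hs(2) that set_update_subset_insert[of hs k f] by blast
        then show ?thesis
          using nambu_skew[OF br, of "hs[k := f]" k "n - 1"] hs(1) k k' A swap[of f] by fastforce
      qed
      show ?thesis
        using last[OF us hk g] br_eq[OF hk] br_eq[OF g(1)] by simp
    qed
  qed
  have "m \<le> n \<Longrightarrow> br (take m gs @ drop m fs) p = br fs p" for m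
  proof (induction m)
    case (Suc m)
    let ?h = "take m gs @ drop m fs"
    have m: "m < n" using Suc.prems by simp
    have upd: "?h[m := gs ! m] = take (Suc m) gs @ drop (Suc m) fs"
      using m fs(1) gs(1) by (intro nth_equalityI) (auto simp: nth_append nth_list_update)
    have "set ?h \<subseteq> A" using fs(2) gs(2) set_take_subset[of m gs] set_drop_subset[of m fs] by auto
    moreover have "?h ! m = fs ! m" "gs ! m \<in> A" using m fs gs nth_mem[of m gs] by (auto simp: nth_append)
    ultimately have "br (?h[m := gs ! m]) p = br ?h p"
      using step[of ?h m "gs ! m"] m fs(1) gs(1) R[OF m] by simp
    then show ?case using Suc upd by simp
  qed simp
  from this[of n] show ?thesis using fs gs by simp
qed


section \<open>Hamiltonian vectors and the map \<open>\<Pi>\<^sup>\<sharp>\<close>\<close>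

definition hamiltonian_vec ::
    "('a, 'e::euclidean_space) mfd \<Rightarrow> (('a \<Rightarrow> real) list \<Rightarrow> 'a \<Rightarrow> real) \<Rightarrow> ('a \<Rightarrow> real) list \<Rightarrow> 'a \<Rightarrow> 'a tvec" where
  "hamiltonian_vec M br gs p = (\<lambda>f. if f \<in> Cinf M then br (gs @ [f]) p else 0)"

text \<open>The Leibniz rule in the last argument makes the bracket a derivation.\<close>

lemma hamiltonian_tangent:
  assumes br: "nambu_structure M n br" and gs: "length gs = n - 1" "set gs \<subseteq> Cinf M"
  shows "hamiltonian_vec M br gs p \<in> tangent M p"
  unfolding tangent_def hamiltonian_vec_def
  using nambu_linear_last[OF br gs] nambu_leibniz[OF br gs] Cinf_lincomb[of _ M] Cinf_mult[of _ M]
  by (auto simp: mult.commute)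

lemma bracket_depends_on_differentials:
  assumes br: "nambu_structure M n br" and fs: "length fs = n" "set fs \<subseteq> Cinf M"
    and gs: "length gs = n" "set gs \<subseteq> Cinf M"
    and d: "\<And>k. k < n \<Longrightarrow> differential M p (fs ! k) = differential M p (gs ! k)"
  shows "br fs p = br gs p"
proof (rule nambu_replace_all[where R = "\<lambda>f g. differential M p f = differential M p g",
      OF br order_refl _ fs gs d])
  fix hs f g assume h: "length hs = n - 1" "set hs \<subseteq> Cinf M" "f \<in> Cinf M" "g \<in> Cinf M"
    "differential M p f = differential M p g"
  have "differential M p f (hamiltonian_vec M br hs p) = differential M p g (hamiltonian_vec M br hs p)"
    using h(5) by simp
  then show "br (hs @ [f]) p = br (hs @ [g]) p"
    using hamiltonian_tangent[OF br h(1,2)] h(3,4) by (simp add: differential_def hamiltonian_vec_def)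
qed

lemma tangent_lincomb:
  assumes "v \<in> tangent M p" "w \<in> tangent M p"
  shows "(\<lambda>f. a * v f + b * w f) \<in> tangent M p"
  using tangentD[OF assms(1)] tangentD[OF assms(2)]
  unfolding tangent_def by (simp add: algebra_simps)

lemma differential_cotangent: "f \<in> Cinf M \<Longrightarrow> differential M p f \<in> cotangent M p"
  unfolding cotangent_def differential_def using tangent_lincomb[of _ M p] by auto

text \<open>A derivation is determined by its values on differentials, so \<open>\<Pi>\<^sup>\<sharp>\<close> of covectors is the
  Hamiltonian vector of any functions with these covectors as differentials.\<close>

lemma nambu_sharp_eq:
  assumes M: "smooth_manifold M" and br: "nambu_structure M n br" and p: "p \<in> carr M"
    and \<alpha>s: "length \<alpha>s = n - 1" "set \<alpha>s \<subseteq> cotangent M p"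
    and gs: "length gs = n - 1" "set gs \<subseteq> Cinf M" "map (differential M p) gs = \<alpha>s"
  shows "nambu_sharp M br p \<alpha>s = hamiltonian_vec M br gs p"
proof -
  define ch where "ch = (\<lambda>\<alpha>. SOME f. f \<in> Cinf M \<and> differential M p f = \<alpha>)"
  have ch: "ch \<alpha> \<in> Cinf M" "differential M p (ch \<alpha>) = \<alpha>" if "\<alpha> \<in> cotangent M p" for \<alpha>
  proof -
    have "\<exists>f. f \<in> Cinf M \<and> differential M p f = \<alpha>" using covector_is_differential[OF M p that] by blast
    from someI_ex[OF this] show "ch \<alpha> \<in> Cinf M" "differential M p (ch \<alpha>) = \<alpha>" unfolding ch_def by auto
  qed
  have n: "1 \<le> n" using nambu_pos[OF br] .
  have tensor: "nambu_tensor M br p (\<alpha>s @ [\<beta>]) = \<beta> (hamiltonian_vec M br gs p)" if \<beta>: "\<beta> \<in> cotangent M p" for \<beta>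
  proof -
    have "nambu_tensor M br p (\<alpha>s @ [\<beta>]) = br (map ch \<alpha>s @ [ch \<beta>]) p"
      unfolding nambu_tensor_def ch_def by simp
    also have "\<dots> = br (gs @ [ch \<beta>]) p"
    proof (rule bracket_depends_on_differentials[OF br])
      fix k assume k: "k < n"
      show "differential M p ((map ch \<alpha>s @ [ch \<beta>]) ! k) = differential M p ((gs @ [ch \<beta>]) ! k)"
      proof (cases "k < n - 1")
        case True
        then have "\<alpha>s ! k \<in> cotangent M p" using \<alpha>s nth_mem[of k \<alpha>s] by auto
        moreover have "differential M p (gs ! k) = \<alpha>s ! k" using gs(1,3) True by (metis nth_map)
        ultimately show ?thesis using True \<alpha>s(1) gs(1) ch(2) by (simp add: nth_append)
      next
        case False
        then show ?thesis using k \<alpha>s(1) gs(1) by (simp add: nth_append)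
      qed
    qed (use n \<alpha>s gs ch(1) \<beta> in auto)
    also have "\<dots> = differential M p (ch \<beta>) (hamiltonian_vec M br gs p)"
      using hamiltonian_tangent[OF br gs(1,2)] ch(1)[OF \<beta>] by (simp add: differential_def hamiltonian_vec_def)
    finally show ?thesis using ch(2)[OF \<beta>] by simp
  qed
  show ?thesis
    unfolding nambu_sharp_def
  proof (rule the_equality)
    show "hamiltonian_vec M br gs p \<in> tangent M p \<and>
        (\<forall>\<beta>\<in>cotangent M p. \<beta> (hamiltonian_vec M br gs p) = nambu_tensor M br p (\<alpha>s @ [\<beta>]))"
      using hamiltonian_tangent[OF br gs(1,2)] tensor by simp
    fix v assume v: "v \<in> tangent M p \<and> (\<forall>\<beta>\<in>cotangent M p. \<beta> v = nambu_tensor M br p (\<alpha>s @ [\<beta>]))"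
    show "v = hamiltonian_vec M br gs p"
    proof
      fix f
      show "v f = hamiltonian_vec M br gs p f"
      proof (cases "f \<in> Cinf M")
        case True
        then have "differential M p f v = differential M p f (hamiltonian_vec M br gs p)"
          using v tensor differential_cotangent by metis
        then show ?thesis using v hamiltonian_tangent[OF br gs(1,2)] by (simp add: differential_def)
      next
        case False
        then show ?thesis using tangentD(3) v by (auto simp: hamiltonian_vec_def)
      qed
    qed
  qed
qed

lemma nambu_sharp_hamiltonian:
  assumes M: "smooth_manifold M" and br: "nambu_structure M n br" and p: "p \<in> carr M"
    and \<alpha>s: "length \<alpha>s = n - 1" "set \<alpha>s \<subseteq> cotangent M p"
  obtains gs where "length gs = n - 1" "set gs \<subseteq> Cinf M" "nambu_sharp M br p \<alpha>s = hamiltonian_vec M br gs p"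
proof -
  have "\<forall>\<alpha>\<in>cotangent M p. \<exists>f. f \<in> Cinf M \<and> differential M p f = \<alpha>"
    using covector_is_differential[OF M p] by blast
  then obtain c where c: "\<And>\<alpha>. \<alpha> \<in> cotangent M p \<Longrightarrow> c \<alpha> \<in> Cinf M \<and> differential M p (c \<alpha>) = \<alpha>" by metis
  have gs: "length (map c \<alpha>s) = n - 1" "set (map c \<alpha>s) \<subseteq> Cinf M" "map (differential M p) (map c \<alpha>s) = \<alpha>s"
    using c \<alpha>s by (auto simp: map_idI subset_iff)
  show ?thesis using that[OF gs(1,2) nambu_sharp_eq[OF M br p \<alpha>s gs]] .
qed


section \<open>Descending a bracket\<close>

text \<open>Two lifts of the same function differ by an element of \<open>A\<close> that vanishes on \<open>N\<close>, so the
  restricted bracket of lifts is independent of the lifts. All identities are inherited since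
  passing to lifts respects the operations.\<close>

theorem nambu_descends:
  fixes M :: "('a, 'e::euclidean_space) mfd" and N :: "('a, 'f::euclidean_space) mfd"
    and Q :: "('b, 'g::euclidean_space) mfd"
  assumes br: "nambu_structure M n br" and A: "A \<subseteq> Cinf M"
    and Alin: "\<And>f g a b. f \<in> A \<Longrightarrow> g \<in> A \<Longrightarrow> (\<lambda>x. a * f x + b * g x) \<in> A"
    and Amult: "\<And>f g. f \<in> A \<Longrightarrow> g \<in> A \<Longrightarrow> (\<lambda>x. f x * g x) \<in> A"
    and Abr: "\<And>fs. length fs = n \<Longrightarrow> set fs \<subseteq> A \<Longrightarrow> br fs \<in> A"
    and surj: "\<pi> ` carr N = carr Q"
    and desc: "\<And>F. F \<in> A \<Longrightarrow> \<exists>f\<in>Cinf Q. pull N \<pi> f = pull N (\<lambda>x. x) F"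
    and lift: "\<And>f. f \<in> Cinf Q \<Longrightarrow> \<exists>F\<in>A. pull N \<pi> f = pull N (\<lambda>x. x) F"
    and vanish: "\<And>gs h p. length gs = n - 1 \<Longrightarrow> set gs \<subseteq> A \<Longrightarrow> h \<in> A \<Longrightarrow> (\<And>x. x \<in> carr N \<Longrightarrow> h x = 0) \<Longrightarrow>
      p \<in> carr N \<Longrightarrow> br (gs @ [h]) p = 0"
  shows "\<exists>brQ. nambu_structure Q n brQ \<and>
    (\<forall>fs Fs. length fs = n \<and> set fs \<subseteq> Cinf Q \<and> length Fs = n \<and> set Fs \<subseteq> A \<and>
      (\<forall>k<n. pull N (\<lambda>x. x) (Fs ! k) = pull N \<pi> (fs ! k)) \<longrightarrow>
      pull N \<pi> (brQ fs) = pull N (\<lambda>x. x) (br Fs))"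
proof -
  define rel where "rel = (\<lambda>f F. f \<in> Cinf Q \<and> F \<in> A \<and> (\<forall>x\<in>carr N. f (\<pi> x) = F x))"
  have pull_iff: "pull N \<pi> f = pull N (\<lambda>x. x) F \<longleftrightarrow> (\<forall>x\<in>carr N. f (\<pi> x) = F x)"
    for f :: "'b \<Rightarrow> real" and F :: "'a \<Rightarrow> real"
    unfolding pull_def fun_eq_iff by auto
  have rel_unique: "f = g" if "rel f F" "rel g F" for f g F
  proof
    fix z show "f z = g z"
    proof (cases "z \<in> carr Q")
      case True
      then obtain x where "x \<in> carr N" "z = \<pi> x" using surj by blast
      then show ?thesis using that unfolding rel_def by simp
    next
      case False
      then show ?thesis using that Cinf_off_carrier[of f Q z] Cinf_off_carrier[of g Q z] unfolding rel_def by simp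
    qed
  qed
  have rel_lin: "rel (\<lambda>x. a * f x + b * g x) (\<lambda>x. a * F x + b * G x)" if "rel f F" "rel g G" for f g F G a b
    using that Alin Cinf_lincomb[of f Q g a b] unfolding rel_def by auto
  have rel_mult: "rel (\<lambda>x. f x * g x) (\<lambda>x. F x * G x)" if "rel f F" "rel g G" for f g F G
    using that Amult Cinf_mult[of f Q g] unfolding rel_def by auto
  have n: "1 \<le> n" using nambu_pos[OF br] .
  have well_def: "br Fs x = br Gs x"
    if "length Fs = n" "set Fs \<subseteq> A" "length Gs = n" "set Gs \<subseteq> A"
      "\<And>k. k < n \<Longrightarrow> \<forall>x\<in>carr N. (Fs ! k) x = (Gs ! k) x" "x \<in> carr N" for Fs Gs x
  proof (rule nambu_replace_all[where R = "\<lambda>f g. \<forall>x\<in>carr N. f x = g x", OF br A _ that(1-5)])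
    fix hs f g assume h: "length hs = n - 1" "set hs \<subseteq> A" "f \<in> A" "g \<in> A" "\<forall>x\<in>carr N. f x = g x"
    have "br (hs @ [\<lambda>x. 1 * f x + (-1) * g x]) x = 0"
      using h that(6) by (intro vanish Alin) auto
    moreover have "set hs \<subseteq> Cinf M" "f \<in> Cinf M" "g \<in> Cinf M" using h A by auto
    ultimately show "br (hs @ [f]) x = br (hs @ [g]) x"
      using nambu_linear_last[OF br h(1), of f g 1 "-1"] by simp
  qed
  define lf where "lf = (\<lambda>f. SOME F. rel f F)"
  have lf: "rel f (lf f)" if "f \<in> Cinf Q" for f
  proof -
    have "\<exists>F. rel f F" using lift[OF that] that unfolding rel_def pull_iff by blast
    then show ?thesis unfolding lf_def by (rule someI_ex)
  qed
  define brQ where "brQ = (\<lambda>fs. SOME f. rel f (br (map lf fs)))"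
  have rel_set: "set fs \<subseteq> Cinf Q" "set Fs \<subseteq> A" if "list_all2 rel fs Fs" for fs Fs
    using that unfolding rel_def list_all2_conv_all_nth by (auto simp: in_set_conv_nth)
  have rel_br: "rel (brQ fs) (br Fs)" if r: "list_all2 rel fs Fs" "length fs = n" for fs Fs
  proof -
    note s = rel_set[OF r(1)]
    have l: "length Fs = n" using r list_all2_lengthD by metis
    have lA: "set (map lf fs) \<subseteq> A" using lf s(1) unfolding rel_def by auto
    have "\<exists>f. rel f (br (map lf fs))"
      using desc[OF Abr[OF _ lA]] Abr[OF _ lA] r(2) unfolding rel_def pull_iff by auto
    then have q: "rel (brQ fs) (br (map lf fs))" unfolding brQ_def by (rule someI_ex)
    have "br (map lf fs) x = br Fs x" if "x \<in> carr N" for x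
    proof (rule well_def[OF _ lA l s(2) _ that])
      fix k assume k: "k < n"
      have "rel (fs ! k) (Fs ! k)" using r k by (simp add: list_all2_conv_all_nth)
      moreover have "rel (fs ! k) (lf (fs ! k))" using lf[of "fs ! k"] s(1) r(2) k nth_mem[of k fs] by blast
      ultimately show "\<forall>x\<in>carr N. (map lf fs ! k) x = (Fs ! k) x"
        using r(2) k unfolding rel_def by simp
    qed (simp add: r)
    then show ?thesis using q Abr[OF l s(2)] unfolding rel_def by auto
  qed
  have lfs: "list_all2 rel fs (map lf fs)" if "set fs \<subseteq> Cinf Q" for fs
    unfolding list_all2_map2 list_all2_same using lf that by blast
  have upd: "list_all2 rel (fs[k := f]) (Fs[k := F])" if "list_all2 rel fs Fs" "rel f F" for fs Fs k f F
    by (rule list_all2_update_cong[where P = rel]) (fact that)+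
  have snoc: "list_all2 rel (fs @ [f]) (Fs @ [F])" if "list_all2 rel fs Fs" "rel f F" for fs Fs f F
    using that by (simp add: list_all2_appendI)
  have "nambu_structure Q n brQ"
    unfolding nambu_structure_def
  proof (intro conjI allI impI; (elim conjE)?)
    show "1 \<le> n" by (rule n)
    show "brQ fs \<in> Cinf Q" if "length fs = n" "set fs \<subseteq> Cinf Q" for fs
      using rel_br[OF lfs[OF that(2)] that(1)] unfolding rel_def by blast
    show "brQ (fs[k := \<lambda>x. a * g x + b * h x]) = (\<lambda>x. a * brQ (fs[k := g]) x + b * brQ (fs[k := h]) x)"
      if fs: "length fs = n" "set fs \<subseteq> Cinf Q" and k: "k < n" and gh: "g \<in> Cinf Q" "h \<in> Cinf Q" for fs k g h a b
    proof (rule rel_unique)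
      let ?Fs = "map lf fs"
      have "br (?Fs[k := \<lambda>x. a * lf g x + b * lf h x]) = (\<lambda>x. a * br (?Fs[k := lf g]) x + b * br (?Fs[k := lf h]) x)"
        using rel_set(2)[OF lfs[OF fs(2)]] lf[OF gh(1)] lf[OF gh(2)] A fs(1) k
        by (intro nambu_linear[OF br]) (auto simp: rel_def)
      then show "rel (\<lambda>x. a * brQ (fs[k := g]) x + b * brQ (fs[k := h]) x) (br (?Fs[k := \<lambda>x. a * lf g x + b * lf h x]))"
        using rel_lin[OF rel_br[OF upd[OF lfs[OF fs(2)] lf[OF gh(1)]]] rel_br[OF upd[OF lfs[OF fs(2)] lf[OF gh(2)]]]] fs(1)
        by simp
      show "rel (brQ (fs[k := \<lambda>x. a * g x + b * h x])) (br (?Fs[k := \<lambda>x. a * lf g x + b * lf h x]))"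
        using fs(1) by (intro rel_br upd lfs fs rel_lin lf gh) simp
    qed
    show "brQ (fs[i := fs ! j, j := fs ! i]) = (\<lambda>x. - brQ fs x)"
      if fs: "length fs = n" "set fs \<subseteq> Cinf Q" and ij: "i < j" "j < n" for fs i j
    proof (rule rel_unique)
      let ?Fs = "map lf fs"
      have eq: "br (?Fs[i := ?Fs ! j, j := ?Fs ! i]) = (\<lambda>x. - br ?Fs x)"
        using rel_set(2)[OF lfs[OF fs(2)]] A fs(1) ij by (intro nambu_skew[OF br]) auto
      have nth: "rel (fs ! k) (?Fs ! k)" if "k < n" for k
        using lfs[OF fs(2)] fs(1) that by (simp add: list_all2_conv_all_nth)
      show "rel (brQ (fs[i := fs ! j, j := fs ! i])) (br (?Fs[i := ?Fs ! j, j := ?Fs ! i]))"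
        using fs(1) ij by (intro rel_br upd lfs fs nth) auto
      show "rel (\<lambda>x. - brQ fs x) (br (?Fs[i := ?Fs ! j, j := ?Fs ! i]))"
        unfolding eq using rel_lin[OF rel_br[OF lfs[OF fs(2)] fs(1)] rel_br[OF lfs[OF fs(2)] fs(1)], of "-1" 0] by simp
    qed
    show "brQ (fs @ [\<lambda>x. g x * h x]) = (\<lambda>x. g x * brQ (fs @ [h]) x + brQ (fs @ [g]) x * h x)"
      if fs: "length fs = n - 1" "set fs \<subseteq> Cinf Q" and gh: "g \<in> Cinf Q" "h \<in> Cinf Q" for fs g h
    proof (rule rel_unique)
      let ?Fs = "map lf fs"
      have len: "length (fs @ [u]) = n" for u using fs(1) n by simp
      have eq: "br (?Fs @ [\<lambda>x. lf g x * lf h x]) = (\<lambda>x. lf g x * br (?Fs @ [lf h]) x + br (?Fs @ [lf g]) x * lf h x)"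
        using rel_set(2)[OF lfs[OF fs(2)]] lf[OF gh(1)] lf[OF gh(2)] A fs(1)
        by (intro nambu_leibniz[OF br]) (auto simp: rel_def)
      show "rel (brQ (fs @ [\<lambda>x. g x * h x])) (br (?Fs @ [\<lambda>x. lf g x * lf h x]))"
        using len by (intro rel_br snoc lfs fs rel_mult lf gh)
      have r: "rel (brQ (fs @ [u])) (br (?Fs @ [lf u]))" if "u \<in> Cinf Q" for u
        using len by (intro rel_br snoc lfs fs lf that)
      from rel_lin[OF rel_mult[OF lf[OF gh(1)] r[OF gh(2)]] rel_mult[OF r[OF gh(1)] lf[OF gh(2)]], of 1 1]
      show "rel (\<lambda>x. g x * brQ (fs @ [h]) x + brQ (fs @ [g]) x * h x) (br (?Fs @ [\<lambda>x. lf g x * lf h x]))"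
        unfolding eq by simp
    qed
    show "brQ (gs @ [brQ fs]) = (\<lambda>x. \<Sum>k<n. brQ (fs[k := brQ (gs @ [fs ! k])]) x)"
      if gs: "length gs = n - 1" "set gs \<subseteq> Cinf Q" and fs: "length fs = n" "set fs \<subseteq> Cinf Q" for gs fs
    proof (rule rel_unique)
      let ?Fs = "map lf fs" and ?Gs = "map lf gs"
      have len: "length (gs @ [u]) = n" for u using gs(1) n by simp
      have eq: "br (?Gs @ [br ?Fs]) = (\<lambda>x. \<Sum>k<n. br (?Fs[k := br (?Gs @ [?Fs ! k])]) x)"
        using rel_set(2)[OF lfs[OF fs(2)]] rel_set(2)[OF lfs[OF gs(2)]] A fs(1) gs(1)
        by (intro nambu_fundamental[OF br]) auto
      have nth: "rel (fs ! k) (?Fs ! k)" if "k < n" for k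
        using lfs[OF fs(2)] fs(1) that by (simp add: list_all2_conv_all_nth)
      show "rel (brQ (gs @ [brQ fs])) (br (?Gs @ [br ?Fs]))"
        using len fs(1) by (intro rel_br snoc lfs fs gs)
      have 1: "rel (brQ (fs[k := brQ (gs @ [fs ! k])])) (br (?Fs[k := br (?Gs @ [?Fs ! k])]))" if "k < n" for k
        using len fs(1) nth[OF that] by (intro rel_br upd snoc lfs fs gs) auto
      have "rel (\<lambda>x. \<Sum>k<m. brQ (fs[k := brQ (gs @ [fs ! k])]) x) (\<lambda>x. \<Sum>k<m. br (?Fs[k := br (?Gs @ [?Fs ! k])]) x)"
        if "m \<le> n" for m
        using that
      proof (induction m)
        case 0
        show ?case using rel_lin[OF 1[of 0] 1[of 0], of 0 0] n by simp
      next
        case (Suc m)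
        then show ?case using rel_lin[OF Suc.IH 1[of m], of 1 1] by simp
      qed
      then show "rel (\<lambda>x. \<Sum>k<n. brQ (fs[k := brQ (gs @ [fs ! k])]) x) (br (?Gs @ [br ?Fs]))"
        unfolding eq by simp
    qed
  qed
  moreover have "pull N \<pi> (brQ fs) = pull N (\<lambda>x. x) (br Fs)"
    if "length fs = n" "set fs \<subseteq> Cinf Q" "length Fs = n" "set Fs \<subseteq> A"
      "\<And>k. k < n \<Longrightarrow> pull N (\<lambda>x. x) (Fs ! k) = pull N \<pi> (fs ! k)" for fs Fs
  proof -
    have "rel (fs ! k) (Fs ! k)" if k: "k < n" for k
    proof -
      have "fs ! k \<in> Cinf Q" "Fs ! k \<in> A"
        using nth_mem[of k fs] nth_mem[of k Fs] k \<open>length fs = n\<close> \<open>length Fs = n\<close>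
          \<open>set fs \<subseteq> Cinf Q\<close> \<open>set Fs \<subseteq> A\<close> by auto
      then show ?thesis
        using \<open>\<And>k. k < n \<Longrightarrow> pull N (\<lambda>x. x) (Fs ! k) = pull N \<pi> (fs ! k)\<close>[OF k]
        unfolding rel_def pull_iff[symmetric] by simp
    qed
    then have "list_all2 rel fs Fs" using that(1,3) by (simp add: list_all2_conv_all_nth)
    then show ?thesis using rel_br that(1) unfolding rel_def pull_iff by blast
  qed
  ultimately show ?thesis by blast
qed


section \<open>Reduction\<close>

text \<open>If \<open>A\<close> is closed under the bracket, this says that the functions in \<open>A\<close> that vanish on \<open>N\<close>
  form an ideal for the bracket. It is the condition to which reducibility, the inclusion of the
  image of \<open>\<Pi>\<^sup>\<sharp>\<close> in \<open>TN\<close>, and being a Nambu-Poisson submanifold all reduce.\<close>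

definition ideal_on :: "('a, 'e::euclidean_space) mfd \<Rightarrow> nat \<Rightarrow> (('a \<Rightarrow> real) list \<Rightarrow> 'a \<Rightarrow> real) \<Rightarrow>
    ('a, 'f) mfd \<Rightarrow> ('a \<Rightarrow> real) set \<Rightarrow> bool" where
  "ideal_on M n br N A \<longleftrightarrow> (\<forall>gs h p. length gs = n - 1 \<and> set gs \<subseteq> A \<and> h \<in> A \<and>
     (\<forall>x\<in>carr N. h x = 0) \<and> p \<in> carr N \<longrightarrow> br (gs @ [h]) p = 0)"

lemma Cinf_along_lincomb:
  assumes "f \<in> Cinf_along M S E" "g \<in> Cinf_along M S E"
  shows "(\<lambda>x. a * f x + b * g x) \<in> Cinf_along M S E"
proof -
  have C: "f \<in> Cinf M" "g \<in> Cinf M" using assms unfolding Cinf_along_def by auto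
  have "differential M p (\<lambda>x. a * f x + b * g x) v = a * differential M p f v + b * differential M p g v" for p v
    using tangentD(1)[OF _ C] by (simp add: differential_def)
  then show ?thesis using assms Cinf_lincomb[OF C] unfolding Cinf_along_def by auto
qed

lemma Cinf_along_mult:
  assumes "f \<in> Cinf_along M S E" "g \<in> Cinf_along M S E"
  shows "(\<lambda>x. f x * g x) \<in> Cinf_along M S E"
proof -
  have C: "f \<in> Cinf M" "g \<in> Cinf M" using assms unfolding Cinf_along_def by auto
  have "differential M p (\<lambda>x. f x * g x) v = f p * differential M p g v + g p * differential M p f v" for p v
    using tangentD(2)[OF _ C] by (simp add: differential_def)
  then show ?thesis using assms Cinf_mult[OF C] unfolding Cinf_along_def by auto
qed

text \<open>A subbundle that is not zero has positive rank, so it is nonzero in every fibre.\<close>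

lemma nonzero_subbundle_fibre:
  assumes E: "vector_subbundle M N E" and nz: "\<not> zero_subbundle N E" and p: "p \<in> carr N"
  obtains v G where "v \<in> E p" "v \<in> tangent M p" "G \<in> Cinf M" "v G \<noteq> 0"
proof -
  obtain k :: nat where k: "\<forall>p\<in>carr N. \<exists>U e. openin (mtop N) U \<and> p \<in> U \<and>
     (\<forall>j<k. (\<forall>q\<in>U. e j q \<in> tangent M q) \<and> (\<forall>f\<in>Cinf M. smooth_fun_on N U (\<lambda>q. e j q f))) \<and>
     (\<forall>q\<in>U. E q = {(\<lambda>f. \<Sum>j<k. c j * e j q f) | c. True} \<and>
        (\<forall>c. (\<forall>f\<in>Cinf M. (\<Sum>j<k. c j * e j q f) = 0) \<longrightarrow> (\<forall>j<k. c j = 0)))"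
    using E unfolding vector_subbundle_def by blast
  have "k \<noteq> 0"
  proof
    assume "k = 0"
    then have "E q = {\<lambda>f. 0}" if "q \<in> carr N" for q
      using k that by auto
    then show False using nz unfolding zero_subbundle_def by blast
  qed
  obtain U e where Ue: "openin (mtop N) U" "p \<in> U"
     "\<forall>j<k. (\<forall>q\<in>U. e j q \<in> tangent M q) \<and> (\<forall>f\<in>Cinf M. smooth_fun_on N U (\<lambda>q. e j q f))"
     "\<forall>q\<in>U. E q = {(\<lambda>f. \<Sum>j<k. c j * e j q f) | c. True} \<and>
        (\<forall>c. (\<forall>f\<in>Cinf M. (\<Sum>j<k. c j * e j q f) = 0) \<longrightarrow> (\<forall>j<k. c j = 0))"
    using bspec[OF k p] by (elim exE conjE) (rule that)
  have e: "\<And>j. j < k \<Longrightarrow> e j p \<in> tangent M p"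
    "E p = {(\<lambda>f. \<Sum>j<k. c j * e j p f) | c. True}"
    "\<And>c. \<forall>f\<in>Cinf M. (\<Sum>j<k. c j * e j p f) = 0 \<Longrightarrow> \<forall>j<k. c j = 0"
    using Ue(2,3) bspec[OF Ue(4) Ue(2)] by simp_all
  let ?c = "\<lambda>j. if j = 0 then 1 else 0 :: real"
  have sum: "(\<Sum>j<k. ?c j * e j p f) = e 0 p f" for f
    using \<open>k \<noteq> 0\<close> by (simp add: if_distrib[of "\<lambda>c. c * _"] sum.delta cong: if_cong)
  have "(\<lambda>f. \<Sum>j<k. ?c j * e j p f) \<in> E p"
    unfolding e(2) by (intro CollectI exI[of _ ?c]) simp
  then have "e 0 p \<in> E p" unfolding sum .
  moreover have "\<not> (\<forall>G\<in>Cinf M. e 0 p G = 0)"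
  proof
    assume "\<forall>G\<in>Cinf M. e 0 p G = 0"
    then have "\<forall>j<k. ?c j = 0" using e(3)[of ?c] unfolding sum by blast
    then show False using \<open>k \<noteq> 0\<close> by auto
  qed
  then obtain G where "G \<in> Cinf M" "e 0 p G \<noteq> 0" by blast
  ultimately show ?thesis using that e(1)[of 0] \<open>k \<noteq> 0\<close> by blast
qed

text \<open>If \<open>h\<close> vanishes on \<open>N\<close> and \<open>dh\<close> vanishes on \<open>E\<close>, then the same holds for \<open>h G\<close> with an
  arbitrary \<open>G\<close>. Evaluating the differential of its brackets on a nonzero vector of \<open>E\<close>
  leaves only the bracket with \<open>h\<close> times the derivative of \<open>G\<close>.\<close>

lemma canonical_ideal:
  assumes br: "nambu_structure M n br" and E: "vector_subbundle M N E"
    and can: "canonical_subbundle M n br N E" and nz: "\<not> zero_subbundle N E"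
  shows "ideal_on M n br N (Cinf_along M (carr N) E)"
  unfolding ideal_on_def
proof (intro allI impI, elim conjE)
  fix gs h p
  let ?A = "Cinf_along M (carr N) E"
  assume gs: "length gs = n - 1" "set gs \<subseteq> ?A" and h: "h \<in> ?A" "\<forall>x\<in>carr N. h x = 0" and p: "p \<in> carr N"
  have A: "?A \<subseteq> Cinf M" unfolding Cinf_along_def by blast
  then have gsC: "set gs \<subseteq> Cinf M" and hC: "h \<in> Cinf M" using gs(2) h(1) by auto
  have n: "1 \<le> n" using nambu_pos[OF br] .
  obtain v G where v: "v \<in> E p" "v \<in> tangent M p" and G: "G \<in> Cinf M" "v G \<noteq> 0"
    using nonzero_subbundle_fibre[OF E nz p] .
  have brA: "br (gs @ [u]) \<in> ?A" if "u \<in> ?A" for u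
    using can gs that n unfolding canonical_subbundle_def by auto
  have v0: "v u = 0" if "u \<in> ?A" for u
    using that p v unfolding Cinf_along_def differential_def by fastforce
  have "(\<lambda>x. h x * G x) \<in> ?A"
  proof -
    have "differential M q (\<lambda>x. h x * G x) w = 0" if q: "q \<in> carr N" "w \<in> E q" for q w
    proof (cases "w \<in> tangent M q")
      case True
      then have "w h = 0" using h(1) q unfolding Cinf_along_def differential_def by fastforce
      then show ?thesis
        using tangentD(2)[OF True hC G(1)] h(2) q(1) by (simp add: differential_def)
    qed (simp add: differential_def)
    then show ?thesis using Cinf_mult[OF hC G(1)] unfolding Cinf_along_def by blast
  qed
  then have "v (br (gs @ [\<lambda>x. h x * G x])) = 0" using v0 brA by blast
  moreover have C: "br (gs @ [G]) \<in> Cinf M" "br (gs @ [h]) \<in> Cinf M"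
    using gs(1) gsC hC G(1) n by (auto intro!: nambu_closed[OF br])
  have "v (br (gs @ [\<lambda>x. h x * G x])) = v (\<lambda>x. 1 * (h x * br (gs @ [G]) x) + 1 * (br (gs @ [h]) x * G x))"
    using nambu_leibniz[OF br gs(1) gsC hC G(1)] by simp
  then have "v (br (gs @ [\<lambda>x. h x * G x])) = h p * v (br (gs @ [G])) + br (gs @ [G]) p * v h
      + (br (gs @ [h]) p * v G + G p * v (br (gs @ [h])))"
    unfolding tangentD(1)[OF v(2) Cinf_mult[OF hC C(1)] Cinf_mult[OF C(2) G(1)]]
    using tangentD(2)[OF v(2) hC C(1)] tangentD(2)[OF v(2) C(2) G(1)] by simp
  ultimately have "br (gs @ [h]) p * v G = 0"
    using h(2) p v0[OF h(1)] v0[OF brA[OF h(1)]] by simp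
  then show "br (gs @ [h]) p = 0" using G(2) by simp
qed

lemma ideal_imp_reducible:
  assumes N: "smooth_manifold N" and br: "nambu_structure M n br"
    and can: "canonical_subbundle M n br N E"
    and F: "regular_integrable_distribution N (tangential_part M N E) Q"
    and restr: "pull N (\<lambda>x. x) ` Cinf_along M (carr N) E = Cinf_along N (carr N) (tangential_part M N E)"
    and ideal: "ideal_on M n br N (Cinf_along M (carr N) E)"
  shows "nambu_reducible M n br N E Q"
proof -
  let ?A = "Cinf_along M (carr N) E" and ?\<pi> = "leaf N (tangential_part M N E)"
  note lsf = leaf_space_functions[OF N F]
  have "\<exists>brQ. nambu_structure Q n brQ \<and>
    (\<forall>fs Fs. length fs = n \<and> set fs \<subseteq> Cinf Q \<and> length Fs = n \<and> set Fs \<subseteq> ?A \<and>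
      (\<forall>k<n. pull N (\<lambda>x. x) (Fs ! k) = pull N ?\<pi> (fs ! k)) \<longrightarrow>
      pull N ?\<pi> (brQ fs) = pull N (\<lambda>x. x) (br Fs))"
  proof (rule nambu_descends[OF br, where A = ?A and N = N and \<pi> = ?\<pi> and Q = Q])
    show "?A \<subseteq> Cinf M" unfolding Cinf_along_def by blast
    show "br fs \<in> ?A" if "length fs = n" "set fs \<subseteq> ?A" for fs
      using can that unfolding canonical_subbundle_def by blast
    show "?\<pi> ` carr N = carr Q" using F unfolding regular_integrable_distribution_def by simp
    show "\<exists>f\<in>Cinf Q. pull N ?\<pi> f = pull N (\<lambda>x. x) G" if "G \<in> ?A" for G
      using lsf(2) restr that by blast
    show "\<exists>G\<in>?A. pull N ?\<pi> f = pull N (\<lambda>x. x) G" if "f \<in> Cinf Q" for f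
      using lsf(1)[OF that] restr by blast
    show "br (gs @ [h]) p = 0" if "length gs = n - 1" "set gs \<subseteq> ?A" "h \<in> ?A" "\<And>x. x \<in> carr N \<Longrightarrow> h x = 0"
      "p \<in> carr N" for gs h p
      using ideal that unfolding ideal_on_def by blast
  qed (rule Cinf_along_lincomb Cinf_along_mult, assumption+)+
  then show ?thesis
    unfolding nambu_reducible_def Let_def .
qed

text \<open>The reduced bracket sees only restrictions to \<open>N\<close>, so replacing an argument that vanishes on
  \<open>N\<close> by \<open>0\<close> does not change the restriction of the bracket.\<close>

lemma reducible_imp_ideal:
  assumes N: "smooth_manifold N" and br: "nambu_structure M n br"
    and F: "regular_integrable_distribution N (tangential_part M N E) Q"
    and restr: "pull N (\<lambda>x. x) ` Cinf_along M (carr N) E = Cinf_along N (carr N) (tangential_part M N E)"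
    and red: "nambu_reducible M n br N E Q"
  shows "ideal_on M n br N (Cinf_along M (carr N) E)"
  unfolding ideal_on_def
proof (intro allI impI, elim conjE)
  fix gs h p
  let ?A = "Cinf_along M (carr N) E" and ?\<pi> = "leaf N (tangential_part M N E)"
  assume gs: "length gs = n - 1" "set gs \<subseteq> ?A" and h: "h \<in> ?A" "\<forall>x\<in>carr N. h x = 0" and p: "p \<in> carr N"
  obtain brQ where brQ: "\<And>fs Fs. length fs = n \<Longrightarrow> set fs \<subseteq> Cinf Q \<Longrightarrow> length Fs = n \<Longrightarrow> set Fs \<subseteq> ?A \<Longrightarrow>
      (\<And>k. k < n \<Longrightarrow> pull N (\<lambda>x. x) (Fs ! k) = pull N ?\<pi> (fs ! k)) \<Longrightarrow>
      pull N ?\<pi> (brQ fs) = pull N (\<lambda>x. x) (br Fs)"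
    using red unfolding nambu_reducible_def Let_def by blast
  have n: "1 \<le> n" using nambu_pos[OF br] .
  have zA: "(\<lambda>x. 0) \<in> ?A" using Cinf_along_lincomb[OF h(1) h(1), of 0 0] by simp
  have "\<forall>G\<in>?A. \<exists>f. f \<in> Cinf Q \<and> pull N ?\<pi> f = pull N (\<lambda>x. x) G"
    using leaf_space_functions(2)[OF N F] restr by blast
  then obtain d where d: "\<And>G. G \<in> ?A \<Longrightarrow> d G \<in> Cinf Q \<and> pull N ?\<pi> (d G) = pull N (\<lambda>x. x) G" by metis
  \<comment> \<open>\<open>h\<close> and \<open>0\<close> both extend the same function on the leaf space.\<close>
  have eq: "pull N ?\<pi> (brQ (map d gs @ [d h])) = pull N (\<lambda>x. x) (br (gs @ [u]))" if u: "u \<in> ?A" "\<forall>x\<in>carr N. u x = 0" for u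
  proof (rule brQ)
    show "pull N (\<lambda>x. x) ((gs @ [u]) ! k) = pull N ?\<pi> ((map d gs @ [d h]) ! k)" if k: "k < n" for k
    proof (cases "k < n - 1")
      case True
      then have "gs ! k \<in> ?A" using gs nth_mem[of k gs] by auto
      then show ?thesis using True gs(1) d by (simp add: nth_append)
    next
      case False
      have "pull N (\<lambda>x. x) u = pull N (\<lambda>x. x) h" using u(2) h(2) by (auto simp: pull_def)
      then show ?thesis using False k gs(1) d[OF h(1)] by (simp add: nth_append)
    qed
  qed (use n gs u h d in auto)
  have "set gs \<subseteq> Cinf M" using gs(2) unfolding Cinf_along_def by blast
  then have "br (gs @ [\<lambda>x. 0]) p = 0" using nambu_last_zero[OF br gs(1)] by simp
  moreover have "pull N (\<lambda>x. x) (br (gs @ [h])) p = pull N (\<lambda>x. x) (br (gs @ [\<lambda>x. 0])) p"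
    using eq[OF h] eq[OF zA] by simp
  ultimately show "br (gs @ [h]) p = 0" using p by (simp add: pull_def)
qed


section \<open>Nambu-Poisson submanifolds\<close>

text \<open>A tangent vector of \<open>M\<close> that kills the functions vanishing on \<open>N\<close> factors through
  restriction to \<open>N\<close>.\<close>

lemma tangent_sub_if_kills:
  assumes restr: "pull N (\<lambda>x. x) ` Cinf M = Cinf N" and p: "p \<in> carr N"
    and v: "v \<in> tangent M p" and kill: "\<And>f. f \<in> Cinf M \<Longrightarrow> (\<And>x. x \<in> carr N \<Longrightarrow> f x = 0) \<Longrightarrow> v f = 0"
  shows "v \<in> tangent_sub M N p"
proof -
  let ?r = "pull N (\<lambda>x. x)"
  have "\<forall>f\<in>Cinf N. \<exists>F. F \<in> Cinf M \<and> ?r F = f" using restr by (metis imageE)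
  then obtain e where e: "\<And>f. f \<in> Cinf N \<Longrightarrow> e f \<in> Cinf M \<and> ?r (e f) = f" by metis
  have eN: "e f x = f x" if "f \<in> Cinf N" "x \<in> carr N" for f x
    using e[OF that(1)] that(2) by (metis pull_apply)
  have wd: "v F = v G" if F: "F \<in> Cinf M" "G \<in> Cinf M" "\<And>x. x \<in> carr N \<Longrightarrow> F x = G x" for F G
  proof -
    have "v (\<lambda>x. 1 * F x + (-1) * G x) = 0"
      using Cinf_lincomb[OF F(1,2), of 1 "-1"] F(3) by (intro kill) auto
    then show ?thesis using tangentD(1)[OF v F(1,2), of 1 "-1"] by simp
  qed
  define w where "w = (\<lambda>f. if f \<in> Cinf N then v (e f) else 0)"
  have "w \<in> tangent N p"
    unfolding tangent_def
  proof (intro CollectI conjI allI impI ballI)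
    fix f g a b assume fg: "f \<in> Cinf N" "g \<in> Cinf N"
    have C: "e f \<in> Cinf M" "e g \<in> Cinf M" using e fg by auto
    have "v (e (\<lambda>x. a * f x + b * g x)) = v (\<lambda>x. a * e f x + b * e g x)"
      using e[OF Cinf_lincomb[OF fg]] eN[OF Cinf_lincomb[OF fg]] eN fg Cinf_lincomb[OF C] by (intro wd) auto
    then show "w (\<lambda>x. a * f x + b * g x) = a * w f + b * w g"
      using tangentD(1)[OF v C] Cinf_lincomb[OF fg] fg by (simp add: w_def)
  next
    fix f g assume fg: "f \<in> Cinf N" "g \<in> Cinf N"
    have C: "e f \<in> Cinf M" "e g \<in> Cinf M" using e fg by auto
    have "v (e (\<lambda>x. f x * g x)) = v (\<lambda>x. e f x * e g x)"
      using e[OF Cinf_mult[OF fg]] eN[OF Cinf_mult[OF fg]] eN fg Cinf_mult[OF C] by (intro wd) auto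
    then show "w (\<lambda>x. f x * g x) = f p * w g + g p * w f"
      using tangentD(2)[OF v C] Cinf_mult[OF fg] fg eN p by (simp add: w_def)
  qed (simp add: w_def)
  moreover have "v = push N M (\<lambda>x. x) w"
  proof
    fix f
    show "v f = push N M (\<lambda>x. x) w f"
    proof (cases "f \<in> Cinf M")
      case True
      then have r: "?r f \<in> Cinf N" using restr by blast
      have "v (e (?r f)) = v f"
        using e[OF r] eN[OF r] True by (intro wd) (auto simp: pull_def)
      then show ?thesis using True r by (simp add: push_def w_def)
    qed (simp add: push_def tangentD(3)[OF v])
  qed
  ultimately show ?thesis unfolding tangent_sub_def by blast
qed

lemma tangent_sub_kills:
  assumes "v \<in> tangent_sub M N p" "f \<in> Cinf M" "\<And>x. x \<in> carr N \<Longrightarrow> f x = 0"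
  shows "v f = 0"
proof -
  obtain w where w: "w \<in> tangent N p" "v = push N M (\<lambda>x. x) w" using assms(1) unfolding tangent_sub_def by blast
  have "pull N (\<lambda>x. x) f = (\<lambda>x. 0)" using assms(3) by (auto simp: pull_def)
  then show ?thesis using w tangent_zero_fun[OF w(1)] assms(2) by (simp add: push_def)
qed

text \<open>The image is spanned by Hamiltonian vectors, and these kill the functions vanishing on \<open>N\<close>
  exactly when those functions form an ideal.\<close>

lemma sharp_image_iff_ideal:
  assumes M: "smooth_manifold M" and br: "nambu_structure M n br" and NM: "carr N \<subseteq> carr M"
    and restr: "pull N (\<lambda>x. x) ` Cinf M = Cinf N"
  shows "(\<forall>p\<in>carr N. nambu_sharp_image M n br p \<subseteq> tangent_sub M N p) \<longleftrightarrow> ideal_on M n br N (Cinf M)"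
proof
  assume sub: "\<forall>p\<in>carr N. nambu_sharp_image M n br p \<subseteq> tangent_sub M N p"
  show "ideal_on M n br N (Cinf M)"
    unfolding ideal_on_def
  proof (intro allI impI, elim conjE)
    fix gs h p
    assume gs: "length gs = n - 1" "set gs \<subseteq> Cinf M" and h: "h \<in> Cinf M" "\<forall>x\<in>carr N. h x = 0" and p: "p \<in> carr N"
    let ?\<alpha>s = "map (differential M p) gs"
    have \<alpha>s: "length ?\<alpha>s = n - 1" "set ?\<alpha>s \<subseteq> cotangent M p"
      using gs differential_cotangent[of _ M p] by auto
    have "(\<lambda>f. \<Sum>j<(1::nat). (\<lambda>j. 1) j * nambu_sharp M br p ((\<lambda>j. ?\<alpha>s) j) f) \<in> nambu_sharp_image M n br p"
      unfolding nambu_sharp_image_def using \<alpha>s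
      by (intro CollectI exI[of _ 1] exI[of _ "\<lambda>j. 1"] exI[of _ "\<lambda>j. ?\<alpha>s"]) auto
    then have "nambu_sharp M br p ?\<alpha>s \<in> tangent_sub M N p" using sub p by auto
    moreover have "nambu_sharp M br p ?\<alpha>s = hamiltonian_vec M br gs p"
      using nambu_sharp_eq[OF M br _ \<alpha>s gs] p NM by auto
    ultimately have "hamiltonian_vec M br gs p h = 0" using tangent_sub_kills h by metis
    then show "br (gs @ [h]) p = 0" using h(1) by (simp add: hamiltonian_vec_def)
  qed
next
  assume ideal: "ideal_on M n br N (Cinf M)"
  show "\<forall>p\<in>carr N. nambu_sharp_image M n br p \<subseteq> tangent_sub M N p"
  proof (intro ballI subsetI)
    fix p v assume p: "p \<in> carr N" and "v \<in> nambu_sharp_image M n br p"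
    then obtain m :: nat and c A where v: "v = (\<lambda>f. \<Sum>j<m. c j * nambu_sharp M br p (A j) f)"
      and A: "\<And>j. j < m \<Longrightarrow> length (A j) = n - 1 \<and> set (A j) \<subseteq> cotangent M p"
      unfolding nambu_sharp_image_def by blast
    have pM: "p \<in> carr M" using p NM by blast
    have j: "nambu_sharp M br p (A j) \<in> tangent M p \<and>
       (\<forall>f\<in>Cinf M. (\<forall>x\<in>carr N. f x = 0) \<longrightarrow> nambu_sharp M br p (A j) f = 0)" if j: "j < m" for j
    proof -
      obtain gs where gs: "length gs = n - 1" "set gs \<subseteq> Cinf M" "nambu_sharp M br p (A j) = hamiltonian_vec M br gs p"
        using nambu_sharp_hamiltonian[OF M br pM] A[OF j] by metis
      then show ?thesis
        using hamiltonian_tangent[OF br gs(1,2)] ideal p unfolding ideal_on_def by (simp add: hamiltonian_vec_def)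
    qed
    have "l \<le> m \<Longrightarrow> (\<lambda>f. \<Sum>j<l. c j * nambu_sharp M br p (A j) f) \<in> tangent M p" for l
    proof (induction l)
      case 0
      show ?case by (simp add: tangent_def)
    next
      case (Suc l)
      then show ?case
        using tangent_lincomb[OF Suc.IH, of "nambu_sharp M br p (A l)" 1 "c l"] j[of l] by simp
    qed
    then have "v \<in> tangent M p" unfolding v by blast
    moreover have "v f = 0" if "f \<in> Cinf M" "\<And>x. x \<in> carr N \<Longrightarrow> f x = 0" for f
      unfolding v using j that by (intro sum.neutral) auto
    ultimately show "v \<in> tangent_sub M N p" using tangent_sub_if_kills[OF restr p] by blast
  qed
qed

text \<open>A bracket on \<open>N\<close> compatible with the inclusion sees only restrictions to \<open>N\<close>, which gives the
  condition. Conversely the bracket descends by \<open>nambu_descends\<close>, with \<open>N\<close> itself for \<open>Q\<close> and all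
  smooth functions for \<open>A\<close>.\<close>

lemma nambu_submanifold_iff_ideal:
  assumes M: "smooth_manifold M" and br: "nambu_structure M n br" and sub: "submanifold M N"
    and restr: "pull N (\<lambda>x. x) ` Cinf M = Cinf N"
  shows "nambu_poisson_submanifold M n br N \<longleftrightarrow> ideal_on M n br N (Cinf M)"
proof
  let ?r = "pull N (\<lambda>x. x)"
  assume "nambu_poisson_submanifold M n br N"
  then obtain brN where brN: "nambu_structure N n brN"
    "\<And>fs. length fs = n \<Longrightarrow> set fs \<subseteq> Cinf M \<Longrightarrow> brN (map ?r fs) = ?r (br fs)"
    unfolding nambu_poisson_submanifold_def nambu_poisson_map_def by blast
  show "ideal_on M n br N (Cinf M)"
    unfolding ideal_on_def
  proof (intro allI impI, elim conjE)
    fix gs h p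
    assume gs: "length gs = n - 1" "set gs \<subseteq> Cinf M" and h: "h \<in> Cinf M" "\<forall>x\<in>carr N. h x = 0" and p: "p \<in> carr N"
    have rh: "?r h = (\<lambda>x. 0)" using h(2) by (auto simp: pull_def)
    have "brN (map ?r gs @ [\<lambda>x. 0]) = ?r (br (gs @ [h]))"
      using brN(2)[of "gs @ [h]"] gs h nambu_pos[OF br] rh by simp
    moreover have "brN (map ?r gs @ [\<lambda>x. 0]) = (\<lambda>x. 0)"
      using gs restr by (intro nambu_last_zero[OF brN(1)]) auto
    ultimately show "br (gs @ [h]) p = 0" using p pull_apply[OF p, of "\<lambda>x. x"] by metis
  qed
next
  let ?r = "pull N (\<lambda>x. x)"
  assume ideal: "ideal_on M n br N (Cinf M)"
  have rr: "?r (?r f) = ?r f" for f by (auto simp: pull_def)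
  have "\<exists>brN. nambu_structure N n brN \<and>
    (\<forall>fs Fs. length fs = n \<and> set fs \<subseteq> Cinf N \<and> length Fs = n \<and> set Fs \<subseteq> Cinf M \<and>
      (\<forall>k<n. ?r (Fs ! k) = ?r (fs ! k)) \<longrightarrow> ?r (brN fs) = ?r (br Fs))"
  proof (rule nambu_descends[OF br, where A = "Cinf M" and N = N and \<pi> = "\<lambda>x. x" and Q = N])
    show "\<exists>f\<in>Cinf N. ?r f = ?r G" if "G \<in> Cinf M" for G
      using rr restr that by blast
    show "\<exists>G\<in>Cinf M. ?r f = ?r G" if "f \<in> Cinf N" for f
      using rr restr that by (metis imageE)
    show "br (gs @ [h]) p = 0" if "length gs = n - 1" "set gs \<subseteq> Cinf M" "h \<in> Cinf M" "\<And>x. x \<in> carr N \<Longrightarrow> h x = 0"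
      "p \<in> carr N" for gs h p
      using ideal that unfolding ideal_on_def by blast
  qed (auto intro: Cinf_lincomb Cinf_mult nambu_closed[OF br])
  then obtain brN where brN: "nambu_structure N n brN"
    "\<And>fs Fs. length fs = n \<Longrightarrow> set fs \<subseteq> Cinf N \<Longrightarrow> length Fs = n \<Longrightarrow> set Fs \<subseteq> Cinf M \<Longrightarrow>
      (\<And>k. k < n \<Longrightarrow> ?r (Fs ! k) = ?r (fs ! k)) \<Longrightarrow> ?r (brN fs) = ?r (br Fs)"
    by blast
  have rN: "?r f = f" if "f \<in> Cinf N" for f
    using Cinf_off_carrier[OF that] by (auto simp: pull_def)
  have "brN (map ?r fs) = ?r (br fs)" if fs: "length fs = n" "set fs \<subseteq> Cinf M" for fs
  proof -
    have s: "set (map ?r fs) \<subseteq> Cinf N" using fs(2) restr by auto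
    have "?r (brN (map ?r fs)) = ?r (br fs)"
      using fs s rr by (intro brN(2)) auto
    then show ?thesis using rN[OF nambu_closed[OF brN(1) _ s]] fs(1) by simp
  qed
  moreover have "smooth_map N M (\<lambda>x. x)"
    using sub unfolding submanifold_def immersion_def by blast
  ultimately show "nambu_poisson_submanifold M n br N"
    unfolding nambu_poisson_submanifold_def nambu_poisson_map_def using sub brN(1) by blast
qed

text \<open>The inclusion is an immersion, so only the zero vector of \<open>N\<close> is mapped to zero.\<close>

lemma zero_subbundle_functions:
  assumes sub: "submanifold M N" and z: "zero_subbundle N E"
  shows "Cinf_along M (carr N) E = Cinf M" "Cinf_along N (carr N) (tangential_part M N E) = Cinf N"
proof -
  have E: "E p = {\<lambda>f. 0}" if "p \<in> carr N" for p using z that unfolding zero_subbundle_def by blast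
  show "Cinf_along M (carr N) E = Cinf M"
    unfolding Cinf_along_def differential_def by (auto simp: E)
  have "v = (\<lambda>f. 0)" if p: "p \<in> carr N" and v: "v \<in> tangential_part M N E p" for p v
  proof (rule inj_onD)
    show "inj_on (push N M (\<lambda>x. x)) (tangent N p)"
      using sub p unfolding submanifold_def immersion_def by blast
    show "v \<in> tangent N p" using v unfolding tangential_part_def by blast
    show "(\<lambda>f. 0) \<in> tangent N p" by (simp add: tangent_def)
    show "push N M (\<lambda>x. x) v = push N M (\<lambda>x. x) (\<lambda>f. 0)"
      using v E[OF p] unfolding tangential_part_def by (auto simp: push_def fun_eq_iff)
  qed
  then show "Cinf_along N (carr N) (tangential_part M N E) = Cinf N"
    unfolding Cinf_along_def differential_def by fastforce
qed

theorem proposition3p4: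
  fixes M :: "('a, 'e::euclidean_space) mfd"
    and N :: "('a, 'f::euclidean_space) mfd"
    and Q :: "('a set, 'g::euclidean_space) mfd"
    and n :: nat
    and br :: "('a \<Rightarrow> real) list \<Rightarrow> 'a \<Rightarrow> real"
    and E :: "'a \<Rightarrow> 'a tvec set"
  assumes "nambu_poisson_manifold M n br"
    and "submanifold M N"
    and "vector_subbundle M N E"
    and "canonical_subbundle M n br N E"
    and "regular_integrable_distribution N (tangential_part M N E) Q"
    and "pull N (\<lambda>x. x) ` Cinf_along M (carr N) E
           = Cinf_along N (carr N) (tangential_part M N E)"
  shows "(\<not> zero_subbundle N E \<longrightarrow> nambu_reducible M n br N E Q) \<and>
         (zero_subbundle N E \<longrightarrow>
           (nambu_reducible M n br N E Q \<longleftrightarrow>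
              (\<forall>p\<in>carr N. nambu_sharp_image M n br p \<subseteq> tangent_sub M N p)) \<and>
           ((\<forall>p\<in>carr N. nambu_sharp_image M n br p \<subseteq> tangent_sub M N p) \<longleftrightarrow>
              nambu_poisson_submanifold M n br N))"
proof -
  have M: "smooth_manifold M" and br: "nambu_structure M n br"
    using assms(1) unfolding nambu_poisson_manifold_def by auto
  have N: "smooth_manifold N" and NM: "carr N \<subseteq> carr M"
    using assms(2) unfolding submanifold_def by auto
  have red_iff: "nambu_reducible M n br N E Q \<longleftrightarrow> ideal_on M n br N (Cinf_along M (carr N) E)"
    using ideal_imp_reducible[OF N br assms(4-6)] reducible_imp_ideal[OF N br assms(5,6)] by blast
  show ?thesis
  proof (cases "zero_subbundle N E")
    case True
    note z = zero_subbundle_functions[OF assms(2) True]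
    have restr: "pull N (\<lambda>x. x) ` Cinf M = Cinf N" using assms(6) unfolding z .
    show ?thesis
      using True red_iff sharp_image_iff_ideal[OF M br NM restr]
        nambu_submanifold_iff_ideal[OF M br assms(2) restr] unfolding z by blast
  next
    case False
    then show ?thesis using red_iff canonical_ideal[OF br assms(3,4)] by blast
  qed
qed

end
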